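(* There is a randomized algorithm (ApproxXi) with the following guarantee. Given $q_0,q_1$ satisfying Assumption (A), an upper bound $\bar\zeta\geq\zeta^*$, and a failure probability $p>0$, with probability at least $1-p$ it outputs $\xi$ and $\hat\gamma$ such that $$\xi^*/4\leq\xi\leq\xi^*,\qquad\lambda_{\min}(A(\hat\gamma))\geq\xi,$$ and runs in time $$\tilde O\left(N\sqrt{\frac{\bar\zeta}{\xi^*}}\log\left(\frac{n}{p}\right)\log(\bar\zeta)\log\left(\frac{1}{\xi^*}\right)^3\right).$$
   Context: For symmetric $A_0,A_1\in\mathbb{R}^{n\times n}$, $b_0,b_1\in\mathbb{R}^n$, $c_0,c_1\in\mathbb{R}$, let $q_i(x)=x^\top A_ix+2b_i^\top x+c_i$ ($i=0,1$) and $A(\gamma)=A_0+\gamma A_1$. Assumption (A): $A_0$ and $A_1$ each have a negative eigenvalue, there exists $\gamma^*\geq 0$ with $A(\gamma^* )\succ 0$, and $\|A_0\|,\|A_1\|,\|b_0\|,\|b_1\|,|c_1|\leq 1$ (spectral norm for matrices, Euclidean norm for vectors). Under (A), $\Gamma:=\{\gamma\geq0: A(\gamma)\succeq 0\}$ is a nonempty compact interval $[\gamma_-,\gamma_+]$. $\xi^*:=\min\{1,\max_{\gamma\geq 0}\lambda_{\min}(A(\gamma))\}$, $\zeta^*:=\max\{1,\gamma_+\}$. $\lambda_{\min}$ is the smallest eigenvalue. $N$ is the number of nonzero entries of $A_0$ and $A_1$; $\tilde O$ hides $\log\log$ factors. *)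

theory Defs
  imports "HOL-Probability.Probability" "Jordan_Normal_Form.Char_Poly"
begin

no_notation Finite_Cartesian_Product.vec_nth (infixl \<open>$\<close> 90)
no_notation Inner_Product.real_inner_class.inner (infix \<open>\<bullet>\<close> 70)

section \<open>The problem data\<close>

definition vec_norm2 :: "real vec \<Rightarrow> real" where
  "vec_norm2 v = sqrt (v \<bullet> v)"

definition spectral_norm :: "real mat \<Rightarrow> real" where
  "spectral_norm A =
     Sup {vec_norm2 (A *\<^sub>v x) | x. x \<in> carrier_vec (dim_col A) \<and> vec_norm2 x = 1}"

definition pos_def :: "real mat \<Rightarrow> bool" where
  "pos_def A \<longleftrightarrow> A\<^sup>T = A \<and>
     (\<forall>x \<in> carrier_vec (dim_row A). x \<noteq> 0\<^sub>v (dim_row A) \<longrightarrow> x \<bullet> (A *\<^sub>v x) > 0)"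

definition pos_semidef :: "real mat \<Rightarrow> bool" where
  "pos_semidef A \<longleftrightarrow> A\<^sup>T = A \<and> (\<forall>x \<in> carrier_vec (dim_row A). x \<bullet> (A *\<^sub>v x) \<ge> 0)"

definition lambda_min :: "real mat \<Rightarrow> real" where
  "lambda_min A = Min {k. eigenvalue A k}"

definition pencil :: "real mat \<Rightarrow> real mat \<Rightarrow> real \<Rightarrow> real mat" where
  "pencil A0 A1 \<gamma> = A0 + \<gamma> \<cdot>\<^sub>m A1"

text \<open>The data describe \<open>q\<^sub>i(x) = x\<^sup>T A\<^sub>i x + 2 b\<^sub>i\<^sup>T x + c\<^sub>i\<close>; no bound is imposed on \<open>c\<^sub>0\<close>.\<close>

definition assumption_A ::
  "nat \<Rightarrow> real mat \<Rightarrow> real vec \<Rightarrow> real \<Rightarrow> real mat \<Rightarrow> real vec \<Rightarrow> real \<Rightarrow> bool" where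
  "assumption_A n A0 b0 c0 A1 b1 c1 \<longleftrightarrow>
     A0 \<in> carrier_mat n n \<and> A0\<^sup>T = A0 \<and> A1 \<in> carrier_mat n n \<and> A1\<^sup>T = A1 \<and>
     b0 \<in> carrier_vec n \<and> b1 \<in> carrier_vec n \<and>
     (\<exists>k<0. eigenvalue A0 k) \<and> (\<exists>k<0. eigenvalue A1 k) \<and>
     (\<exists>\<gamma>\<ge>0. pos_def (pencil A0 A1 \<gamma>)) \<and>
     spectral_norm A0 \<le> 1 \<and> spectral_norm A1 \<le> 1 \<and>
     vec_norm2 b0 \<le> 1 \<and> vec_norm2 b1 \<le> 1 \<and> \<bar>c1\<bar> \<le> 1"

definition Gamma_set :: "real mat \<Rightarrow> real mat \<Rightarrow> real set" where
  "Gamma_set A0 A1 = {\<gamma>. 0 \<le> \<gamma> \<and> pos_semidef (pencil A0 A1 \<gamma>)}"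

definition gamma_plus :: "real mat \<Rightarrow> real mat \<Rightarrow> real" where
  "gamma_plus A0 A1 = Sup (Gamma_set A0 A1)"

definition xi_star :: "real mat \<Rightarrow> real mat \<Rightarrow> real" where
  "xi_star A0 A1 = min 1 (SUP \<gamma>\<in>{0..}. lambda_min (pencil A0 A1 \<gamma>))"

definition zeta_star :: "real mat \<Rightarrow> real mat \<Rightarrow> real" where
  "zeta_star A0 A1 = max 1 (gamma_plus A0 A1)"

definition nonzeros :: "real mat \<Rightarrow> (nat \<times> nat) set" where
  "nonzeros A = {(i, j). i < dim_row A \<and> j < dim_col A \<and> A $$ (i, j) \<noteq> 0}"

section \<open>A randomized real RAM\<close>

text \<open>
  Algorithms are programs of a while language over a unit-cost real RAM.  Memory consists of
  named natural-number and real registers and of named, unbounded arrays of either kind.  Real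
  arithmetic is exact.  Naturals (used as addresses and counters) support only addition and
  truncated subtraction, there is no rounding from reals to naturals, and program constants are
  integers, so that neither real constants nor integer arithmetic can smuggle in extra power.
  Division by zero and square roots of negative numbers follow the totalised HOL functions.
\<close>

type_synonym vname = string

datatype nexp =
    NConst nat
  | NVar vname
  | NArr vname nexp
  | NAdd nexp nexp
  | NSub nexp nexp

datatype rexp =
    RConst int
  | RVar vname
  | RArr vname nexp
  | RAdd rexp rexp
  | RSub rexp rexp
  | RMul rexp rexp
  | RDiv rexp rexp
  | RSqrt rexp

datatype bexp =
    NLe nexp nexp
  | RLe rexp rexp
  | BNot bexp
  | BAnd bexp bexp

datatype com =
    Skip
  | NAssign vname nexp
  | RAssign vname rexp
  | NStore vname nexp nexp
  | RStore vname nexp rexp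
  | Draw vname
  | Seq com com
  | Cond bexp com com
  | While bexp com

record state =
  nvar :: "vname \<Rightarrow> nat"
  rvar :: "vname \<Rightarrow> real"
  narr :: "vname \<Rightarrow> nat \<Rightarrow> nat"
  rarr :: "vname \<Rightarrow> nat \<Rightarrow> real"
  drawn :: nat

primrec nval :: "nexp \<Rightarrow> state \<Rightarrow> nat" where
  "nval (NConst k) s = k"
| "nval (NVar x) s = nvar s x"
| "nval (NArr a e) s = narr s a (nval e s)"
| "nval (NAdd e f) s = nval e s + nval f s"
| "nval (NSub e f) s = nval e s - nval f s"

primrec rval :: "rexp \<Rightarrow> state \<Rightarrow> real" where
  "rval (RConst k) s = of_int k"
| "rval (RVar x) s = rvar s x"
| "rval (RArr a e) s = rarr s a (nval e s)"
| "rval (RAdd e f) s = rval e s + rval f s"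
| "rval (RSub e f) s = rval e s - rval f s"
| "rval (RMul e f) s = rval e s * rval f s"
| "rval (RDiv e f) s = rval e s / rval f s"
| "rval (RSqrt e) s = sqrt (rval e s)"

primrec bval :: "bexp \<Rightarrow> state \<Rightarrow> bool" where
  "bval (NLe e f) s \<longleftrightarrow> nval e s \<le> nval f s"
| "bval (RLe e f) s \<longleftrightarrow> rval e s \<le> rval f s"
| "bval (BNot b) s \<longleftrightarrow> \<not> bval b s"
| "bval (BAnd b c) s \<longleftrightarrow> bval b s \<and> bval c s"

text \<open>Evaluation costs one time unit per memory access, constant, operation and comparison.\<close>

primrec ncost :: "nexp \<Rightarrow> nat" where
  "ncost (NConst k) = 1"
| "ncost (NVar x) = 1"
| "ncost (NArr a e) = 1 + ncost e"
| "ncost (NAdd e f) = 1 + ncost e + ncost f"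
| "ncost (NSub e f) = 1 + ncost e + ncost f"

primrec rcost :: "rexp \<Rightarrow> nat" where
  "rcost (RConst k) = 1"
| "rcost (RVar x) = 1"
| "rcost (RArr a e) = 1 + ncost e"
| "rcost (RAdd e f) = 1 + rcost e + rcost f"
| "rcost (RSub e f) = 1 + rcost e + rcost f"
| "rcost (RMul e f) = 1 + rcost e + rcost f"
| "rcost (RDiv e f) = 1 + rcost e + rcost f"
| "rcost (RSqrt e) = 1 + rcost e"

primrec bcost :: "bexp \<Rightarrow> nat" where
  "bcost (NLe e f) = 1 + ncost e + ncost f"
| "bcost (RLe e f) = 1 + rcost e + rcost f"
| "bcost (BNot b) = 1 + bcost b"
| "bcost (BAnd b c) = 1 + bcost b + bcost c"

text \<open>
  \<open>exec \<omega> c s t s'\<close>: with random tape \<open>\<omega>\<close>, program \<open>c\<close> started in \<open>s\<close> halts in \<open>s'\<close>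
  after \<open>t\<close> time units.  Each \<open>Draw\<close> consumes the next unread tape cell.
\<close>

inductive exec :: "(nat \<Rightarrow> real) \<Rightarrow> com \<Rightarrow> state \<Rightarrow> nat \<Rightarrow> state \<Rightarrow> bool" for \<omega> where
  Skip: "exec \<omega> Skip s 1 s"
| NAssign: "exec \<omega> (NAssign x e) s (1 + ncost e) (s\<lparr>nvar := (nvar s)(x := nval e s)\<rparr>)"
| RAssign: "exec \<omega> (RAssign x e) s (1 + rcost e) (s\<lparr>rvar := (rvar s)(x := rval e s)\<rparr>)"
| NStore: "exec \<omega> (NStore a i e) s (1 + ncost i + ncost e)
    (s\<lparr>narr := (narr s)(a := (narr s a)(nval i s := nval e s))\<rparr>)"
| RStore: "exec \<omega> (RStore a i e) s (1 + ncost i + rcost e)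
    (s\<lparr>rarr := (rarr s)(a := (rarr s a)(nval i s := rval e s))\<rparr>)"
| Draw: "exec \<omega> (Draw x) s 1
    (s\<lparr>rvar := (rvar s)(x := \<omega> (drawn s)), drawn := Suc (drawn s)\<rparr>)"
| Seq: "exec \<omega> c s t s' \<Longrightarrow> exec \<omega> d s' u s'' \<Longrightarrow> exec \<omega> (Seq c d) s (t + u) s''"
| CondTrue: "bval b s \<Longrightarrow> exec \<omega> c s t s' \<Longrightarrow> exec \<omega> (Cond b c d) s (1 + bcost b + t) s'"
| CondFalse: "\<not> bval b s \<Longrightarrow> exec \<omega> d s t s' \<Longrightarrow> exec \<omega> (Cond b c d) s (1 + bcost b + t) s'"
| WhileFalse: "\<not> bval b s \<Longrightarrow> exec \<omega> (While b c) s (1 + bcost b) s"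
| WhileTrue: "bval b s \<Longrightarrow> exec \<omega> c s t s' \<Longrightarrow> exec \<omega> (While b c) s' u s'' \<Longrightarrow>
    exec \<omega> (While b c) s (1 + bcost b + t + u) s''"

inductive_cases exec_SkipE: "exec \<omega> Skip s t s'"
inductive_cases exec_NAssignE: "exec \<omega> (NAssign x e) s t s'"
inductive_cases exec_RAssignE: "exec \<omega> (RAssign x e) s t s'"
inductive_cases exec_NStoreE: "exec \<omega> (NStore a i e) s t s'"
inductive_cases exec_RStoreE: "exec \<omega> (RStore a i e) s t s'"
inductive_cases exec_DrawE: "exec \<omega> (Draw x) s t s'"
inductive_cases exec_SeqE: "exec \<omega> (Seq c d) s t s'"
inductive_cases exec_CondE: "exec \<omega> (Cond b c d) s t s'"
inductive_cases exec_WhileE: "exec \<omega> (While b c) s t s'"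

lemma exec_deterministic:
  "exec \<omega> c s t s' \<Longrightarrow> exec \<omega> c s u s'' \<Longrightarrow> u = t \<and> s'' = s'"
proof (induction arbitrary: u s'' rule: exec.induct)
  case (Skip s)
  then show ?case by (rule exec_SkipE) simp
next
  case (NAssign x e s)
  then show ?case by (rule exec_NAssignE) simp
next
  case (RAssign x e s)
  then show ?case by (rule exec_RAssignE) simp
next
  case (NStore a i e s)
  then show ?case by (rule exec_NStoreE) simp
next
  case (RStore a i e s)
  then show ?case by (rule exec_RStoreE) simp
next
  case (Draw x s)
  then show ?case by (rule exec_DrawE) simp
next
  case (Seq c s t s1 d u1 s2)
  from Seq.prems show ?case
  proof (rule exec_SeqE)
    fix t' s1' u'
    assume u: "u = t' + u'" and c: "exec \<omega> c s t' s1'" and d: "exec \<omega> d s1' u' s''"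
    from Seq.IH(1)[OF c] have "t' = t" "s1' = s1" by simp_all
    with Seq.IH(2) d u show ?thesis by simp
  qed
next
  case (CondTrue b s c t s1 d)
  from CondTrue.prems show ?case
  proof (rule exec_CondE)
    fix t' assume "u = Suc (bcost b + t')" and c: "exec \<omega> c s t' s''"
    then show ?thesis using CondTrue.IH[OF c] by simp
  qed (use CondTrue.hyps in simp)
next
  case (CondFalse b s d t s1 c)
  from CondFalse.prems show ?case
  proof (rule exec_CondE)
    fix t' assume "u = Suc (bcost b + t')" and d: "exec \<omega> d s t' s''"
    then show ?thesis using CondFalse.IH[OF d] by simp
  qed (use CondFalse.hyps in simp)
next
  case (WhileFalse b s c)
  from WhileFalse.prems show ?case
    by (rule exec_WhileE) (use WhileFalse.hyps in simp_all)
next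
  case (WhileTrue b s c t s1 u1 s2)
  from WhileTrue.prems show ?case
  proof (rule exec_WhileE)
    fix t' s1' u'
    assume u: "u = Suc (bcost b + t' + u')" and c: "exec \<omega> c s t' s1'"
      and w: "exec \<omega> (While b c) s1' u' s''"
    from WhileTrue.IH(1)[OF c] have "t' = t" "s1' = s1" by simp_all
    with WhileTrue.IH(2) w u show ?thesis by simp
  qed (use WhileTrue.hyps in simp)
qed

definition random_tape :: "(nat \<Rightarrow> real) measure" where
  "random_tape = (\<Pi>\<^sub>M i\<in>UNIV. uniform_measure lborel {0..1})"

section \<open>Input encoding and running-time bound\<close>

text \<open>
  Matrices are given in coordinate format: the positions of the nonzero entries are listed
  without repetition, in an arbitrary order.
\<close>

definition lists_nonzeros :: "(nat \<times> nat) list \<Rightarrow> real mat \<Rightarrow> bool" where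
  "lists_nonzeros xs A \<longleftrightarrow> distinct xs \<and> set xs = nonzeros A"

definition array_of :: "'a::zero list \<Rightarrow> nat \<Rightarrow> 'a" where
  "array_of xs k = (if k < length xs then xs ! k else 0)"

definition input_state ::
  "nat \<Rightarrow> real mat \<Rightarrow> real vec \<Rightarrow> real \<Rightarrow> real mat \<Rightarrow> real vec \<Rightarrow> real \<Rightarrow>
   (nat \<times> nat) list \<Rightarrow> (nat \<times> nat) list \<Rightarrow> real \<Rightarrow> real \<Rightarrow> state" where
  "input_state n A0 b0 c0 A1 b1 c1 xs0 xs1 \<zeta> p =
     \<lparr>nvar = (\<lambda>_. 0)(''n'' := n, ''nnz0'' := length xs0, ''nnz1'' := length xs1),
      rvar = (\<lambda>_. 0)(''c0'' := c0, ''c1'' := c1, ''zeta'' := \<zeta>, ''p'' := p),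
      narr = (\<lambda>_ _. 0)
        (''row0'' := array_of (map fst xs0), ''col0'' := array_of (map snd xs0),
         ''row1'' := array_of (map fst xs1), ''col1'' := array_of (map snd xs1)),
      rarr = (\<lambda>_ _. 0)
        (''val0'' := array_of (map (($$) A0) xs0), ''val1'' := array_of (map (($$) A1) xs1),
         ''b0'' := array_of (list_of_vec b0), ''b1'' := array_of (list_of_vec b1)),
      drawn = 0\<rparr>"

text \<open>
  Logarithms in a running-time bound are truncated below at 1: \<open>ln \<zeta>\<close> vanishes at \<open>\<zeta> = 1\<close> and
  \<open>ln (1/\<xi>\<^sup>*)\<close> can be arbitrarily close to 0, whereas every running time is positive.
\<close>

definition lg :: "real \<Rightarrow> real" where
  "lg x = max 1 (ln x)"

definition time_bound :: "nat \<Rightarrow> nat \<Rightarrow> real \<Rightarrow> real \<Rightarrow> real \<Rightarrow> real" where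
  "time_bound N n \<zeta> \<xi> p =
     real N * sqrt (\<zeta> / \<xi>) * lg (real n / p) * lg \<zeta> * lg (1 / \<xi>) ^ 3"

text \<open>The quantity of which a power is hidden by the soft-O notation.\<close>

definition loglog_factor :: "nat \<Rightarrow> real \<Rightarrow> real \<Rightarrow> real \<Rightarrow> real" where
  "loglog_factor n \<zeta> \<xi> p = lg (lg (real n / p)) * lg (lg \<zeta>) * lg (lg (1 / \<xi>))"

end

theory Submission
  imports Defs
begin

text \<open>
  Guess \<open>\<xi> = 1, 1/2, 1/4, \<dots>\<close> and, for each guess, bisect \<open>[0, \<zeta>]\<close> for a \<open>\<gamma>\<close> with
  \<open>\<lambda>\<^sub>m\<^sub>i\<^sub>n(A(\<gamma>)) \<ge> \<xi>\<close>.  At the midpoint \<open>\<gamma>\<close>, a random vector \<open>g\<close> is filtered by a polynomial in \<open>A(\<gamma>)\<close>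
  that is large below \<open>\<xi>\<close>.  If the result \<open>y\<close> has \<open>y\<^sup>T A(\<gamma>) y < (3/2) \<xi> y\<^sup>T y\<close>, the sign of
  \<open>y\<^sup>T A\<^sub>1 y\<close> tells on which side of \<open>\<gamma>\<close> every better multiplier lies; otherwise \<open>\<gamma>\<close> is accepted.
  Rejections are always justified, so the running time and the bound \<open>\<xi>\<^sup>*/4 \<le> \<xi>\<close> are deterministic.
  Acceptance can be wrong only if \<open>g\<close> is nearly orthogonal to an extremal eigenvector.  As \<open>g\<close> is
  fresh and the search state takes finitely many values, the failure probabilities just add up.

  The filter is the Chebyshev polynomial \<open>W\<^sub>m\<close> of the fourth kind.  Since \<open>(1 - b) W\<^sub>m(b)\<^sup>2 \<le> 2\<close> on
  \<open>[-1, 1]\<close>, the quadratic form of \<open>A(\<gamma>) - (3/2) \<xi>\<close> at the unwanted part of \<open>y\<close> is bounded by a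
  multiple of \<open>(1 + \<gamma>) g\<^sup>T g\<close>, and the degree \<open>O(sqrt (\<zeta>/\<xi>) log (n/p))\<close> needs no further factor \<open>log (\<zeta>/\<xi>)\<close>.
\<close>

section \<open>Quadratic forms and extremal eigenvalues\<close>

definition quad_form :: "real mat \<Rightarrow> real vec \<Rightarrow> real" where
  "quad_form A x = x \<bullet> (A *\<^sub>v x)"

lemma smult_mat_mult_vec:
  fixes A :: "'a :: comm_semiring_0 mat"
  assumes "A \<in> carrier_mat m n" "x \<in> carrier_vec n"
  shows "(k \<cdot>\<^sub>m A) *\<^sub>v x = k \<cdot>\<^sub>v (A *\<^sub>v x)"
  using assms by (intro eq_vecI) auto

lemma scalar_prod_self_nonneg: "0 \<le> x \<bullet> x" for x :: "real vec"
  by (simp add: scalar_prod_def sum_nonneg)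

lemma scalar_prod_self_eq_0_iff:
  fixes x :: "real vec"
  assumes "x \<in> carrier_vec n"
  shows "x \<bullet> x = 0 \<longleftrightarrow> x = 0\<^sub>v n"
  using assms by (auto simp: scalar_prod_def sum_nonneg_eq_0_iff)

lemma abs_scalar_prod_le:
  assumes "x \<in> carrier_vec n" "y \<in> carrier_vec n"
  shows "\<bar>x \<bullet> y\<bar> \<le> vec_norm2 x * vec_norm2 y"
proof -
  have "(x \<bullet> y)\<^sup>2 \<le> (x \<bullet> x) * (y \<bullet> y)"
    using assms Cauchy_Schwarz_ineq_sum[of "($) x" "($) y" "{0..<n}"]
    by (simp add: scalar_prod_def power2_eq_square)
  then have "sqrt ((x \<bullet> y)\<^sup>2) \<le> sqrt ((x \<bullet> x) * (y \<bullet> y))"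
    by (rule real_sqrt_le_mono)
  then show ?thesis
    by (simp add: vec_norm2_def real_sqrt_mult)
qed

lemma mult_mat_vec_scalar_prod_symmetric:
  fixes A :: "'a :: comm_semiring_1 mat"
  assumes "A \<in> carrier_mat n n" "A\<^sup>T = A" "x \<in> carrier_vec n" "y \<in> carrier_vec n"
  shows "(A *\<^sub>v x) \<bullet> y = x \<bullet> (A *\<^sub>v y)"
  using transpose_vec_mult_scalar[OF assms(1,4,3)] assms(2) by simp

lemma quad_form_eq_sum:
  assumes "A \<in> carrier_mat n n" "x \<in> carrier_vec n"
  shows "quad_form A x = (\<Sum>i<n. \<Sum>j<n. A $$ (i, j) * (x $ i * x $ j))"
proof -
  have "quad_form A x = (\<Sum>i<n. x $ i * (\<Sum>j<n. A $$ (i, j) * x $ j))"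
    using assms by (simp add: quad_form_def scalar_prod_def atLeast0LessThan)
  then show ?thesis
    by (simp add: sum_distrib_left mult_ac)
qed

lemma quad_form_smult:
  assumes "A \<in> carrier_mat n n" "x \<in> carrier_vec n"
  shows "quad_form A (c \<cdot>\<^sub>v x) = c\<^sup>2 * quad_form A x"
  using assms by (simp add: quad_form_def mult_mat_vec power2_eq_square)

lemma quad_form_add:
  assumes A: "A \<in> carrier_mat n n" "A\<^sup>T = A" and x: "x \<in> carrier_vec n" and y: "y \<in> carrier_vec n"
  shows "quad_form A (x + y) = quad_form A x + 2 * (y \<bullet> (A *\<^sub>v x)) + quad_form A y"
proof -
  have "x \<bullet> (A *\<^sub>v y) = y \<bullet> (A *\<^sub>v x)"
    using mult_mat_vec_scalar_prod_symmetric[OF A x y] A(1) x y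
    by (simp add: comm_scalar_prod[of y n])
  then show ?thesis
    using A(1) x y
    by (simp add: quad_form_def mult_add_distrib_mat_vec[of A n n] add_scalar_prod_distrib[of _ n]
        scalar_prod_add_distrib[of _ n])
qed

lemma quad_form_diff:
  assumes "A \<in> carrier_mat n n" "A\<^sup>T = A" and x: "x \<in> carrier_vec n" and y: "y \<in> carrier_vec n"
  shows "quad_form A (x - y) = quad_form A x - 2 * (y \<bullet> (A *\<^sub>v x)) + quad_form A y"
proof -
  have "x - y = x + (- 1) \<cdot>\<^sub>v y" using x y by (intro eq_vecI) auto
  moreover have "A *\<^sub>v x \<in> carrier_vec n" using assms by simp
  ultimately show ?thesis
    using assms quad_form_add[of A n x "(- 1) \<cdot>\<^sub>v y"] by (simp add: quad_form_smult)
qed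

lemma quad_form_char_matrix:
  assumes A: "A \<in> carrier_mat n n" and x: "x \<in> carrier_vec n"
  shows "quad_form (char_matrix A \<mu>) x = quad_form A x - \<mu> * (x \<bullet> x)"
proof -
  have "char_matrix A \<mu> *\<^sub>v x = A *\<^sub>v x + (- \<mu>) \<cdot>\<^sub>v x"
    using A x
    by (simp add: char_matrix_def add_mult_distrib_mat_vec[of A n n] smult_mat_mult_vec[of _ n n])
  then show ?thesis
    using A x by (simp add: quad_form_def scalar_prod_add_distrib[of _ n])
qed

lemma char_matrix_symmetric:
  fixes A :: "'a :: field mat"
  assumes "A \<in> carrier_mat n n" "A\<^sup>T = A"
  shows "(char_matrix A \<mu>)\<^sup>T = char_matrix A \<mu>"
proof -
  have "(- \<mu> \<cdot>\<^sub>m 1\<^sub>m n)\<^sup>T = - \<mu> \<cdot>\<^sub>m 1\<^sub>m n" by (intro eq_matI) auto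
  then show ?thesis
    using assms by (simp add: char_matrix_def transpose_add[of _ n n])
qed

lemma pos_semidef_quad_form_eq_0:
  assumes A: "A \<in> carrier_mat n n" and psd: "pos_semidef A"
    and x: "x \<in> carrier_vec n" and zero: "quad_form A x = 0"
  shows "A *\<^sub>v x = 0\<^sub>v n"
proof -
  define y where "y = A *\<^sub>v x"
  define q where "q = quad_form A y"
  define t where "t = (y \<bullet> y) / (1 + q)"
  have y: "y \<in> carrier_vec n" using A x by (simp add: y_def)
  have nonneg: "0 \<le> quad_form A z" if "z \<in> carrier_vec n" for z
    using psd that A by (auto simp: pos_semidef_def quad_form_def)
  have q: "0 \<le> q" unfolding q_def by (rule nonneg[OF y])
  have "0 \<le> quad_form A (x + (- t) \<cdot>\<^sub>v y)" using x y by (intro nonneg) simp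
  also have "\<dots> = t * (t * q - 2 * (y \<bullet> y))"
    using psd zero quad_form_add[OF A _ x, of "(- t) \<cdot>\<^sub>v y"] y
    by (simp add: pos_semidef_def quad_form_smult[OF A] y_def[symmetric] q_def[symmetric]
        power2_eq_square algebra_simps)
  also have "y \<bullet> y = t * (1 + q)" using q by (simp add: t_def)
  also have "t * (t * q - 2 * (t * (1 + q))) = - (t\<^sup>2 * (2 + q))"
    by (simp add: power2_eq_square algebra_simps)
  finally have "t = 0" using q by (simp add: mult_le_0_iff)
  then have "y \<bullet> y = 0" using q by (simp add: t_def)
  then show ?thesis using scalar_prod_self_eq_0_iff[OF y] by (simp add: y_def)
qed

lemma ex_unit_multiple:
  fixes x :: "real vec"
  assumes x: "x \<in> carrier_vec n" "x \<noteq> 0\<^sub>v n"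
  obtains c where "c\<^sup>2 * (x \<bullet> x) = 1" "(c \<cdot>\<^sub>v x) \<bullet> (c \<cdot>\<^sub>v x) = 1"
proof
  have "0 < x \<bullet> x"
    using x scalar_prod_self_nonneg[of x] by (simp add: scalar_prod_self_eq_0_iff less_le)
  then show "(1 / sqrt (x \<bullet> x))\<^sup>2 * (x \<bullet> x) = 1" by (simp add: power_divide)
  then show "((1 / sqrt (x \<bullet> x)) \<cdot>\<^sub>v x) \<bullet> ((1 / sqrt (x \<bullet> x)) \<cdot>\<^sub>v x) = 1"
    by (simp add: power2_eq_square)
qed

lemma quad_form_attains_min_on_sphere:
  assumes A: "A \<in> carrier_mat n n" and n: "0 < n"
  obtains e where "e \<in> carrier_vec n" "e \<bullet> e = 1"
    "\<And>x. x \<in> carrier_vec n \<Longrightarrow> x \<bullet> x = 1 \<Longrightarrow> quad_form A e \<le> quad_form A x"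
proof -
  let ?cube = "PiE UNIV (\<lambda>i. if i < n then {-1..1} else {0}) :: (nat \<Rightarrow> real) set"
  let ?sphere = "?cube \<inter> {f. vec n f \<bullet> vec n f = 1}"
  have on_sphere: "\<exists>f\<in>?sphere. vec n f = x" if x: "x \<in> carrier_vec n" "x \<bullet> x = 1" for x
  proof -
    let ?f = "\<lambda>i. if i < n then x $ i else 0"
    have vec: "vec n ?f = x" using x(1) by (intro eq_vecI) auto
    have "(x $ i)\<^sup>2 \<le> x \<bullet> x" if "i < n" for i
      using that x(1) member_le_sum[of i "{0..<n}" "\<lambda>i. (x $ i)\<^sup>2"]
      by (simp add: scalar_prod_def power2_eq_square)
    then have "\<bar>x $ i\<bar> \<le> 1" if "i < n" for i using that x(2) by (simp add: abs_square_le_1)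
    then have "?f \<in> ?cube" by (auto simp: abs_le_iff minus_le_iff)
    then show ?thesis using vec x(2) by (intro bexI[of _ ?f]) auto
  qed
  have coordinate: "continuous_on S (\<lambda>f::nat \<Rightarrow> real. f i)" for S i
    by (rule continuous_on_subset[OF continuous_on_product_coordinates]) simp
  have "compactin (product_topology (\<lambda>i. euclidean) UNIV) ?cube"
    by (auto simp: compactin_PiE)
  then have "compact ?cube" by (simp add: euclidean_product_topology)
  moreover have "closed {f. vec n f \<bullet> vec n f = (1 :: real)}"
    unfolding scalar_prod_def
    by (intro closed_Collect_eq) (auto intro!: continuous_intros coordinate)
  ultimately have compact: "compact ?sphere" by (rule compact_Int_closed)
  have "unit_vec n 0 \<bullet> unit_vec n 0 = (1 :: real)" using n by simp
  then have nonempty: "?sphere \<noteq> {}" using on_sphere[of "unit_vec n 0"] by auto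
  have "continuous_on ?sphere (\<lambda>f. quad_form A (vec n f))"
    using A by (auto simp: quad_form_eq_sum intro!: continuous_intros coordinate)
  from continuous_attains_inf[OF compact nonempty this]
  obtain f where f: "f \<in> ?sphere" "\<forall>g\<in>?sphere. quad_form A (vec n f) \<le> quad_form A (vec n g)"
    by blast
  show thesis
  proof (rule that[of "vec n f"])
    fix x :: "real vec" assume "x \<in> carrier_vec n" "x \<bullet> x = 1"
    then show "quad_form A (vec n f) \<le> quad_form A x" using on_sphere f(2) by blast
  qed (use f(1) in auto)
qed

text \<open>At a minimizer of the Rayleigh quotient \<open>A - \<mu>\<close> is positive semidefinite with vanishing form.\<close>

lemma symmetric_min_eigenvalue:
  assumes A: "A \<in> carrier_mat n n" and sym: "A\<^sup>T = A" and n: "0 < n"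
  obtains \<mu> where "eigenvalue A \<mu>" "\<And>x. x \<in> carrier_vec n \<Longrightarrow> \<mu> * (x \<bullet> x) \<le> quad_form A x"
proof -
  obtain e where e: "e \<in> carrier_vec n" "e \<bullet> e = 1"
    and min: "\<And>x. x \<in> carrier_vec n \<Longrightarrow> x \<bullet> x = 1 \<Longrightarrow> quad_form A e \<le> quad_form A x"
    using quad_form_attains_min_on_sphere[OF A n] by blast
  define \<mu> where "\<mu> = quad_form A e"
  have rayleigh: "\<mu> * (x \<bullet> x) \<le> quad_form A x" if x: "x \<in> carrier_vec n" for x
  proof (cases "x = 0\<^sub>v n")
    case True
    then show ?thesis using quad_form_eq_sum[OF A x] by simp
  next
    case False
    then obtain c where c: "c\<^sup>2 * (x \<bullet> x) = 1" "(c \<cdot>\<^sub>v x) \<bullet> (c \<cdot>\<^sub>v x) = 1"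
      using ex_unit_multiple[OF x] by blast
    then have "c\<^sup>2 * (\<mu> * (x \<bullet> x)) \<le> c\<^sup>2 * quad_form A x"
      using min[of "c \<cdot>\<^sub>v x"] x by (simp add: quad_form_smult[OF A] \<mu>_def mult.left_commute)
    moreover have "0 < c\<^sup>2" using c(1) by (cases "c = 0") auto
    ultimately show ?thesis by simp
  qed
  have "pos_semidef (char_matrix A \<mu>)"
    using rayleigh quad_form_char_matrix[OF A] carrier_matD(1)[OF char_matrix_closed[OF A]]
    by (simp add: pos_semidef_def char_matrix_symmetric[OF A sym] quad_form_def)
  moreover have "quad_form (char_matrix A \<mu>) e = 0"
    using e by (simp add: quad_form_char_matrix[OF A] \<mu>_def)
  ultimately have "char_matrix A \<mu> *\<^sub>v e = 0\<^sub>v n"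
    using A e(1) by (intro pos_semidef_quad_form_eq_0) auto
  moreover have "e \<noteq> 0\<^sub>v n" using e by auto
  ultimately have "eigenvalue A \<mu>" using e(1) eigenvalue_char_matrix[OF A] by auto
  then show thesis using that rayleigh by blast
qed

lemma eigenvalue_unit_eigenvector:
  fixes A :: "real mat"
  assumes A: "A \<in> carrier_mat n n" and "eigenvalue A k"
  obtains e where "e \<in> carrier_vec n" "e \<bullet> e = 1" "A *\<^sub>v e = k \<cdot>\<^sub>v e"
proof -
  obtain v where v: "v \<in> carrier_vec n" "v \<noteq> 0\<^sub>v n" "A *\<^sub>v v = k \<cdot>\<^sub>v v"
    using assms by (auto simp: eigenvalue_def eigenvector_def)
  obtain c where "(c \<cdot>\<^sub>v v) \<bullet> (c \<cdot>\<^sub>v v) = 1"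
    using ex_unit_multiple[OF v(1,2)] by blast
  moreover have "A *\<^sub>v (c \<cdot>\<^sub>v v) = k \<cdot>\<^sub>v (c \<cdot>\<^sub>v v)"
    using mult_mat_vec[OF A v(1), of c] v(3) by (simp add: smult_smult_assoc mult.commute)
  ultimately show thesis using that[of "c \<cdot>\<^sub>v v"] v(1) by simp
qed

lemma quad_form_unit_eigenvector:
  assumes "e \<in> carrier_vec n" "e \<bullet> e = 1" "A *\<^sub>v e = k \<cdot>\<^sub>v e"
  shows "quad_form A e = k"
  using assms by (simp add: quad_form_def)

lemma
  assumes A: "A \<in> carrier_mat n n" and "A\<^sup>T = A" and n: "0 < n"
  shows eigenvalue_lambda_min: "eigenvalue A (lambda_min A)"
    and lambda_min_le_quad_form: "x \<in> carrier_vec n \<Longrightarrow> lambda_min A * (x \<bullet> x) \<le> quad_form A x"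
proof -
  obtain \<mu> where \<mu>: "eigenvalue A \<mu>" "\<And>x. x \<in> carrier_vec n \<Longrightarrow> \<mu> * (x \<bullet> x) \<le> quad_form A x"
    using symmetric_min_eigenvalue[OF assms] by blast
  have "char_poly A \<noteq> 0" using degree_monic_char_poly[OF A] n by auto
  then have "finite {k. eigenvalue A k}"
    unfolding eigenvalue_root_char_poly[OF A] by (rule poly_roots_finite)
  then have "lambda_min A = \<mu>"
    unfolding lambda_min_def
  proof (rule Min_eqI)
    fix k assume "k \<in> {k. eigenvalue A k}"
    then obtain e where e: "e \<in> carrier_vec n" "e \<bullet> e = 1" "A *\<^sub>v e = k \<cdot>\<^sub>v e"
      using eigenvalue_unit_eigenvector[OF A] by auto
    then show "\<mu> \<le> k" using \<mu>(2)[of e] quad_form_unit_eigenvector[of e n A k] by simp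
  qed (use \<mu> in simp)
  with \<mu> show "eigenvalue A (lambda_min A)"
    and "x \<in> carrier_vec n \<Longrightarrow> lambda_min A * (x \<bullet> x) \<le> quad_form A x" by simp_all
qed

lemma vec_norm2_mult_mat_vec_le_Frobenius:
  assumes "A \<in> carrier_mat m n" "x \<in> carrier_vec n"
  shows "vec_norm2 (A *\<^sub>v x) \<le> sqrt (\<Sum>i<m. row A i \<bullet> row A i) * vec_norm2 x"
proof -
  have "(A *\<^sub>v x) \<bullet> (A *\<^sub>v x) = (\<Sum>i<m. (row A i \<bullet> x)\<^sup>2)"
    using assms by (simp add: scalar_prod_def[of "A *\<^sub>v x"] atLeast0LessThan power2_eq_square)
  also have "\<dots> \<le> (\<Sum>i<m. (row A i \<bullet> row A i) * (x \<bullet> x))"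
  proof (rule sum_mono)
    fix i
    have "\<bar>row A i \<bullet> x\<bar> \<le> \<bar>vec_norm2 (row A i) * vec_norm2 x\<bar>"
      using assms abs_scalar_prod_le[of "row A i" n x] row_carrier[of A i] by force
    then have "(row A i \<bullet> x)\<^sup>2 \<le> (vec_norm2 (row A i) * vec_norm2 x)\<^sup>2"
      by (simp only: abs_le_square_iff)
    then show "(row A i \<bullet> x)\<^sup>2 \<le> (row A i \<bullet> row A i) * (x \<bullet> x)"
      by (simp add: vec_norm2_def power_mult_distrib scalar_prod_self_nonneg)
  qed
  finally show ?thesis
    by (simp add: vec_norm2_def real_sqrt_mult[symmetric] sum_distrib_right[symmetric])
qed

lemma vec_norm2_mult_mat_vec_le:
  assumes A: "A \<in> carrier_mat m n" and x: "x \<in> carrier_vec n"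
  shows "vec_norm2 (A *\<^sub>v x) \<le> spectral_norm A * vec_norm2 x"
proof (cases "x = 0\<^sub>v n")
  case True
  then have "A *\<^sub>v x = 0\<^sub>v m" using A by (intro eq_vecI) auto
  then show ?thesis using True by (simp add: vec_norm2_def)
next
  case False
  let ?S = "{vec_norm2 (A *\<^sub>v x) | x. x \<in> carrier_vec (dim_col A) \<and> vec_norm2 x = 1}"
  have bdd: "bdd_above ?S"
    using A vec_norm2_mult_mat_vec_le_Frobenius[OF A]
    by (intro bdd_aboveI[of _ "sqrt (\<Sum>i<m. row A i \<bullet> row A i)"]) fastforce
  have norm_smult: "vec_norm2 (c \<cdot>\<^sub>v y) = \<bar>c\<bar> * vec_norm2 y" for c y
    by (simp add: vec_norm2_def real_sqrt_mult mult.assoc[symmetric])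
  obtain c where c: "c\<^sup>2 * (x \<bullet> x) = 1" "(c \<cdot>\<^sub>v x) \<bullet> (c \<cdot>\<^sub>v x) = 1"
    using ex_unit_multiple[OF x False] by blast
  then have unit: "vec_norm2 (c \<cdot>\<^sub>v x) = 1" unfolding vec_norm2_def by (metis real_sqrt_one)
  then have "vec_norm2 (A *\<^sub>v (c \<cdot>\<^sub>v x)) \<le> spectral_norm A"
    unfolding spectral_norm_def using A x by (intro cSup_upper bdd) auto
  then have "\<bar>c\<bar> * vec_norm2 (A *\<^sub>v x) \<le> \<bar>c\<bar> * (spectral_norm A * vec_norm2 x)"
    using unit by (simp add: mult_mat_vec[OF A x] norm_smult mult.left_commute)
  moreover have "0 < \<bar>c\<bar>" using c(1) by (cases "c = 0") auto
  ultimately show ?thesis by simp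
qed

lemma abs_quad_form_le_spectral_norm:
  assumes A: "A \<in> carrier_mat n n" and x: "x \<in> carrier_vec n"
  shows "\<bar>quad_form A x\<bar> \<le> spectral_norm A * (x \<bullet> x)"
proof -
  have "\<bar>quad_form A x\<bar> \<le> vec_norm2 x * vec_norm2 (A *\<^sub>v x)"
    unfolding quad_form_def using assms by (intro abs_scalar_prod_le) auto
  also have "\<dots> \<le> vec_norm2 x * (spectral_norm A * vec_norm2 x)"
    by (intro mult_left_mono vec_norm2_mult_mat_vec_le[OF A x])
      (simp add: vec_norm2_def scalar_prod_self_nonneg)
  also have "\<dots> = spectral_norm A * (x \<bullet> x)"
    using scalar_prod_self_nonneg[of x] by (simp add: vec_norm2_def)
  finally show ?thesis .
qed

section \<open>Chebyshev filters\<close>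

text \<open>The Chebyshev polynomials \<open>W\<^sub>m(cos \<theta>) = sin ((m + 1/2) \<theta>) / sin (\<theta>/2)\<close> of the fourth kind and
  \<open>V\<^sub>m(cos \<theta>) = cos ((m + 1/2) \<theta>) / cos (\<theta>/2)\<close> of the third kind; the coupled recursion is the
  pair of addition formulas.\<close>

fun chebW chebV :: "real \<Rightarrow> nat \<Rightarrow> real" where
  "chebW x 0 = 1"
| "chebW x (Suc m) = x * (chebW x m + chebV x m) + chebV x m"
| "chebV x 0 = 1"
| "chebV x (Suc m) = x * (chebW x m + chebV x m) - chebW x m"

fun chebW_vec chebV_vec :: "real mat \<Rightarrow> real vec \<Rightarrow> nat \<Rightarrow> real vec" where
  "chebW_vec B g 0 = g"
| "chebW_vec B g (Suc m) = B *\<^sub>v (chebW_vec B g m + chebV_vec B g m) + chebV_vec B g m"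
| "chebV_vec B g 0 = g"
| "chebV_vec B g (Suc m) = B *\<^sub>v (chebW_vec B g m + chebV_vec B g m) - chebW_vec B g m"

lemma chebWV_cosh:
  "chebW (cosh t) m * sinh (t / 2) = sinh ((real m + 1 / 2) * t) \<and>
   chebV (cosh t) m * cosh (t / 2) = cosh ((real m + 1 / 2) * t)"
proof (induction m)
  case (Suc m)
  define a b c s where "a = sinh ((real m + 1 / 2) * t)" and "b = cosh ((real m + 1 / 2) * t)"
    and "c = cosh (t / 2)" and "s = sinh (t / 2)"
  let ?W = "chebW (cosh t) m" and ?V = "chebV (cosh t) m"
  have IH: "?W * s = a" "?V * c = b" using Suc by (simp_all add: a_def b_def c_def s_def)
  have cs: "c\<^sup>2 = s\<^sup>2 + 1" by (simp add: c_def s_def cosh_square_eq)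
  have t: "cosh t = c\<^sup>2 + s\<^sup>2" "sinh t = 2 * s * c"
    using cosh_double[of "t / 2"] sinh_double[of "t / 2"] by (simp_all add: c_def s_def)
  have Suc_t: "(real (Suc m) + 1 / 2) * t = (real m + 1 / 2) * t + t" by (simp add: algebra_simps)
  have sinh: "sinh ((real (Suc m) + 1 / 2) * t) = a * cosh t + b * sinh t"
    and cosh: "cosh ((real (Suc m) + 1 / 2) * t) = b * cosh t + a * sinh t"
    unfolding Suc_t sinh_add cosh_add by (simp_all add: a_def b_def)
  have "(cosh t * (?W + ?V) + ?V) * s = cosh t * (?W * s) + (cosh t + 1) * ?V * s"
    by (simp add: algebra_simps)
  also have "cosh t + 1 = 2 * c\<^sup>2" using t(1) cs by simp
  also have "cosh t * (?W * s) + 2 * c\<^sup>2 * ?V * s = a * cosh t + b * sinh t"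
    unfolding t(2) IH[symmetric] by (simp add: power2_eq_square)
  finally have W: "chebW (cosh t) (Suc m) * s = a * cosh t + b * sinh t" by simp
  have "(cosh t * (?W + ?V) - ?W) * c = cosh t * (?V * c) + (cosh t - 1) * ?W * c"
    by (simp add: algebra_simps)
  also have "cosh t - 1 = 2 * s\<^sup>2" using t(1) cs by simp
  also have "cosh t * (?V * c) + 2 * s\<^sup>2 * ?W * c = b * cosh t + a * sinh t"
    unfolding t(2) IH[symmetric] by (simp add: power2_eq_square)
  finally have V: "chebV (cosh t) (Suc m) * c = b * cosh t + a * sinh t" by simp
  show ?case using W V unfolding sinh cosh by (simp add: c_def s_def)
qed simp

lemma chebW_growth:
  assumes \<eta>: "0 < \<eta>" "\<eta> \<le> 1" and T: "0 \<le> T" and m: "2 * ln (2 * T + 2) / sqrt \<eta> \<le> real m"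
  shows "T\<^sup>2 \<le> \<eta> * (chebW (1 + \<eta>) m)\<^sup>2"
proof -
  define t where "t = arcosh (1 + \<eta>)"
  define x where "x = (real m + 1 / 2) * t"
  have t: "cosh t = 1 + \<eta>" "0 \<le> t" using \<eta> by (simp_all add: t_def)
  have "sqrt \<eta> / 2 \<le> t"
  proof -
    have root: "0 \<le> sqrt \<eta>" "sqrt \<eta> \<le> 1" using \<eta> by simp_all
    have "exp (sqrt \<eta> / 2) \<le> 1 + sqrt \<eta> / 2 + (sqrt \<eta> / 2)\<^sup>2"
      by (rule exp_bound) (use root in linarith)+
    also have "(sqrt \<eta> / 2)\<^sup>2 = \<eta> / 4" using \<eta> by (simp add: power_divide)
    also have "1 + sqrt \<eta> / 2 + \<eta> / 4 \<le> 1 + \<eta> + sqrt \<eta>" using root(1) \<eta>(1) by linarith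
    also have "sqrt \<eta> \<le> sqrt ((1 + \<eta>)\<^sup>2 - 1)" using \<eta> by (simp add: power2_eq_square algebra_simps)
    also have "1 + \<eta> + sqrt ((1 + \<eta>)\<^sup>2 - 1) = exp t"
      using \<eta> t(1) sinh_arcosh_real[of "1 + \<eta>"] by (simp add: t_def flip: cosh_plus_sinh)
    finally show ?thesis by simp
  qed
  then have "real m * (sqrt \<eta> / 2) \<le> x"
    unfolding x_def using t(2) \<eta> by (intro mult_mono) auto
  moreover have "ln (2 * T + 2) \<le> real m * (sqrt \<eta> / 2)" using m \<eta> by (simp add: field_simps)
  ultimately have "ln (2 * T + 2) \<le> x" by linarith
  then have "exp (ln (2 * T + 2)) \<le> exp x" by simp
  then have "2 * T + 2 \<le> exp x" using T by simp
  moreover have "exp x - 1 \<le> 2 * sinh x" using t(2) by (simp add: sinh_field_def x_def)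
  ultimately have "T \<le> sinh x" by linarith
  then have "T\<^sup>2 \<le> (sinh x)\<^sup>2" using T by (rule power_mono)
  then have "T\<^sup>2 \<le> 2 * (sinh x)\<^sup>2" using zero_le_power2[of "sinh x"] by linarith
  also have "\<dots> = 2 * (chebW (1 + \<eta>) m * sinh (t / 2))\<^sup>2"
    using chebWV_cosh[of t m] by (simp add: x_def t(1))
  also have "\<dots> = (cosh t - 1) * (chebW (1 + \<eta>) m)\<^sup>2"
    using cosh_double[of "t / 2"] by (simp add: power_mult_distrib cosh_square_eq)
  finally show ?thesis by (simp add: t(1))
qed

lemma chebWV_mono:
  assumes "1 \<le> x" "x \<le> y"
  shows "1 \<le> chebW x m \<and> 1 \<le> chebV x m \<and> chebW x m \<le> chebW y m \<and> chebV x m \<le> chebV y m"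
proof (induction m)
  case (Suc m)
  let ?W = "chebW x m" and ?V = "chebV x m" and ?W' = "chebW y m" and ?V' = "chebV y m"
  have IH: "1 \<le> ?W" "1 \<le> ?V" "?W \<le> ?W'" "?V \<le> ?V'" using Suc by simp_all
  have "1 * 1 \<le> x * ?V" "1 * ?W \<le> x * ?W"
    using assms IH by (intro mult_mono; simp)+
  moreover have "x * ?V \<le> y * ?V'" "(x - 1) * ?W \<le> (y - 1) * ?W'" "x * ?W \<le> y * ?W'"
    using assms IH by (intro mult_mono; simp)+
  ultimately show ?case
    using IH unfolding chebW.simps chebV.simps distrib_left left_diff_distrib
    by (intro conjI; linarith)
qed simp

lemma cheb_vec_carrier:
  assumes "B \<in> carrier_mat n n" "g \<in> carrier_vec n"
  shows "chebW_vec B g m \<in> carrier_vec n \<and> chebV_vec B g m \<in> carrier_vec n"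
  using assms by (induction m) simp_all

lemmas chebW_vec_carrier [simp] = cheb_vec_carrier[THEN conjunct1]
  and chebV_vec_carrier [simp] = cheb_vec_carrier[THEN conjunct2]

lemma cheb_vec_add:
  assumes B: "B \<in> carrier_mat n n" and g: "g \<in> carrier_vec n" and h: "h \<in> carrier_vec n"
  shows "chebW_vec B (g + h) m = chebW_vec B g m + chebW_vec B h m \<and>
         chebV_vec B (g + h) m = chebV_vec B g m + chebV_vec B h m"
proof (induction m)
  case (Suc m)
  let ?w = "chebW_vec B g m" and ?v = "chebV_vec B g m" and ?w' = "chebW_vec B h m"
    and ?v' = "chebV_vec B h m"
  have carrier: "?w \<in> carrier_vec n" "?v \<in> carrier_vec n" "?w' \<in> carrier_vec n"
    "?v' \<in> carrier_vec n"
    using assms by simp_all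
  then have "(?w + ?w') + (?v + ?v') = (?w + ?v) + (?w' + ?v')" by (intro eq_vecI) auto
  then have "B *\<^sub>v ((?w + ?w') + (?v + ?v')) = B *\<^sub>v (?w + ?v) + B *\<^sub>v (?w' + ?v')"
    using carrier mult_add_distrib_mat_vec[OF B, of "?w + ?v" "?w' + ?v'"] by simp
  then show ?case
    using carrier B Suc by (auto intro!: eq_vecI simp del: index_mult_mat_vec)
qed simp

lemma cheb_vec_eigenvector:
  assumes B: "B \<in> carrier_mat n n" and e: "e \<in> carrier_vec n" "B *\<^sub>v e = \<beta> \<cdot>\<^sub>v e"
  shows "chebW_vec B (a \<cdot>\<^sub>v e) m = (a * chebW \<beta> m) \<cdot>\<^sub>v e \<and>
         chebV_vec B (a \<cdot>\<^sub>v e) m = (a * chebV \<beta> m) \<cdot>\<^sub>v e"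
proof (induction m)
  case (Suc m)
  have "B *\<^sub>v ((a * chebW \<beta> m) \<cdot>\<^sub>v e + (a * chebV \<beta> m) \<cdot>\<^sub>v e)
      = (a * (chebW \<beta> m + chebV \<beta> m) * \<beta>) \<cdot>\<^sub>v e"
    using e by (simp add: add_smult_distrib_vec[symmetric] mult_mat_vec[OF B] smult_smult_assoc
        distrib_left[symmetric])
  then show ?case using Suc by (auto intro!: eq_vecI simp: algebra_simps)
qed simp

lemma cheb_vec_orthogonal:
  assumes B: "B \<in> carrier_mat n n" "B\<^sup>T = B" and e: "e \<in> carrier_vec n" "B *\<^sub>v e = \<beta> \<cdot>\<^sub>v e"
    and h: "h \<in> carrier_vec n" "h \<bullet> e = 0"
  shows "chebW_vec B h m \<bullet> e = 0 \<and> chebV_vec B h m \<bullet> e = 0"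
proof (induction m)
  case (Suc m)
  have "(B *\<^sub>v x) \<bullet> e = \<beta> * (x \<bullet> e)" if "x \<in> carrier_vec n" for x
    using mult_mat_vec_scalar_prod_symmetric[OF B that e(1)] e that by simp
  then show ?case
    using Suc B(1) h(1) e(1)
    by (simp add: add_scalar_prod_distrib[of _ n] minus_scalar_prod_distrib[of _ n])
qed (use h in simp)

text \<open>The operator form of \<open>(1 - cos \<theta>) W\<^sub>m\<^sup>2 + (1 + cos \<theta>) V\<^sub>m\<^sup>2 = 2\<close>.\<close>

lemma cheb_vec_energy:
  assumes B: "B \<in> carrier_mat n n" "B\<^sup>T = B" and h: "h \<in> carrier_vec n"
  shows "chebW_vec B h m \<bullet> chebW_vec B h m - quad_form B (chebW_vec B h m) +
    (chebV_vec B h m \<bullet> chebV_vec B h m + quad_form B (chebV_vec B h m)) = 2 * (h \<bullet> h)"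
proof (induction m)
  case (Suc m)
  define w v where "w = chebW_vec B h m" and "v = chebV_vec B h m"
  define b where "b = B *\<^sub>v (w + v)"
  have w: "w \<in> carrier_vec n" and v: "v \<in> carrier_vec n" and b: "b \<in> carrier_vec n"
    and Bb: "B *\<^sub>v b \<in> carrier_vec n" and Bw: "B *\<^sub>v w \<in> carrier_vec n"
    and Bv: "B *\<^sub>v v \<in> carrier_vec n"
    using B h by (simp_all add: w_def v_def b_def)
  note bilinear = add_scalar_prod_distrib[of _ n] scalar_prod_add_distrib[of _ n]
    minus_scalar_prod_distrib[of _ n] scalar_prod_minus_distrib[of _ n]
  note comm = comm_scalar_prod[of _ n]
  have Bwv: "b = B *\<^sub>v w + B *\<^sub>v v" unfolding b_def by (rule mult_add_distrib_mat_vec[OF B(1) w v])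
  have "b \<bullet> b = (w + v) \<bullet> (B *\<^sub>v b)"
    unfolding b_def using B w v by (intro mult_mat_vec_scalar_prod_symmetric) auto
  then have bb: "b \<bullet> b = w \<bullet> (B *\<^sub>v b) + v \<bullet> (B *\<^sub>v b)" using w v Bb by (simp add: bilinear)
  have "w \<bullet> (B *\<^sub>v v) = v \<bullet> (B *\<^sub>v w)"
    using mult_mat_vec_scalar_prod_symmetric[OF B w v] comm[OF Bw v] by simp
  then have cross: "b \<bullet> v - b \<bullet> w = quad_form B v - quad_form B w"
    unfolding Bwv quad_form_def using w v Bw Bv by (simp add: bilinear comm)
  have "(b + v) \<bullet> (b + v) + (b - w) \<bullet> (b - w) = 2 * (b \<bullet> b) + v \<bullet> v + w \<bullet> w + 2 * (b \<bullet> v - b \<bullet> w)"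
    using w v b by (simp add: bilinear comm[of v b] comm[of w b])
  moreover have "quad_form B (b + v) - quad_form B (b - w) =
      2 * (b \<bullet> b) + quad_form B v - quad_form B w"
    unfolding quad_form_add[OF B b v] quad_form_diff[OF B b w] bb by simp
  ultimately show ?case
    using Suc cross by (simp flip: w_def v_def b_def)
qed simp

lemma chebW_vec_quad_form_large:
  assumes B: "B \<in> carrier_mat n n" "B\<^sup>T = B"
    and lower: "\<And>x. x \<in> carrier_vec n \<Longrightarrow> - (x \<bullet> x) \<le> quad_form B x"
    and e: "e \<in> carrier_vec n" "e \<bullet> e = 1" "B *\<^sub>v e = \<beta> \<cdot>\<^sub>v e" and g: "g \<in> carrier_vec n"
    and large: "2 * (g \<bullet> g) < (g \<bullet> e)\<^sup>2 * ((\<beta> - 1) * (chebW \<beta> m)\<^sup>2)"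
  shows "chebW_vec B g m \<bullet> chebW_vec B g m < quad_form B (chebW_vec B g m)"
proof -
  define a where "a = g \<bullet> e"
  define h where "h = g - a \<cdot>\<^sub>v e"
  define r where "r = chebW_vec B h m"
  define z where "z = (a * chebW \<beta> m) \<cdot>\<^sub>v e"
  have h: "h \<in> carrier_vec n" and r: "r \<in> carrier_vec n" and z: "z \<in> carrier_vec n"
    using B g e(1) by (simp_all add: h_def r_def z_def)
  have he: "h \<bullet> e = 0" using g e by (simp add: h_def minus_scalar_prod_distrib[of _ n] a_def)
  have "h \<bullet> h = h \<bullet> g"
    using g e(1) h he by (subst (2) h_def) (simp add: scalar_prod_minus_distrib[of _ n])
  also have "\<dots> = g \<bullet> g - a\<^sup>2"
    using g e(1) by (simp add: h_def minus_scalar_prod_distrib[of _ n] comm_scalar_prod[of e n g]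
        a_def power2_eq_square)
  finally have hh: "h \<bullet> h \<le> g \<bullet> g" by simp
  have "a \<cdot>\<^sub>v e + h = g" using g e(1) by (auto intro!: eq_vecI simp: h_def)
  then have y: "chebW_vec B g m = z + r"
    using cheb_vec_add[OF B(1) _ h, of "a \<cdot>\<^sub>v e" m]
      cheb_vec_eigenvector[OF B(1) e(1,3), of a m] e(1)
    by (simp add: z_def r_def)
  have re: "r \<bullet> e = 0" using cheb_vec_orthogonal[OF B e(1,3) h he] by (simp add: r_def)
  have "B *\<^sub>v z = \<beta> \<cdot>\<^sub>v z"
    using mult_mat_vec[OF B(1) e(1)] e(3) by (simp add: z_def smult_smult_assoc mult.commute)
  then have "quad_form B (z + r) = \<beta> * (z \<bullet> z) + 2 * (\<beta> * (r \<bullet> z)) + quad_form B r"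
    using z r by (simp add: quad_form_add[OF B z r] quad_form_def[of B z])
  moreover have "(z + r) \<bullet> (z + r) = z \<bullet> z + 2 * (r \<bullet> z) + r \<bullet> r"
    using z r by (simp add: add_scalar_prod_distrib[of _ n] scalar_prod_add_distrib[of _ n]
        comm_scalar_prod[of z n r])
  moreover have "r \<bullet> z = 0" "z \<bullet> z = (a * chebW \<beta> m)\<^sup>2"
    using r e re by (simp_all add: z_def power2_eq_square)
  ultimately have "quad_form B (z + r) - (z + r) \<bullet> (z + r) =
      a\<^sup>2 * ((\<beta> - 1) * (chebW \<beta> m)\<^sup>2) - (r \<bullet> r - quad_form B r)"
    by (simp add: power_mult_distrib algebra_simps)
  moreover have "r \<bullet> r - quad_form B r \<le> 2 * (h \<bullet> h)"
    using cheb_vec_energy[OF B h, of m] lower[of "chebV_vec B h m"] B(1) h by (simp add: r_def)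
  ultimately show ?thesis using large hh by (simp add: y a_def)
qed

text \<open>The affine image of \<open>M\<close> that moves the eigenvalue \<open>3\<xi>/2\<close> to 1 and, if \<open>M \<le> L\<close>, larger ones
  into \<open>[-1, 1]\<close>; an eigenvalue below \<open>\<xi>\<close> is moved beyond \<open>1 + \<xi>/L\<close>.\<close>

definition filter_mat :: "real \<Rightarrow> real \<Rightarrow> real mat \<Rightarrow> real mat" where
  "filter_mat \<xi> L M = (1 + 3 * \<xi> / L) \<cdot>\<^sub>m 1\<^sub>m (dim_row M) + (- 2 / L) \<cdot>\<^sub>m M"

lemma filter_mat_carrier [simp]: "M \<in> carrier_mat n n \<Longrightarrow> filter_mat \<xi> L M \<in> carrier_mat n n"
  by (auto simp: filter_mat_def)

lemma filter_mat_symmetric: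
  assumes "M \<in> carrier_mat n n" "M\<^sup>T = M"
  shows "(filter_mat \<xi> L M)\<^sup>T = filter_mat \<xi> L M"
proof -
  have "M $$ (j, i) = M $$ (i, j)" if "i < n" "j < n" for i j
    using assms that index_transpose_mat(1)[of i M j] by auto
  then show ?thesis using assms by (intro eq_matI) (auto simp: filter_mat_def)
qed

lemma filter_mat_mult_vec:
  assumes "M \<in> carrier_mat n n" "x \<in> carrier_vec n"
  shows "filter_mat \<xi> L M *\<^sub>v x = (1 + 3 * \<xi> / L) \<cdot>\<^sub>v x + (- 2 / L) \<cdot>\<^sub>v (M *\<^sub>v x)"
  using assms
  by (simp add: filter_mat_def add_mult_distrib_mat_vec[of _ n n] smult_mat_mult_vec[of _ n n])

lemma quad_form_filter_mat:
  assumes "M \<in> carrier_mat n n" "x \<in> carrier_vec n"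
  shows "quad_form (filter_mat \<xi> L M) x = (1 + 3 * \<xi> / L) * (x \<bullet> x) - 2 / L * quad_form M x"
  using assms by (simp add: quad_form_def filter_mat_mult_vec scalar_prod_add_distrib[of _ n])

lemma chebyshev_filter_detects:
  assumes M: "M \<in> carrier_mat n n" "M\<^sup>T = M" and L: "0 < L" and \<xi>: "0 < \<xi>"
    and upper: "\<And>x. x \<in> carrier_vec n \<Longrightarrow> quad_form M x \<le> L * (x \<bullet> x)"
    and e: "e \<in> carrier_vec n" "e \<bullet> e = 1" "M *\<^sub>v e = \<mu> \<cdot>\<^sub>v e" and \<mu>: "\<mu> < \<xi>"
    and g: "g \<in> carrier_vec n"
    and large: "2 * (g \<bullet> g) < (g \<bullet> e)\<^sup>2 * T\<^sup>2"
    and T: "T\<^sup>2 \<le> \<xi> / L * (chebW (1 + \<xi> / L) m)\<^sup>2"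
  defines "y \<equiv> chebW_vec (filter_mat \<xi> L M) g m"
  shows "2 * quad_form M y < 3 * \<xi> * (y \<bullet> y)"
proof -
  let ?B = "filter_mat \<xi> L M"
  define \<beta> where "\<beta> = 1 + 3 * \<xi> / L - 2 / L * \<mu>"
  have "2 / L * \<mu> \<le> 2 / L * \<xi>" using \<mu> L by (intro mult_left_mono) auto
  moreover have "3 * \<xi> / L = \<xi> / L + 2 / L * \<xi>" by (simp add: add_divide_distrib[symmetric])
  ultimately have \<beta>: "1 + \<xi> / L \<le> \<beta>" unfolding \<beta>_def by linarith
  have \<eta>: "0 < \<xi> / L" using \<xi> L by simp
  have eB: "?B *\<^sub>v e = \<beta> \<cdot>\<^sub>v e"
    unfolding filter_mat_mult_vec[OF M(1) e(1)] e(3)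
    using e(1) by (intro eq_vecI) (auto simp: \<beta>_def algebra_simps)
  have lower: "- (x \<bullet> x) \<le> quad_form ?B x" if x: "x \<in> carrier_vec n" for x
  proof -
    have "2 / L * quad_form M x \<le> 2 / L * (L * (x \<bullet> x))"
      using upper[OF x] L by (intro mult_left_mono) auto
    moreover have "2 / L * (L * (x \<bullet> x)) = 2 * (x \<bullet> x)" using L by simp
    moreover have "0 \<le> 3 * \<xi> / L * (x \<bullet> x)" using \<xi> L scalar_prod_self_nonneg[of x] by simp
    ultimately show ?thesis unfolding quad_form_filter_mat[OF M(1) x] distrib_right by linarith
  qed
  have W: "1 \<le> chebW (1 + \<xi> / L) m" "chebW (1 + \<xi> / L) m \<le> chebW \<beta> m"
    using chebWV_mono[OF _ \<beta>, of m] \<eta> by simp_all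
  have "T\<^sup>2 \<le> (\<beta> - 1) * (chebW \<beta> m)\<^sup>2"
    using T by (rule order_trans) (use W \<beta> \<eta> in \<open>intro mult_mono power_mono, auto\<close>)
  then have "(g \<bullet> e)\<^sup>2 * T\<^sup>2 \<le> (g \<bullet> e)\<^sup>2 * ((\<beta> - 1) * (chebW \<beta> m)\<^sup>2)"
    by (intro mult_left_mono) auto
  with large have "2 * (g \<bullet> g) < (g \<bullet> e)\<^sup>2 * ((\<beta> - 1) * (chebW \<beta> m)\<^sup>2)" by linarith
  then have "y \<bullet> y < quad_form ?B y"
    unfolding y_def by (intro chebW_vec_quad_form_large[OF _ _ lower e(1,2) eB g])
      (simp_all add: M filter_mat_symmetric[OF M])
  also have "\<dots> = y \<bullet> y + (3 * \<xi> * (y \<bullet> y) - 2 * quad_form M y) / L"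
    using M g by (subst quad_form_filter_mat[OF M(1)])
      (simp_all add: y_def diff_divide_distrib algebra_simps)
  finally show ?thesis using L by (simp add: zero_less_divide_iff)
qed

definition cheb_degree :: "real \<Rightarrow> real \<Rightarrow> nat" where
  "cheb_degree \<eta> T = (LEAST m. T\<^sup>2 \<le> \<eta> * (chebW (1 + \<eta>) m)\<^sup>2)"

lemma less_cheb_degree: "m < cheb_degree \<eta> T \<Longrightarrow> \<eta> * (chebW (1 + \<eta>) m)\<^sup>2 < T\<^sup>2"
  using not_less_Least unfolding cheb_degree_def by force

lemma
  assumes \<eta>: "0 < \<eta>" "\<eta> \<le> 1" and T: "0 \<le> T"
  shows cheb_degree_reaches: "T\<^sup>2 \<le> \<eta> * (chebW (1 + \<eta>) (cheb_degree \<eta> T))\<^sup>2"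
    and cheb_degree_le: "real (cheb_degree \<eta> T) \<le> 1 + 2 * ln (2 * T + 2) / sqrt \<eta>"
proof -
  define m where "m = nat \<lceil>2 * ln (2 * T + 2) / sqrt \<eta>\<rceil>"
  have "2 * ln (2 * T + 2) / sqrt \<eta> \<le> real m" unfolding m_def by (rule real_nat_ceiling_ge)
  note reached = chebW_growth[OF \<eta> T this]
  from reached show "T\<^sup>2 \<le> \<eta> * (chebW (1 + \<eta>) (cheb_degree \<eta> T))\<^sup>2"
    unfolding cheb_degree_def by (rule LeastI)
  have "cheb_degree \<eta> T \<le> m"
    unfolding cheb_degree_def by (rule Least_le) (rule reached)
  moreover have "0 \<le> 2 * ln (2 * T + 2) / sqrt \<eta>" using T \<eta> by simp
  then have "real m \<le> 1 + 2 * ln (2 * T + 2) / sqrt \<eta>" unfolding m_def by linarith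
  ultimately show "real (cheb_degree \<eta> T) \<le> 1 + 2 * ln (2 * T + 2) / sqrt \<eta>" by linarith
qed

section \<open>The random tape\<close>

abbreviation uniform01 :: "real measure" where
  "uniform01 \<equiv> uniform_measure lborel {0..1}"

interpretation uniform01: prob_space uniform01
  by (rule prob_space_uniform_measure) auto

interpretation random_tape: prob_space random_tape
  unfolding random_tape_def by (rule prob_space_PiM) (rule uniform01.prob_space_axioms)

lemma space_random_tape [simp]: "space random_tape = UNIV"
  by (simp add: random_tape_def space_PiM)

lemma measurable_random_tape_component [measurable]:
  "(\<lambda>\<omega>. \<omega> i) \<in> borel_measurable random_tape"
proof -
  have "(\<lambda>\<omega>. \<omega> i) \<in> measurable random_tape uniform01"
    unfolding random_tape_def by measurable
  then show ?thesis by (simp cong: measurable_cong_sets)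
qed

lemma random_tape_sets_Collect:
  "Measurable.pred random_tape P \<Longrightarrow> {\<omega>. P \<omega>} \<in> sets random_tape"
  unfolding pred_def by simp

lemma
  shows sets_unit_cube: "{\<omega>. \<forall>i. \<omega> i \<in> {0..1}} \<in> sets random_tape"
    and prob_unit_cube: "measure random_tape {\<omega>. \<forall>i. \<omega> i \<in> {0..1}} = 1"
proof -
  show sets: "{\<omega>. \<forall>i. \<omega> i \<in> {0..1}} \<in> sets random_tape"
    by (rule random_tape_sets_Collect) measurable
  have "AE x in uniform01. x \<in> {0..1}" by (rule AE_uniform_measureI) auto
  then have "AE \<omega> in random_tape. \<omega> i \<in> {0..1}" for i
    unfolding random_tape_def by (intro AE_PiM_component uniform01.prob_space_axioms) auto
  then have "AE \<omega> in random_tape. \<forall>i. \<omega> i \<in> {0..1}" by (simp add: AE_all_countable)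
  then show "measure random_tape {\<omega>. \<forall>i. \<omega> i \<in> {0..1}} = 1"
    by (intro random_tape.prob_eq_1[THEN iffD2] sets) simp
qed

lemma emeasure_uniform01_affine_le:
  assumes a: "a \<noteq> 0" and \<tau>: "0 \<le> \<tau>"
  shows "emeasure uniform01 {x. \<bar>b + a * x\<bar> \<le> \<tau>} \<le> ennreal (2 * \<tau> / \<bar>a\<bar>)"
proof -
  let ?I = "{- b / a - \<tau> / \<bar>a\<bar> .. - b / a + \<tau> / \<bar>a\<bar>}"
  have "\<bar>x + b / a\<bar> \<le> \<tau> / \<bar>a\<bar>" if "\<bar>b + a * x\<bar> \<le> \<tau>" for x
  proof -
    have "b + a * x = a * (x + b / a)" using a by (simp add: field_simps)
    then have "\<bar>a\<bar> * \<bar>x + b / a\<bar> \<le> \<tau>" using that by (simp only: abs_mult)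
    then show ?thesis using a by (simp add: pos_le_divide_eq mult.commute)
  qed
  then have "{x. \<bar>b + a * x\<bar> \<le> \<tau>} \<subseteq> ?I" by (force simp: abs_le_iff)
  then have "emeasure uniform01 {x. \<bar>b + a * x\<bar> \<le> \<tau>} \<le> emeasure uniform01 ?I"
    by (rule emeasure_mono) simp
  also have "\<dots> \<le> emeasure lborel ?I" by (auto simp: divide_ennreal_def intro!: emeasure_mono)
  also have "\<dots> = ennreal (2 * \<tau> / \<bar>a\<bar>)"
    using divide_nonneg_nonneg[OF \<tau> abs_ge_zero[of a]] by (subst emeasure_lborel_Icc) simp_all
  finally show ?thesis .
qed

lemma emeasure_random_tape_resample:
  assumes D: "D \<in> sets random_tape"
  shows "emeasure random_tape D = (\<integral>\<^sup>+\<omega>. emeasure uniform01 {x. fun_upd \<omega> m x \<in> D} \<partial>random_tape)"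
proof -
  interpret pair_prob_space uniform01 random_tape ..
  let ?F = "\<lambda>(x, \<omega>::nat \<Rightarrow> real). fun_upd \<omega> m x"
  have F: "?F \<in> measurable (uniform01 \<Otimes>\<^sub>M random_tape) random_tape"
    unfolding random_tape_def
  proof (rule measurable_PiM_single')
    fix i
    show "(\<lambda>\<omega>. ?F \<omega> i) \<in> measurable (uniform01 \<Otimes>\<^sub>M Pi\<^sub>M UNIV (\<lambda>i. uniform01)) uniform01"
      by (cases "i = m") (simp_all add: case_prod_beta)
  qed simp
  have "random_tape = distr (uniform01 \<Otimes>\<^sub>M random_tape) random_tape ?F"
    unfolding random_tape_def
    using distr_pair_PiM_eq_PiM[of UNIV "\<lambda>_. uniform01" m, symmetric,
        OF uniform01.prob_space_axioms uniform01.prob_space_axioms] by (simp only: insert_UNIV)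
  then have "emeasure random_tape D = emeasure (distr (uniform01 \<Otimes>\<^sub>M random_tape) random_tape ?F) D"
    by (rule arg_cong)
  also have "\<dots> = emeasure (uniform01 \<Otimes>\<^sub>M random_tape) (?F -` D \<inter> space (uniform01 \<Otimes>\<^sub>M random_tape))"
    by (rule emeasure_distr[OF F D])
  also have "\<dots> = (\<integral>\<^sup>+\<omega>. emeasure uniform01
      ((\<lambda>x. (x, \<omega>)) -` (?F -` D \<inter> space (uniform01 \<Otimes>\<^sub>M random_tape))) \<partial>random_tape)"
    by (rule emeasure_pair_measure_alt2) (rule measurable_sets[OF F D])
  finally show ?thesis by (simp add: space_pair_measure vimage_def)
qed

lemma random_tape_small_ball_cell:
  assumes A: "A \<in> sets random_tape" "\<And>\<omega> x. fun_upd \<omega> m x \<in> A \<longleftrightarrow> \<omega> \<in> A"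
    and f: "f \<in> borel_measurable random_tape" "\<And>\<omega> x. f (fun_upd \<omega> m x) = f \<omega>"
    and a: "a \<noteq> 0" and \<tau>: "0 \<le> \<tau>"
  shows "measure random_tape {\<omega>\<in>A. \<bar>f \<omega> + a * \<omega> m\<bar> \<le> \<tau>} \<le> 2 * \<tau> / \<bar>a\<bar> * measure random_tape A"
proof -
  let ?D = "{\<omega>. \<omega> \<in> A \<and> \<bar>f \<omega> + a * \<omega> m\<bar> \<le> \<tau>}"
  note [measurable] = A(1) f(1)
  have "?D \<in> sets random_tape" by (rule random_tape_sets_Collect) measurable
  then have "emeasure random_tape ?D
      = (\<integral>\<^sup>+\<omega>. emeasure uniform01 {x. fun_upd \<omega> m x \<in> ?D} \<partial>random_tape)"
    by (rule emeasure_random_tape_resample)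
  also have "\<dots> \<le> (\<integral>\<^sup>+\<omega>. ennreal (2 * \<tau> / \<bar>a\<bar>) * indicator A \<omega> \<partial>random_tape)"
    using emeasure_uniform01_affine_le[OF a \<tau>]
    by (intro nn_integral_mono) (simp add: A(2) f(2) indicator_def)
  also have "\<dots> = ennreal (2 * \<tau> / \<bar>a\<bar>) * emeasure random_tape A"
    using A(1) by (simp add: nn_integral_cmult_indicator)
  finally have "ennreal (measure random_tape ?D) \<le> ennreal (2 * \<tau> / \<bar>a\<bar> * measure random_tape A)"
    using \<tau> by (subst ennreal_mult) (simp_all add: random_tape.emeasure_eq_measure)
  then show ?thesis using \<tau> by (subst (asm) ennreal_le_iff) auto
qed

lemma unit_vector_large_coordinate:
  fixes e :: "real vec"
  assumes e: "e \<in> carrier_vec n" "e \<bullet> e = 1"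
  obtains i where "i < n" "1 / sqrt (real n) \<le> \<bar>e $ i\<bar>"
proof -
  have n: "0 < n" using e by (cases n) (auto simp: scalar_prod_def)
  have "\<exists>i<n. 1 / real n \<le> (e $ i)\<^sup>2"
  proof (rule ccontr)
    assume "\<not> ?thesis"
    then have "e \<bullet> e < (\<Sum>i<n. 1 / real n)"
      using e(1) n unfolding scalar_prod_def atLeast0LessThan carrier_vecD[OF e(1)]
      by (intro sum_strict_mono) (auto simp: power2_eq_square not_le)
    then show False using e(2) n by simp
  qed
  then obtain i where "i < n" "(1 / sqrt (real n))\<^sup>2 \<le> (e $ i)\<^sup>2"
    using n by (auto simp: power_divide)
  then show thesis using that by (simp add: abs_le_square_iff[symmetric])
qed

definition tape_block :: "nat \<Rightarrow> nat \<Rightarrow> (nat \<Rightarrow> real) \<Rightarrow> real vec" where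
  "tape_block n c \<omega> = vec n (\<lambda>i. \<omega> (c + i))"

lemma tape_block_carrier [simp]: "tape_block n c \<omega> \<in> carrier_vec n"
  by (simp add: tape_block_def)

lemma tape_block_scalar_prod:
  "e \<in> carrier_vec n \<Longrightarrow> tape_block n c \<omega> \<bullet> e = (\<Sum>j<n. \<omega> (c + j) * e $ j)"
  by (simp add: tape_block_def scalar_prod_def atLeast0LessThan)

lemma cheb_vec_tape_block_measurable:
  assumes B: "B \<in> carrier_mat n n" and "i < n"
  shows "(\<lambda>\<omega>. chebW_vec B (tape_block n c \<omega>) m $ i) \<in> borel_measurable random_tape \<and>
    (\<lambda>\<omega>. chebV_vec B (tape_block n c \<omega>) m $ i) \<in> borel_measurable random_tape"
  using assms(2)
proof (induction m arbitrary: i)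
  case 0
  then show ?case by (simp add: tape_block_def)
next
  case (Suc m)
  let ?w = "\<lambda>\<omega>. chebW_vec B (tape_block n c \<omega>) m" and ?v = "\<lambda>\<omega>. chebV_vec B (tape_block n c \<omega>) m"
  have [measurable]: "(\<lambda>\<omega>. ?w \<omega> $ j) \<in> borel_measurable random_tape"
    "(\<lambda>\<omega>. ?v \<omega> $ j) \<in> borel_measurable random_tape" if "j < n" for j
    using Suc.IH[OF that] by simp_all
  have dim: "dim_vec (?w \<omega>) = n" "dim_vec (?v \<omega>) = n" for \<omega>
    using B by (auto intro!: carrier_vecD)
  have "(B *\<^sub>v (?w \<omega> + ?v \<omega>)) $ i = (\<Sum>j<n. B $$ (i, j) * (?w \<omega> $ j + ?v \<omega> $ j))" for \<omega>
    using B Suc.prems by (simp add: dim scalar_prod_def atLeast0LessThan)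
  then show ?case using Suc.prems by (simp add: dim del: index_mult_mat_vec)
qed

lemma random_tape_small_ball_block:
  assumes A: "A \<in> sets random_tape"
    and depends: "\<And>\<omega> \<omega>'. (\<forall>i<c. \<omega> i = \<omega>' i) \<Longrightarrow> \<omega> \<in> A \<longleftrightarrow> \<omega>' \<in> A"
    and e: "e \<in> carrier_vec n" "e \<bullet> e = 1" and \<tau>: "0 \<le> \<tau>"
  shows "measure random_tape {\<omega>\<in>A. \<bar>tape_block n c \<omega> \<bullet> e\<bar> \<le> \<tau>}
      \<le> 2 * \<tau> * sqrt (real n) * measure random_tape A"
proof -
  obtain i where i: "i < n" "1 / sqrt (real n) \<le> \<bar>e $ i\<bar>"
    using unit_vector_large_coordinate[OF e] by blast
  have pos: "0 < 1 / sqrt (real n)" using i(1) by simp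
  then have ei: "0 < \<bar>e $ i\<bar>" using i(2) by linarith
  let ?rest = "\<lambda>\<omega>. \<Sum>j\<in>{..<n} - {i}. \<omega> (c + j) * e $ j"
  have "tape_block n c \<omega> \<bullet> e = ?rest \<omega> + e $ i * \<omega> (c + i)" for \<omega>
    unfolding tape_block_scalar_prod[OF e(1)] using i(1)
    by (subst sum.remove[of _ i]) (auto simp: mult.commute)
  moreover have "measure random_tape {\<omega>\<in>A. \<bar>?rest \<omega> + e $ i * \<omega> (c + i)\<bar> \<le> \<tau>}
      \<le> 2 * \<tau> / \<bar>e $ i\<bar> * measure random_tape A"
  proof (rule random_tape_small_ball_cell[OF A])
    show "fun_upd \<omega> (c + i) x \<in> A \<longleftrightarrow> \<omega> \<in> A" for \<omega> x by (rule depends) auto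
    show "?rest \<in> borel_measurable random_tape" by measurable
    show "?rest (fun_upd \<omega> (c + i) x) = ?rest \<omega>" for \<omega> x by (intro sum.cong) auto
  qed (use ei \<tau> in auto)
  moreover have "2 * \<tau> / \<bar>e $ i\<bar> * measure random_tape A
      \<le> 2 * \<tau> * sqrt (real n) * measure random_tape A"
  proof (rule mult_right_mono)
    have "2 * \<tau> / \<bar>e $ i\<bar> \<le> 2 * \<tau> / (1 / sqrt (real n))"
      using i(2) ei pos \<tau> by (intro divide_left_mono mult_pos_pos) auto
    then show "2 * \<tau> / \<bar>e $ i\<bar> \<le> 2 * \<tau> * sqrt (real n)" by simp
  qed simp
  ultimately show ?thesis by (simp only:)
qed

text \<open>The direction \<open>e\<close> may depend on the earlier tape cells through finitely many states \<open>\<sigma>\<close>: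
  condition on the state.\<close>

lemma random_tape_small_ball_adaptive:
  fixes \<sigma> :: "(nat \<Rightarrow> real) \<Rightarrow> 's"
  assumes fin: "finite (range \<sigma>)" and meas: "\<And>s. {\<omega>. \<sigma> \<omega> = s} \<in> sets random_tape"
    and depends: "\<And>\<omega> \<omega>'. (\<forall>i<c. \<omega> i = \<omega>' i) \<Longrightarrow> \<sigma> \<omega> = \<sigma> \<omega>'"
    and e: "\<And>s. e s \<in> carrier_vec n" "\<And>s. e s \<bullet> e s = 1" and \<tau>: "0 \<le> \<tau>"
  defines "D \<equiv> {\<omega>. \<bar>tape_block n c \<omega> \<bullet> e (\<sigma> \<omega>)\<bar> \<le> \<tau>}"
  shows "D \<in> sets random_tape" and "measure random_tape D \<le> 2 * \<tau> * sqrt (real n)"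
proof -
  let ?A = "\<lambda>s. {\<omega>. \<sigma> \<omega> = s}"
  let ?D = "\<lambda>s. {\<omega>\<in>?A s. \<bar>tape_block n c \<omega> \<bullet> e s\<bar> \<le> \<tau>}"
  have depends_A: "\<omega> \<in> ?A s \<longleftrightarrow> \<omega>' \<in> ?A s" if "\<forall>i<c. \<omega> i = \<omega>' i" for s \<omega> \<omega>'
    by (simp add: depends[OF that])
  have D_s: "?D s \<in> sets random_tape" for s
  proof -
    have "{\<omega>. \<bar>tape_block n c \<omega> \<bullet> e s\<bar> \<le> \<tau>} \<in> sets random_tape"
      unfolding tape_block_scalar_prod[OF e(1)] by (rule random_tape_sets_Collect) measurable
    then have "?A s \<inter> {\<omega>. \<bar>tape_block n c \<omega> \<bullet> e s\<bar> \<le> \<tau>} \<in> sets random_tape"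
      by (rule sets.Int[OF meas])
    then show ?thesis by (simp add: Int_def)
  qed
  have D: "D = (\<Union>s\<in>range \<sigma>. ?D s)" by (auto simp: D_def)
  show "D \<in> sets random_tape" unfolding D using D_s fin by (intro sets.finite_UN) auto
  have "measure random_tape D \<le> (\<Sum>s\<in>range \<sigma>. measure random_tape (?D s))"
    unfolding D using fin D_s by (intro random_tape.finite_measure_subadditive_finite) auto
  also have "\<dots> \<le> (\<Sum>s\<in>range \<sigma>. 2 * \<tau> * sqrt (real n) * measure random_tape (?A s))"
    by (intro sum_mono random_tape_small_ball_block meas depends_A e \<tau>)
  also have "\<dots> = 2 * \<tau> * sqrt (real n) * measure random_tape (\<Union>s\<in>range \<sigma>. ?A s)"
    using fin meas by (subst random_tape.finite_measure_finite_Union)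
      (auto simp: disjoint_family_on_def sum_distrib_left)
  also have "\<dots> \<le> 2 * \<tau> * sqrt (real n) * 1"
    using \<tau> by (intro mult_left_mono random_tape.prob_le_1) auto
  finally show "measure random_tape D \<le> 2 * \<tau> * sqrt (real n)" by simp
qed

lemma sums_inverse_pronic: "(\<lambda>k. p / ((real k + 1) * (real k + 2))) sums p"
proof -
  have "(\<lambda>k. p / (real k + 1) - p / (real (Suc k) + 1)) sums (p / (real 0 + 1) - 0)"
    by (rule telescope_sums') real_asymp
  moreover have "p / (real k + 1) - p / (real (Suc k) + 1)
      = p / ((real k + 1) * (real k + 2))" for k
    by (simp add: field_simps)
  ultimately show ?thesis by simp
qed

lemma (in prob_space) prob_UN_le_pronic:
  assumes F: "\<And>k. F k \<in> events" and le: "\<And>k. prob (F k) \<le> p / ((real k + 1) * (real k + 2))"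
  shows "prob (\<Union>k. F k) \<le> p"
proof -
  note sums = sums_inverse_pronic[of p]
  have summable: "summable (\<lambda>k. prob (F k))"
    using le by (intro summable_comparison_test'[OF sums_summable[OF sums], of 0]) auto
  have "prob (\<Union>k. F k) \<le> (\<Sum>k. prob (F k))"
    using F summable by (intro finite_measure_subadditive_countably) auto
  also have "\<dots> \<le> (\<Sum>k. p / ((real k + 1) * (real k + 2)))"
    by (intro suminf_le le summable sums_summable[OF sums])
  also have "\<dots> = p" using sums by (rule sums_unique[symmetric])
  finally show ?thesis .
qed

section \<open>Definite pencils\<close>

locale definite_pencil =
  fixes n :: nat and A0 A1 :: "real mat"
  assumes A0: "A0 \<in> carrier_mat n n" "A0\<^sup>T = A0" and A1: "A1 \<in> carrier_mat n n" "A1\<^sup>T = A1"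
    and negative_eigenvalues: "\<exists>k<0. eigenvalue A0 k" "\<exists>k<0. eigenvalue A1 k"
    and ex_pos_def: "\<exists>\<gamma>\<ge>0. pos_def (pencil A0 A1 \<gamma>)"
    and spectral_norms: "spectral_norm A0 \<le> 1" "spectral_norm A1 \<le> 1"
begin

abbreviation "A \<equiv> pencil A0 A1"
abbreviation "lmin \<gamma> \<equiv> lambda_min (A \<gamma>)"
abbreviation "\<xi>star \<equiv> xi_star A0 A1"

lemma n_pos: "0 < n"
  using negative_eigenvalues(1) eigenvalue_imp_nonzero_dim[OF A0(1)] by auto

lemma pencil_carrier [simp]: "A \<gamma> \<in> carrier_mat n n"
  using A0 A1 by (auto simp: pencil_def)

lemma pencil_dim [simp]: "dim_row (A \<gamma>) = n" "dim_col (A \<gamma>) = n"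
  using carrier_matD[OF pencil_carrier] by auto

lemma pencil_symmetric: "(A \<gamma>)\<^sup>T = A \<gamma>"
proof -
  have "(\<gamma> \<cdot>\<^sub>m A1)\<^sup>T = \<gamma> \<cdot>\<^sub>m A1\<^sup>T" by (intro eq_matI) auto
  then show ?thesis using A0 A1 by (simp add: pencil_def transpose_add[of _ n n])
qed

lemma pencil_mult_vec:
  "x \<in> carrier_vec n \<Longrightarrow> A \<gamma> *\<^sub>v x = A0 *\<^sub>v x + \<gamma> \<cdot>\<^sub>v (A1 *\<^sub>v x)"
  using A0 A1
  by (simp add: pencil_def add_mult_distrib_mat_vec[of _ n n] smult_mat_mult_vec[of _ n n])

lemma quad_form_pencil:
  "x \<in> carrier_vec n \<Longrightarrow> quad_form (A \<gamma>) x = quad_form A0 x + \<gamma> * quad_form A1 x"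
  using A0 A1 by (simp add: quad_form_def pencil_mult_vec scalar_prod_add_distrib[of _ n])

lemma abs_quad_form_le:
  assumes "x \<in> carrier_vec n"
  shows "\<bar>quad_form A0 x\<bar> \<le> x \<bullet> x" "\<bar>quad_form A1 x\<bar> \<le> x \<bullet> x"
  using abs_quad_form_le_spectral_norm[OF A0(1) assms]
    abs_quad_form_le_spectral_norm[OF A1(1) assms]
    mult_right_mono[OF spectral_norms(1) scalar_prod_self_nonneg[of x]]
    mult_right_mono[OF spectral_norms(2) scalar_prod_self_nonneg[of x]]
  by linarith+

lemma quad_form_pencil_le:
  assumes \<gamma>: "0 \<le> \<gamma>" and x: "x \<in> carrier_vec n"
  shows "quad_form (A \<gamma>) x \<le> (1 + \<gamma>) * (x \<bullet> x)"
proof -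
  have "\<gamma> * quad_form A1 x \<le> \<gamma> * (x \<bullet> x)"
    using abs_quad_form_le(2)[OF x] \<gamma> by (intro mult_left_mono) auto
  then show ?thesis
    using abs_quad_form_le(1)[OF x] by (simp add: quad_form_pencil[OF x] algebra_simps)
qed

lemma lmin_le_quad_form: "x \<in> carrier_vec n \<Longrightarrow> lmin \<gamma> * (x \<bullet> x) \<le> quad_form (A \<gamma>) x"
  by (rule lambda_min_le_quad_form[OF pencil_carrier pencil_symmetric n_pos])

definition min_eigvec :: "real \<Rightarrow> real vec" where
  "min_eigvec \<gamma> = (SOME e. e \<in> carrier_vec n \<and> e \<bullet> e = 1 \<and> A \<gamma> *\<^sub>v e = lmin \<gamma> \<cdot>\<^sub>v e)"

lemma min_eigvec:
  shows min_eigvec_carrier: "min_eigvec \<gamma> \<in> carrier_vec n"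
    and min_eigvec_unit: "min_eigvec \<gamma> \<bullet> min_eigvec \<gamma> = 1"
    and min_eigvec_eigenvector: "A \<gamma> *\<^sub>v min_eigvec \<gamma> = lmin \<gamma> \<cdot>\<^sub>v min_eigvec \<gamma>"
proof -
  have "eigenvalue (A \<gamma>) (lmin \<gamma>)"
    by (rule eigenvalue_lambda_min[OF pencil_carrier pencil_symmetric n_pos])
  then have "\<exists>e. e \<in> carrier_vec n \<and> e \<bullet> e = 1 \<and> A \<gamma> *\<^sub>v e = lmin \<gamma> \<cdot>\<^sub>v e"
    by (meson eigenvalue_unit_eigenvector pencil_carrier)
  from someI_ex[OF this]
  show "min_eigvec \<gamma> \<in> carrier_vec n" "min_eigvec \<gamma> \<bullet> min_eigvec \<gamma> = 1"
    "A \<gamma> *\<^sub>v min_eigvec \<gamma> = lmin \<gamma> \<cdot>\<^sub>v min_eigvec \<gamma>"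
    unfolding min_eigvec_def by blast+
qed

lemma lmin_positive: "\<exists>\<gamma>\<ge>0. 0 < lmin \<gamma>"
proof -
  obtain \<gamma> where \<gamma>: "0 \<le> \<gamma>" "pos_def (A \<gamma>)" using ex_pos_def by blast
  have "min_eigvec \<gamma> \<noteq> 0\<^sub>v n" using min_eigvec_unit[of \<gamma>] by auto
  then have "0 < quad_form (A \<gamma>) (min_eigvec \<gamma>)"
    using \<gamma>(2) min_eigvec_carrier[of \<gamma>] by (auto simp: pos_def_def quad_form_def)
  then show ?thesis using \<gamma>(1) quad_form_unit_eigenvector[OF min_eigvec] by auto
qed

lemma negative_direction:
  obtains e0 e1 where "e0 \<in> carrier_vec n" "e0 \<bullet> e0 = 1" "quad_form A0 e0 < 0"
    "e1 \<in> carrier_vec n" "e1 \<bullet> e1 = 1" "quad_form A1 e1 < 0"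
  using negative_eigenvalues eigenvalue_unit_eigenvector[OF A0(1)]
    eigenvalue_unit_eigenvector[OF A1(1)]
    quad_form_unit_eigenvector by metis

lemma Gamma_set_iff: "\<gamma> \<in> Gamma_set A0 A1 \<longleftrightarrow> 0 \<le> \<gamma> \<and> (\<forall>x\<in>carrier_vec n. 0 \<le> quad_form (A \<gamma>) x)"
  by (auto simp: Gamma_set_def pos_semidef_def pencil_symmetric quad_form_def)

lemma Gamma_set_le_zeta_star:
  assumes "\<gamma> \<in> Gamma_set A0 A1"
  shows "\<gamma> \<le> zeta_star A0 A1"
proof -
  obtain e where e: "e \<in> carrier_vec n" "e \<bullet> e = 1" "quad_form A1 e < 0"
    using negative_direction by metis
  have "bdd_above (Gamma_set A0 A1)"
  proof (rule bdd_aboveI)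
    fix \<gamma> assume "\<gamma> \<in> Gamma_set A0 A1"
    then have "0 \<le> quad_form A0 e + \<gamma> * quad_form A1 e"
      using e(1) by (auto simp: Gamma_set_iff quad_form_pencil)
    then have "\<gamma> * - quad_form A1 e \<le> 1" using abs_quad_form_le(1)[OF e(1)] e(2) by simp
    then show "\<gamma> \<le> 1 / - quad_form A1 e" using e(3) by (subst pos_le_divide_eq) auto
  qed
  then have "\<gamma> \<le> gamma_plus A0 A1" unfolding gamma_plus_def using assms by (intro cSup_upper)
  then show ?thesis by (simp add: zeta_star_def)
qed

lemma lmin_le_1:
  assumes "0 \<le> \<gamma>"
  shows "lmin \<gamma> \<le> 1"
proof -
  obtain e where e: "e \<in> carrier_vec n" "e \<bullet> e = 1" "quad_form A1 e < 0"
    using negative_direction by metis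
  have "lmin \<gamma> \<le> quad_form A0 e + \<gamma> * quad_form A1 e"
    using lmin_le_quad_form[OF e(1), of \<gamma>] e by (simp add: quad_form_pencil)
  also have "\<dots> \<le> 1 + 0"
    using abs_quad_form_le(1)[OF e(1)] e assms by (intro add_mono mult_nonneg_nonpos) auto
  finally show ?thesis by simp
qed

lemma xi_star_le_1: "\<xi>star \<le> 1"
  by (simp add: xi_star_def)

lemma le_xi_star:
  assumes "0 \<le> \<gamma>" "c \<le> lmin \<gamma>"
  shows "c \<le> \<xi>star"
proof -
  have "bdd_above (lmin ` {0..})" using lmin_le_1 by (intro bdd_aboveI[of _ 1]) auto
  then have "lmin \<gamma> \<le> (SUP \<gamma>\<in>{0..}. lmin \<gamma>)" using assms by (intro cSUP_upper) auto
  then show ?thesis using assms lmin_le_1[OF assms(1)] by (simp add: xi_star_def)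
qed

lemma xi_star_le:
  assumes "\<And>\<gamma>. 0 \<le> \<gamma> \<Longrightarrow> lmin \<gamma> \<le> c"
  shows "\<xi>star \<le> c"
proof -
  have "(SUP \<gamma>\<in>{0..}. lmin \<gamma>) \<le> c" using assms by (intro cSUP_least) auto
  then show ?thesis by (simp add: xi_star_def)
qed

lemma xi_star_pos: "0 < \<xi>star"
  using lmin_positive le_xi_star less_le_trans by blast

lemma n_le_card_nonzeros: "n \<le> card (nonzeros A0) + card (nonzeros A1)"
proof -
  obtain \<gamma> where \<gamma>: "0 \<le> \<gamma>" "0 < lmin \<gamma>" using lmin_positive by blast
  have finite: "finite (nonzeros M)" if "M \<in> carrier_mat n n" for M
    using that by (intro finite_subset[of "nonzeros M" "{..<n} \<times> {..<n}"]) (auto simp: nonzeros_def)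
  have "(i, i) \<in> nonzeros A0 \<union> nonzeros A1" if i: "i < n" for i
  proof -
    have diagonal: "quad_form M (unit_vec n i) = M $$ (i, i)" if "M \<in> carrier_mat n n" for M
      using that i by (simp add: quad_form_def)
    have "0 < A0 $$ (i, i) + \<gamma> * A1 $$ (i, i)"
      using lmin_le_quad_form[of "unit_vec n i" \<gamma>] \<gamma>(2) i
      by (simp add: quad_form_pencil diagonal[OF A0(1)] diagonal[OF A1(1)])
    then have "A0 $$ (i, i) \<noteq> 0 \<or> A1 $$ (i, i) \<noteq> 0" by auto
    then show ?thesis using i A0(1) A1(1) by (auto simp: nonzeros_def)
  qed
  then have "(\<lambda>i. (i, i)) ` {..<n} \<subseteq> nonzeros A0 \<union> nonzeros A1" by auto
  then have "card ((\<lambda>i. (i, i)) ` {..<n}) \<le> card (nonzeros A0 \<union> nonzeros A1)"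
    using finite A0(1) A1(1) by (intro card_mono) auto
  also have "\<dots> \<le> card (nonzeros A0) + card (nonzeros A1)" by (rule card_Un_le)
  finally show ?thesis by (simp add: card_image inj_on_def)
qed

lemma quad_form_near_good_multiplier:
  assumes "2 * \<xi> \<le> lmin \<gamma>" "\<bar>\<gamma>' - \<gamma>\<bar> \<le> \<xi> / 2" and x: "x \<in> carrier_vec n"
  shows "3 * \<xi> / 2 * (x \<bullet> x) \<le> quad_form (A \<gamma>') x"
proof -
  define d where "d = \<xi> * (x \<bullet> x)"
  have "2 * \<xi> * (x \<bullet> x) \<le> lmin \<gamma> * (x \<bullet> x)"
    using assms(1) scalar_prod_self_nonneg[of x] by (intro mult_right_mono)
  then have "2 * d \<le> quad_form (A \<gamma>) x" using lmin_le_quad_form[OF x, of \<gamma>] by (simp add: d_def)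
  moreover have "0 \<le> \<xi>" using assms(2) by linarith
  then have "\<bar>(\<gamma>' - \<gamma>) * quad_form A1 x\<bar> \<le> \<xi> / 2 * (x \<bullet> x)"
    unfolding abs_mult using assms(2) abs_quad_form_le(2)[OF x] by (intro mult_mono) auto
  then have "- (d / 2) \<le> (\<gamma>' - \<gamma>) * quad_form A1 x" by (simp only: d_def)
  moreover have "quad_form (A \<gamma>') x = quad_form (A \<gamma>) x + (\<gamma>' - \<gamma>) * quad_form A1 x"
    by (simp add: quad_form_pencil[OF x] algebra_simps)
  ultimately have "3 / 2 * d \<le> quad_form (A \<gamma>') x" by linarith
  then show ?thesis by (simp add: d_def)
qed

lemma good_multiplier_bounds:
  assumes \<gamma>: "0 \<le> \<gamma>" and \<xi>: "0 < \<xi>" "2 * \<xi> \<le> lmin \<gamma>"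
  shows "0 \<le> \<gamma> - \<xi> / 2" "\<gamma> + \<xi> / 2 \<le> zeta_star A0 A1"
proof -
  show "0 \<le> \<gamma> - \<xi> / 2"
  proof (rule ccontr)
    assume "\<not> 0 \<le> \<gamma> - \<xi> / 2"
    then have "\<bar>0 - \<gamma>\<bar> \<le> \<xi> / 2" using \<gamma> by simp
    moreover obtain e where e: "e \<in> carrier_vec n" "e \<bullet> e = 1" "quad_form A0 e < 0"
      using negative_direction by metis
    ultimately show False
      using quad_form_near_good_multiplier[OF \<xi>(2), of 0 e] \<xi>(1) by (simp add: quad_form_pencil)
  qed
  have "0 \<le> quad_form (A (\<gamma> + \<xi> / 2)) x" if "x \<in> carrier_vec n" for x
  proof -
    have "0 \<le> 3 * \<xi> / 2 * (x \<bullet> x)" using \<xi>(1) scalar_prod_self_nonneg[of x] by simp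
    also have "\<dots> \<le> quad_form (A (\<gamma> + \<xi> / 2)) x"
      using \<xi>(1) by (intro quad_form_near_good_multiplier[OF \<xi>(2) _ that]) simp
    finally show ?thesis .
  qed
  then show "\<gamma> + \<xi> / 2 \<le> zeta_star A0 A1"
    using \<gamma> \<xi>(1) by (intro Gamma_set_le_zeta_star) (simp add: Gamma_set_iff)
qed

end

section \<open>The search for a multiplier\<close>

lemma le_nat_floor_log2:
  assumes "2 ^ i \<le> x"
  shows "i \<le> nat \<lfloor>log 2 x\<rfloor>"
proof -
  have "real i \<le> log 2 x"
    using assms by (simp add: le_log_iff powr_realpow less_le_trans[of 0 "2 ^ i"])
  then show ?thesis by (simp add: le_nat_floor le_floor_iff nat_le_iff)
qed

datatype bracket = Bracket (guess: real) (lower: real) (upper: real)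

definition mid :: "bracket \<Rightarrow> real" where
  "mid b = (lower b + upper b) / 2"

definition left_half :: "bracket \<Rightarrow> bracket" where
  "left_half b = Bracket (guess b) (lower b) (mid b)"

definition right_half :: "bracket \<Rightarrow> bracket" where
  "right_half b = Bracket (guess b) (mid b) (upper b)"

definition rel_gap :: "bracket \<Rightarrow> real" where
  "rel_gap b = guess b / (1 + mid b)"

locale multiplier_search = definite_pencil +
  fixes \<zeta> p :: real
  assumes zeta_star_le: "zeta_star A0 A1 \<le> \<zeta>" and p_pos: "0 < p" and p_less_1: "p < 1"
begin

lemma zeta_ge_1: "1 \<le> \<zeta>"
  using zeta_star_le by (simp add: zeta_star_def)

definition failure_prob :: "nat \<Rightarrow> real" where
  "failure_prob k = p / ((real k + 1) * (real k + 2))"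

text \<open>A random block \<open>g\<close> has \<open>g\<^sup>T g \<le> n\<close> and, up to failure probability \<open>\<delta>\<close>, component at least
  \<open>\<delta> / (2 sqrt n)\<close> along an eigenvector, so an amplification by \<open>3n/\<delta> > 2 sqrt 2 n/\<delta>\<close> suffices.\<close>

definition threshold :: "nat \<Rightarrow> real" where
  "threshold k = 3 * real n * (real k + 1) * (real k + 2) / p"

lemma failure_prob_pos: "0 < failure_prob k"
  using p_pos by (simp add: failure_prob_def add_pos_pos)

lemma threshold_eq: "threshold k = 3 * real n / failure_prob k"
  by (simp add: threshold_def failure_prob_def)

lemma threshold_nonneg: "0 \<le> threshold k"
  using failure_prob_pos[of k] by (simp add: threshold_eq)

definition degree :: "nat \<Rightarrow> bracket \<Rightarrow> nat" where
  "degree k b = cheb_degree (rel_gap b) (threshold k)"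

definition bracket_filter :: "bracket \<Rightarrow> real mat" where
  "bracket_filter b = filter_mat (guess b) (1 + mid b) (A (mid b))"

definition filtered :: "nat \<Rightarrow> (nat \<Rightarrow> real) \<Rightarrow> bracket \<Rightarrow> real vec" where
  "filtered k \<omega> b = chebW_vec (bracket_filter b) (tape_block n (k * n) \<omega>) (degree k b)"

definition reset :: "bracket \<Rightarrow> bracket" where
  "reset b = (if upper b - lower b < guess b then Bracket (guess b / 2) 0 \<zeta> else b)"

definition bisect :: "bracket \<Rightarrow> real vec \<Rightarrow> bracket" where
  "bisect b y = (if quad_form A1 y \<le> 0 then left_half b else right_half b)"

lemmas bisect_defs = bisect_def left_half_def right_half_def

fun search :: "nat \<Rightarrow> (nat \<Rightarrow> real) \<Rightarrow> bracket" where
  "search 0 \<omega> = Bracket 1 0 \<zeta>"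
| "search (Suc k) \<omega> = (let b = reset (search k \<omega>) in bisect b (filtered k \<omega> b))"

definition candidate :: "nat \<Rightarrow> (nat \<Rightarrow> real) \<Rightarrow> bracket" where
  "candidate k \<omega> = reset (search k \<omega>)"

definition probe :: "nat \<Rightarrow> (nat \<Rightarrow> real) \<Rightarrow> real vec" where
  "probe k \<omega> = filtered k \<omega> (candidate k \<omega>)"

definition refutes :: "bracket \<Rightarrow> real vec \<Rightarrow> bool" where
  "refutes b y \<longleftrightarrow> 2 * quad_form (A (mid b)) y < 3 * guess b * (y \<bullet> y)"

abbreviation rejected :: "nat \<Rightarrow> (nat \<Rightarrow> real) \<Rightarrow> bool" where
  "rejected k \<omega> \<equiv> refutes (candidate k \<omega>) (probe k \<omega>)"

lemma search_Suc: "search (Suc k) \<omega> = bisect (candidate k \<omega>) (probe k \<omega>)"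
  by (simp add: Let_def candidate_def probe_def)

lemma bracket_filter_carrier [simp]: "bracket_filter b \<in> carrier_mat n n"
  by (simp add: bracket_filter_def)

lemma filtered_carrier [simp]: "filtered k \<omega> b \<in> carrier_vec n"
  unfolding filtered_def by (rule chebW_vec_carrier) simp_all

lemma probe_carrier [simp]: "probe k \<omega> \<in> carrier_vec n"
  by (simp add: probe_def)

text \<open>As \<open>\<gamma> \<mapsto> \<lambda>\<^sub>m\<^sub>i\<^sub>n(A(\<gamma>))\<close> is 1-Lipschitz, a multiplier that is good for twice the guess stays
  at distance at least half the guess from both ends of the bracket; so a bracket shorter than the
  guess refutes it.\<close>

definition encloses :: "bracket \<Rightarrow> bool" where
  "encloses b \<longleftrightarrow> (\<forall>\<gamma>\<ge>0. 2 * guess b \<le> lmin \<gamma> \<longrightarrow>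
     lower b \<le> \<gamma> - guess b / 2 \<and> \<gamma> + guess b / 2 \<le> upper b)"

lemma encloses_full: "0 < \<xi> \<Longrightarrow> encloses (Bracket \<xi> 0 \<zeta>)"
  using good_multiplier_bounds[of _ \<xi>] zeta_star_le by (fastforce simp: encloses_def)

lemma xi_star_le_if_short_bracket:
  assumes enc: "encloses b" and short: "upper b - lower b < guess b"
  shows "\<xi>star \<le> 2 * guess b"
proof (rule xi_star_le, rule ccontr)
  fix \<gamma> assume "0 \<le> \<gamma>" "\<not> lmin \<gamma> \<le> 2 * guess b"
  then have "lower b \<le> \<gamma> - guess b / 2" "\<gamma> + guess b / 2 \<le> upper b"
    using enc by (auto simp: encloses_def)
  with short show False by linarith
qed

lemma encloses_bisect:
  assumes enc: "encloses b" and pos: "0 < guess b" and y: "y \<in> carrier_vec n"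
    and refutes: "refutes b y"
  shows "encloses (bisect b y)"
proof -
  have cut: "0 < (\<gamma>' - mid b) * quad_form A1 y"
    if "2 * guess b \<le> lmin \<gamma>" "\<bar>\<gamma>' - \<gamma>\<bar> \<le> guess b / 2" for \<gamma> \<gamma>'
    using quad_form_near_good_multiplier[OF that y] refutes
    by (simp add: refutes_def quad_form_pencil[OF y] algebra_simps)
  have "if quad_form A1 y \<le> 0 then \<gamma> + guess b / 2 \<le> mid b else mid b \<le> \<gamma> - guess b / 2"
    if "2 * guess b \<le> lmin \<gamma>" for \<gamma>
    using cut[OF that, of "\<gamma> + guess b / 2"] cut[OF that, of "\<gamma> - guess b / 2"] pos
    by (auto simp: zero_less_mult_iff)
  then show ?thesis using enc by (auto simp: encloses_def bisect_defs)
qed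

definition max_bisections :: nat where "max_bisections = nat \<lfloor>log 2 (4 * \<zeta> / \<xi>star)\<rfloor>"
definition max_halvings :: nat where "max_halvings = nat \<lfloor>log 2 (4 / \<xi>star)\<rfloor>"

text \<open>Here \<open>j\<close> counts the halvings of the guess and \<open>i\<close> the bisections since the last one.\<close>

definition search_inv :: "nat \<Rightarrow> bracket \<Rightarrow> bool" where
  "search_inv k b \<longleftrightarrow> encloses b \<and> \<xi>star / 4 \<le> guess b \<and> 0 \<le> lower b \<and> upper b \<le> \<zeta> \<and>
     (\<exists>j i. guess b = 1 / 2 ^ j \<and> upper b - lower b = \<zeta> / 2 ^ i \<and>
       i \<le> Suc max_bisections \<and> k \<le> j * Suc max_bisections + i)"

lemma search_inv_bounds:
  assumes "search_inv k b"
  shows "0 < guess b" "guess b \<le> 1" "0 \<le> mid b" "mid b \<le> \<zeta>" "\<xi>star / 4 \<le> guess b"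
proof -
  from assms obtain j i where b: "guess b = 1 / 2 ^ j" "upper b - lower b = \<zeta> / 2 ^ i"
    "0 \<le> lower b" "upper b \<le> \<zeta>" "\<xi>star / 4 \<le> guess b"
    unfolding search_inv_def by blast
  have "0 \<le> \<zeta> / 2 ^ i" using zeta_ge_1 by simp
  then show "0 < guess b" "guess b \<le> 1" "0 \<le> mid b" "mid b \<le> \<zeta>" "\<xi>star / 4 \<le> guess b"
    using b by (auto simp: mid_def divide_le_eq)
qed

lemma rel_gap_bounds:
  assumes "search_inv k b"
  shows "0 < rel_gap b" "rel_gap b \<le> 1"
  using search_inv_bounds[OF assms] by (simp_all add: rel_gap_def divide_le_eq)

lemma search_inv_init: "search_inv 0 (Bracket 1 0 \<zeta>)"
  unfolding search_inv_def using encloses_full xi_star_le_1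
  by (intro conjI exI[of _ 0]) simp_all

lemma search_inv_reset:
  assumes inv: "search_inv k b"
  shows "search_inv k (reset b)" "guess (reset b) \<le> upper (reset b) - lower (reset b)"
proof -
  from inv obtain j i where b: "guess b = 1 / 2 ^ j" "upper b - lower b = \<zeta> / 2 ^ i"
    "i \<le> Suc max_bisections" "k \<le> j * Suc max_bisections + i" and enc: "encloses b"
    unfolding search_inv_def by blast
  note bounds = search_inv_bounds[OF inv]
  have "search_inv k (reset b) \<and> guess (reset b) \<le> upper (reset b) - lower (reset b)"
  proof (cases "upper b - lower b < guess b")
    case True
    then have reset: "reset b = Bracket (guess b / 2) 0 \<zeta>" by (simp add: reset_def)
    have "\<xi>star / 4 \<le> guess (reset b)" "encloses (reset b)"
      using xi_star_le_if_short_bracket[OF enc True] encloses_full[of "guess b / 2"] bounds(1)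
      by (simp_all add: reset)
    moreover have "0 \<le> lower (reset b)" "upper (reset b) \<le> \<zeta>" by (simp_all add: reset)
    moreover have "guess (reset b) = 1 / 2 ^ Suc j" "upper (reset b) - lower (reset b) = \<zeta> / 2 ^ 0"
      "k \<le> Suc j * Suc max_bisections + 0" using b by (simp_all add: reset)
    ultimately have "search_inv k (reset b)" unfolding search_inv_def by blast
    then show ?thesis using bounds zeta_ge_1 by (simp add: reset)
  next
    case False
    then show ?thesis using inv by (simp add: reset_def)
  qed
  then show "search_inv k (reset b)" "guess (reset b) \<le> upper (reset b) - lower (reset b)"
    by simp_all
qed

lemma bisections_le_max:
  assumes "search_inv k b" "guess b \<le> \<zeta> / 2 ^ i"
  shows "i \<le> max_bisections"
proof -
  have "\<xi>star / 4 \<le> \<zeta> / 2 ^ i" using search_inv_bounds(5)[OF assms(1)] assms(2) by linarith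
  then have "2 ^ i \<le> 4 * \<zeta> / \<xi>star" using xi_star_pos by (simp add: field_simps)
  then show ?thesis unfolding max_bisections_def by (rule le_nat_floor_log2)
qed

lemma search_inv_bisect:
  assumes inv: "search_inv k b" and wide: "guess b \<le> upper b - lower b"
    and y: "y \<in> carrier_vec n" "refutes b y"
  shows "search_inv (Suc k) (bisect b y)"
proof -
  from inv obtain j i where b: "guess b = 1 / 2 ^ j" "upper b - lower b = \<zeta> / 2 ^ i" "0 \<le> lower b"
    "upper b \<le> \<zeta>" "\<xi>star / 4 \<le> guess b" "k \<le> j * Suc max_bisections + i" and enc: "encloses b"
    unfolding search_inv_def by blast
  note bounds = search_inv_bounds[OF inv]
  have "i \<le> max_bisections" using bisections_le_max[OF inv] wide b(2) by simp
  moreover have "mid b - lower b = \<zeta> / 2 ^ Suc i" "upper b - mid b = \<zeta> / 2 ^ Suc i"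
    using b(2) by (simp_all add: mid_def field_simps)
  ultimately have "upper (bisect b y) - lower (bisect b y) = \<zeta> / 2 ^ Suc i"
    "Suc i \<le> Suc max_bisections" "Suc k \<le> j * Suc max_bisections + Suc i"
    using b(6) by (simp_all add: bisect_defs)
  moreover have "guess (bisect b y) = guess b" "0 \<le> lower (bisect b y)" "upper (bisect b y) \<le> \<zeta>"
    using b(3,4) bounds(3,4) by (simp_all add: bisect_defs)
  ultimately show ?thesis
    using b(1,5) encloses_bisect[OF enc bounds(1) y] unfolding search_inv_def by metis
qed

lemma search_inv_index_less:
  assumes inv: "search_inv k b" and wide: "guess b \<le> upper b - lower b"
  shows "k < Suc max_halvings * Suc max_bisections"
proof -
  from inv obtain j i where b: "guess b = 1 / 2 ^ j" "upper b - lower b = \<zeta> / 2 ^ i"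
    "k \<le> j * Suc max_bisections + i"
    unfolding search_inv_def by blast
  have i: "i \<le> max_bisections" using bisections_le_max[OF inv] wide b(2) by simp
  have "\<xi>star / 4 \<le> 1 / 2 ^ j" using search_inv_bounds(5)[OF inv] unfolding b(1) .
  then have "2 ^ j \<le> 4 / \<xi>star" using xi_star_pos by (simp add: field_simps)
  then have "j \<le> max_halvings" unfolding max_halvings_def by (rule le_nat_floor_log2)
  then have "k \<le> max_halvings * Suc max_bisections + max_bisections"
    using b(3) i mult_le_mono1[of j max_halvings "Suc max_bisections"] by linarith
  then show ?thesis by simp
qed

lemma search_inv_search: "(\<And>k'. k' < k \<Longrightarrow> rejected k' \<omega>) \<Longrightarrow> search_inv k (search k \<omega>)"
proof (induction k)
  case (Suc k)
  then have "search_inv k (search k \<omega>)" "rejected k \<omega>" by simp_all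
  then show ?case
    unfolding search_Suc candidate_def by (intro search_inv_bisect search_inv_reset) auto
qed (simp add: search_inv_init)

lemma search_inv_candidate:
  assumes "\<And>k'. k' < k \<Longrightarrow> rejected k' \<omega>"
  shows "search_inv k (candidate k \<omega>)" "k < Suc max_halvings * Suc max_bisections"
  using search_inv_reset[OF search_inv_search[OF assms]] search_inv_index_less
  by (auto simp: candidate_def)

lemma ex_first_accepted:
  obtains K where "\<not> rejected K \<omega>" "\<And>k. k < K \<Longrightarrow> rejected k \<omega>"
proof -
  have "\<exists>k. \<not> rejected k \<omega>" using search_inv_candidate(2) less_irrefl by metis
  then show thesis using that not_less_Least LeastI_ex[of "\<lambda>k. \<not> rejected k \<omega>"] by blast
qed

lemma finite_range_search: "finite (range (search k))"
proof (induction k)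
  case 0
  have "range (search 0) = {Bracket 1 0 \<zeta>}" by auto
  then show ?case by simp
next
  case (Suc k)
  have "range (search (Suc k)) \<subseteq> (\<Union>b\<in>reset ` range (search k). {left_half b, right_half b})"
    by (auto simp: Let_def bisect_def)
  moreover have "finite \<dots>" by (intro finite_UN_I finite_imageI Suc) simp
  ultimately show ?case by (rule finite_subset)
qed

lemma bisect_filtered_measurable: "{\<omega>. bisect b (filtered k \<omega> b) = b'} \<in> sets random_tape"
proof -
  let ?q = "\<lambda>\<omega>. quad_form A1 (filtered k \<omega> b)"
  have "?q = (\<lambda>\<omega>. \<Sum>i<n. \<Sum>j<n. A1 $$ (i, j) * (filtered k \<omega> b $ i * filtered k \<omega> b $ j))"
    by (simp add: quad_form_eq_sum[OF A1(1)])
  moreover have "(\<lambda>\<omega>. filtered k \<omega> b $ i) \<in> borel_measurable random_tape" if "i < n" for i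
    unfolding filtered_def using that cheb_vec_tape_block_measurable[THEN conjunct1] by simp
  ultimately have [measurable]: "?q \<in> borel_measurable random_tape" by simp
  have "{\<omega>. bisect b (filtered k \<omega> b) = b'} =
      {\<omega>. if ?q \<omega> \<le> 0 then left_half b = b' else right_half b = b'}"
    by (auto simp: bisect_def)
  also have "\<dots> \<in> sets random_tape" by (rule random_tape_sets_Collect) measurable
  finally show ?thesis .
qed

lemma search_measurable: "{\<omega>. search k \<omega> = b} \<in> sets random_tape"
proof (induction k arbitrary: b)
  case 0
  show ?case by (rule random_tape_sets_Collect) simp
next
  case (Suc k)
  have "{\<omega>. search (Suc k) \<omega> = b} =
      (\<Union>b'\<in>range (search k).
        {\<omega>. search k \<omega> = b'} \<inter> {\<omega>. bisect (reset b') (filtered k \<omega> (reset b')) = b})"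
    by (auto simp: Let_def)
  also have "\<dots> \<in> sets random_tape"
    using finite_range_search Suc bisect_filtered_measurable by (intro sets.finite_UN sets.Int) auto
  finally show ?case .
qed

lemma search_cong:
  "(\<forall>i<k * n. \<omega> i = \<omega>' i) \<Longrightarrow> search k \<omega> = search k \<omega>'"
proof (induction k)
  case (Suc k)
  then have "tape_block n (k * n) \<omega> = tape_block n (k * n) \<omega>'"
    by (intro eq_vecI) (auto simp: tape_block_def)
  then show ?case using Suc by (simp add: Let_def filtered_def)
qed simp

definition unlucky :: "nat \<Rightarrow> (nat \<Rightarrow> real) set" where
  "unlucky k = {\<omega>. \<bar>tape_block n (k * n) \<omega> \<bullet> min_eigvec (mid (candidate k \<omega>))\<bar>
     \<le> failure_prob k / (2 * sqrt (real n))}"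

lemma unlucky:
  shows unlucky_sets: "unlucky k \<in> sets random_tape"
    and prob_unlucky_le: "measure random_tape (unlucky k) \<le> failure_prob k"
proof -
  let ?\<tau> = "failure_prob k / (2 * sqrt (real n))"
  have \<tau>: "0 \<le> ?\<tau>" using failure_prob_pos[of k] by simp
  note small_ball = random_tape_small_ball_adaptive[where \<sigma> = "search k" and c = "k * n" and n = n
      and e = "\<lambda>b. min_eigvec (mid (reset b))", OF finite_range_search search_measurable
      search_cong min_eigvec_carrier min_eigvec_unit \<tau>]
  show "unlucky k \<in> sets random_tape" using small_ball(1) by (simp add: unlucky_def candidate_def)
  have "2 * ?\<tau> * sqrt (real n) = failure_prob k" using n_pos by simp
  then show "measure random_tape (unlucky k) \<le> failure_prob k"
    using small_ball(2) by (simp add: unlucky_def candidate_def)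
qed

definition lucky :: "(nat \<Rightarrow> real) set" where
  "lucky = {\<omega>. \<forall>i. \<omega> i \<in> {0..1}} - (\<Union>k. unlucky k)"

lemma lucky:
  shows lucky_sets: "lucky \<in> sets random_tape"
    and prob_lucky_ge: "1 - p \<le> measure random_tape lucky"
proof -
  have UN: "(\<Union>k. unlucky k) \<in> sets random_tape" using unlucky_sets by (intro sets.countable_UN) auto
  then show lucky: "lucky \<in> sets random_tape"
    unfolding lucky_def by (rule sets.Diff[OF sets_unit_cube])
  have "measure random_tape (\<Union>k. unlucky k) \<le> p"
    using unlucky_sets prob_unlucky_le unfolding failure_prob_def
    by (rule random_tape.prob_UN_le_pronic)
  moreover have "measure random_tape {\<omega>. \<forall>i. \<omega> i \<in> {0..1}}
      \<le> measure random_tape (lucky \<union> (\<Union>k. unlucky k))"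
    using lucky UN by (intro random_tape.finite_measure_mono sets.Un) (auto simp: lucky_def)
  moreover have "\<dots> \<le> measure random_tape lucky + measure random_tape (\<Union>k. unlucky k)"
    using lucky UN by (rule measure_Un_le)
  ultimately show "1 - p \<le> measure random_tape lucky" unfolding prob_unit_cube by linarith
qed

lemma lucky_block_large:
  fixes k
  assumes \<omega>: "\<omega> \<in> lucky"
  defines "g \<equiv> tape_block n (k * n) \<omega>" and "e \<equiv> min_eigvec (mid (candidate k \<omega>))"
  shows "2 * (g \<bullet> g) < (g \<bullet> e)\<^sup>2 * (threshold k)\<^sup>2"
proof -
  let ?\<delta> = "failure_prob k" and ?N = "real n"
  have "0 \<le> \<omega> i" "\<omega> i \<le> 1" for i using \<omega> by (auto simp: lucky_def)
  then have "g \<bullet> g \<le> (\<Sum>i<n. 1 * 1)"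
    unfolding g_def tape_block_scalar_prod[OF tape_block_carrier]
    by (intro sum_mono mult_mono) (auto simp: tape_block_def)
  then have gg: "g \<bullet> g \<le> ?N" by simp
  have "?\<delta> / (2 * sqrt ?N) \<le> \<bar>g \<bullet> e\<bar>"
    using \<omega> by (auto simp: lucky_def unlucky_def g_def e_def not_le intro: less_imp_le)
  then have "(?\<delta> / (2 * sqrt ?N))\<^sup>2 \<le> (g \<bullet> e)\<^sup>2"
    using failure_prob_pos[of k] by (subst abs_le_square_iff[symmetric]) simp
  then have "(?\<delta> / (2 * sqrt ?N))\<^sup>2 * (threshold k)\<^sup>2 \<le> (g \<bullet> e)\<^sup>2 * (threshold k)\<^sup>2"
    by (rule mult_right_mono) simp
  moreover have "(?\<delta> / (2 * sqrt ?N))\<^sup>2 * (threshold k)\<^sup>2 = 9 / 4 * ?N"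
    using n_pos failure_prob_pos[of k]
    by (simp add: threshold_eq power_divide power_mult_distrib) (simp add: power2_eq_square)
  moreover have "0 < ?N" using n_pos by simp
  ultimately show ?thesis using gg by linarith
qed

lemma accepted_guess_le_lmin:
  assumes \<omega>: "\<omega> \<in> lucky" and inv: "search_inv k (candidate k \<omega>)" and accepted: "\<not> rejected k \<omega>"
  shows "guess (candidate k \<omega>) \<le> lmin (mid (candidate k \<omega>))"
proof (rule ccontr)
  define b where "b = candidate k \<omega>"
  assume "\<not> ?thesis"
  then have small: "lmin (mid b) < guess b" by (simp add: b_def)
  note bounds = search_inv_bounds[OF inv, folded b_def]
  have "refutes b (probe k \<omega>)"
    unfolding refutes_def probe_def filtered_def bracket_filter_def b_def[symmetric]
  proof (rule chebyshev_filter_detects[OF pencil_carrier pencil_symmetric _ bounds(1)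
        quad_form_pencil_le[OF bounds(3)] min_eigvec small tape_block_carrier])
    have "(threshold k)\<^sup>2 \<le> rel_gap b * (chebW (1 + rel_gap b) (degree k b))\<^sup>2"
      using rel_gap_bounds[OF inv] threshold_nonneg unfolding degree_def b_def
      by (rule cheb_degree_reaches)
    then show "(threshold k)\<^sup>2
        \<le> guess b / (1 + mid b) * (chebW (1 + guess b / (1 + mid b)) (degree k b))\<^sup>2"
      by (simp add: rel_gap_def)
  qed (use bounds lucky_block_large[OF \<omega>, of k] in \<open>simp_all add: b_def\<close>)
  with accepted show False by (simp add: b_def)
qed

end

section \<open>Bounds on the number of tests and on the filter degree\<close>

lemma lg_ge_1: "1 \<le> lg x"
  by (simp add: lg_def)

lemma ln_le_lg: "ln x \<le> lg x"
  by (simp add: lg_def)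

lemma lg_mult_le:
  assumes "1 \<le> x" "1 \<le> y"
  shows "lg (x * y) \<le> lg x + lg y"
proof -
  have "ln (x * y) = ln x + ln y" using assms by (intro ln_mult_pos) auto
  then show ?thesis
    unfolding lg_def[of "x * y"]
    using ln_le_lg[of x] ln_le_lg[of y] lg_ge_1[of x] lg_ge_1[of y]
    by (intro max.boundedI) linarith+
qed

lemma Suc_nat_floor_log2_4_le:
  assumes x: "1 \<le> x"
  shows "real (Suc (nat \<lfloor>log 2 (4 * x)\<rfloor>)) \<le> 5 * lg x"
proof -
  have "log 2 4 = (2 :: real)" using log_pow_cancel[of "2 :: real" 2] by simp
  then have log: "log 2 (4 * x) = 2 + log 2 x" using x by (simp add: log_mult_pos)
  have "1 / 2 \<le> ln (2 :: real)"
    using ln_one_minus_pos_upper_bound[of "1 / 2 :: real"] by (simp add: ln_div)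
  then have "ln x * 1 \<le> ln x * (2 * ln 2)" using x by (intro mult_left_mono) auto
  then have "log 2 x \<le> 2 * ln x" by (simp add: log_def field_simps)
  moreover have "0 \<le> log 2 (4 * x)" using x by simp
  ultimately show ?thesis using log lg_ge_1[of x] ln_le_lg[of x] by linarith
qed

lemma
  shows loglog_factor_ge_1: "1 \<le> loglog_factor n \<zeta> \<xi> p"
    and lg_lg_le_loglog_factor: "lg (lg \<zeta>) \<le> loglog_factor n \<zeta> \<xi> p"
      "lg (lg (1 / \<xi>)) \<le> loglog_factor n \<zeta> \<xi> p"
proof -
  define a b c where "a = lg (lg (real n / p))" and "b = lg (lg \<zeta>)" and "c = lg (lg (1 / \<xi>))"
  have abc: "1 \<le> a" "1 \<le> b" "1 \<le> c" by (simp_all add: a_def b_def c_def lg_ge_1)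
  have ab: "b \<le> a * b" "1 \<le> a * b" using abc mult_mono[of 1 a 1 b] by simp_all
  then have abc': "c \<le> a * b * c" "a * b \<le> a * b * c" using abc by simp_all
  show "1 \<le> loglog_factor n \<zeta> \<xi> p" "lg (lg \<zeta>) \<le> loglog_factor n \<zeta> \<xi> p"
    "lg (lg (1 / \<xi>)) \<le> loglog_factor n \<zeta> \<xi> p"
    unfolding loglog_factor_def a_def[symmetric] b_def[symmetric] c_def[symmetric]
    using ab abc' by linarith+
qed

context multiplier_search
begin

abbreviation "L\<xi> \<equiv> lg (1 / \<xi>star)"
abbreviation "L\<zeta> \<equiv> lg \<zeta>"
abbreviation "Lnp \<equiv> lg (real n / p)"
abbreviation "LL \<equiv> loglog_factor n \<zeta> \<xi>star p"

lemma max_tests_le: "real (Suc max_halvings * Suc max_bisections) \<le> 50 * (L\<zeta> * L\<xi>\<^sup>2)"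
proof -
  have \<xi>: "1 \<le> 1 / \<xi>star" using xi_star_pos xi_star_le_1 by simp
  have L: "1 \<le> L\<xi>" "1 \<le> L\<zeta>" by (rule lg_ge_1)+
  have halvings: "real (Suc max_halvings) \<le> 5 * L\<xi>"
    using Suc_nat_floor_log2_4_le[OF \<xi>] by (simp add: max_halvings_def)
  have "1 * 1 \<le> \<zeta> * (1 / \<xi>star)" using zeta_ge_1 \<xi> by (intro mult_mono) auto
  from Suc_nat_floor_log2_4_le[OF this[unfolded mult_1]]
  have "real (Suc max_bisections) \<le> 5 * lg (\<zeta> * (1 / \<xi>star))" by (simp add: max_bisections_def)
  also have "\<dots> \<le> 5 * (L\<zeta> + L\<xi>)" using lg_mult_le[OF zeta_ge_1 \<xi>] by simp
  also have "\<dots> \<le> 10 * (L\<zeta> * L\<xi>)"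
  proof -
    have "L\<zeta> \<le> L\<zeta> * L\<xi>" "L\<xi> \<le> L\<zeta> * L\<xi>" using L by simp_all
    then have "L\<zeta> + L\<xi> \<le> 2 * (L\<zeta> * L\<xi>)" by simp
    then show ?thesis by simp
  qed
  finally have bisections: "real (Suc max_bisections) \<le> 10 * (L\<zeta> * L\<xi>)" .
  have "real (Suc max_halvings) * real (Suc max_bisections) \<le> (5 * L\<xi>) * (10 * (L\<zeta> * L\<xi>))"
    using halvings bisections L by (intro mult_mono) auto
  then show ?thesis by (simp add: power2_eq_square algebra_simps)
qed

lemma threshold_le:
  assumes k: "k < Suc max_halvings * Suc max_bisections"
  shows "1 \<le> threshold k" "2 * threshold k + 2 \<le> 2 ^ 16 * (real n / p * (L\<zeta>\<^sup>2 * L\<xi> ^ 4))"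
proof -
  define H where "H = 50 * (L\<zeta> * L\<xi>\<^sup>2)"
  define q where "q = real n / p"
  define r where "r = (real k + 1) * (real k + 2)"
  have q: "1 \<le> q" using n_pos p_pos p_less_1 by (simp add: q_def le_divide_eq)
  have threshold: "threshold k = 3 * (q * r)" by (simp add: threshold_def q_def r_def)
  have "1 * 1 \<le> (real k + 1) * (real k + 2)" by (intro mult_mono) auto
  then have "1 * 1 \<le> q * r" using q unfolding r_def by (intro mult_mono) auto
  then show "1 \<le> threshold k" by (simp add: threshold)
  have "real k + 1 \<le> real (Suc max_halvings * Suc max_bisections)" using k by linarith
  then have H: "real k + 1 \<le> H" using max_tests_le unfolding H_def by linarith
  then have "r \<le> H * (2 * H)" unfolding r_def by (intro mult_mono) auto
  then have "q * r \<le> q * (H * (2 * H))" using q by (intro mult_left_mono) auto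
  then have "2 * threshold k + 2 \<le> 18 * (q * H\<^sup>2)"
    using \<open>1 * 1 \<le> q * r\<close> by (simp add: threshold power2_eq_square)
  also have "\<dots> = 45000 * (q * (L\<zeta>\<^sup>2 * L\<xi> ^ 4))" by (simp add: H_def power_mult_distrib)
  also have "\<dots> \<le> 2 ^ 16 * (q * (L\<zeta>\<^sup>2 * L\<xi> ^ 4))"
    using q by (intro mult_right_mono mult_nonneg_nonneg) auto
  finally show "2 * threshold k + 2 \<le> 2 ^ 16 * (real n / p * (L\<zeta>\<^sup>2 * L\<xi> ^ 4))" by (simp add: q_def)
qed

lemma ln_threshold_le:
  assumes k: "k < Suc max_halvings * Suc max_bisections"
  shows "ln (2 * threshold k + 2) \<le> 23 * (Lnp * LL)"
proof -
  have L: "1 \<le> L\<xi>" "1 \<le> L\<zeta>" "1 \<le> Lnp" by (rule lg_ge_1)+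
  have ln_product: "ln (2 ^ 16 * (q * (a\<^sup>2 * b ^ 4))) = 16 * ln 2 + (ln q + (2 * ln a + 4 * ln b))"
    if "0 < q" "1 \<le> a" "1 \<le> b" for q a b :: real
    using that ln_realpow[of "2 :: real" 16] by (simp add: ln_mult_pos ln_realpow)
  have "ln (2 * threshold k + 2) \<le> ln (2 ^ 16 * (real n / p * (L\<zeta>\<^sup>2 * L\<xi> ^ 4)))"
    using threshold_le[OF k] by (intro ln_mono) auto
  also have "\<dots> = 16 * ln 2 + (ln (real n / p) + (2 * ln L\<zeta> + 4 * ln L\<xi>))"
    using n_pos p_pos L by (intro ln_product) auto
  also have "\<dots> \<le> 16 + (Lnp + (2 * lg L\<zeta> + 4 * lg L\<xi>))"
    using ln_2_less_1 ln_le_lg[of "real n / p"] ln_le_lg[of L\<zeta>] ln_le_lg[of L\<xi>] by simp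
  also have "\<dots> \<le> 16 + (Lnp + 6 * LL)"
    using lg_lg_le_loglog_factor[where n = n and \<zeta> = \<zeta> and \<xi> = \<xi>star and p = p] by simp
  also have "\<dots> \<le> 23 * (Lnp * LL)"
  proof -
    have "1 * LL \<le> Lnp * LL" "Lnp * 1 \<le> Lnp * LL"
      using L loglog_factor_ge_1[of n \<zeta> \<xi>star p] by (intro mult_mono; simp)+
    then show ?thesis using loglog_factor_ge_1[of n \<zeta> \<xi>star p] by linarith
  qed
  finally show ?thesis .
qed

lemma inverse_sqrt_rel_gap_le:
  assumes inv: "search_inv k b"
  shows "1 / sqrt (rel_gap b) \<le> 3 * sqrt (\<zeta> / \<xi>star)"
proof -
  note bounds = search_inv_bounds[OF inv]
  have "(1 + mid b) / guess b \<le> (2 * \<zeta>) / (\<xi>star / 4)"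
    using bounds zeta_ge_1 xi_star_pos by (intro frac_le) auto
  also have "\<dots> \<le> 3\<^sup>2 * (\<zeta> / \<xi>star)" using zeta_ge_1 xi_star_pos by (simp add: field_simps)
  finally have "sqrt ((1 + mid b) / guess b) \<le> sqrt (3\<^sup>2 * (\<zeta> / \<xi>star))" by (rule real_sqrt_le_mono)
  then show ?thesis by (simp add: rel_gap_def real_sqrt_divide real_sqrt_mult)
qed

lemma degree_le:
  assumes inv: "search_inv k b" and k: "k < Suc max_halvings * Suc max_bisections"
  shows "real (degree k b) + 2 \<le> 141 * (Lnp * LL * sqrt (\<zeta> / \<xi>star))"
proof -
  let ?S = "sqrt (\<zeta> / \<xi>star)"
  note gap = rel_gap_bounds[OF inv]
  have "0 \<le> ln (2 * threshold k + 2)" using threshold_le(1)[OF k] by simp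
  then have "ln (2 * threshold k + 2) * (1 / sqrt (rel_gap b)) \<le> (23 * (Lnp * LL)) * (3 * ?S)"
    using ln_threshold_le[OF k] inverse_sqrt_rel_gap_le[OF inv] gap(1) by (intro mult_mono) auto
  then have "real (degree k b) \<le> 1 + 138 * (Lnp * LL * ?S)"
    using cheb_degree_le[OF gap threshold_nonneg, of k] by (simp add: degree_def)
  moreover have "1 * 1 * 1 \<le> Lnp * LL * ?S"
  proof (intro mult_mono)
    show "1 \<le> ?S" using zeta_ge_1 xi_star_pos xi_star_le_1 by (simp add: le_divide_eq)
  qed (use lg_ge_1[of "real n / p"] loglog_factor_ge_1[of n \<zeta> \<xi>star p] in auto)
  ultimately show ?thesis by linarith
qed

end

section \<open>Time-bounded execution\<close>

definition runs :: "(nat \<Rightarrow> real) \<Rightarrow> com \<Rightarrow> state \<Rightarrow> nat \<Rightarrow> (state \<Rightarrow> bool) \<Rightarrow> bool" where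
  "runs \<omega> c s T Q \<longleftrightarrow> (\<exists>t s'. exec \<omega> c s t s' \<and> t \<le> T \<and> Q s')"

lemma runs_iff_exec: "exec \<omega> c s t s' \<Longrightarrow> runs \<omega> c s T Q \<longleftrightarrow> t \<le> T \<and> Q s'"
  unfolding runs_def using exec_deterministic by blast

lemma runs_Seq_iff_exec:
  assumes c: "exec \<omega> c s t s'"
  shows "runs \<omega> (Seq c d) s T Q \<longleftrightarrow> t \<le> T \<and> runs \<omega> d s' (T - t) Q"
proof
  assume "runs \<omega> (Seq c d) s T Q"
  then obtain t' s1 u s'' where "exec \<omega> c s t' s1" "exec \<omega> d s1 u s''" "t' + u \<le> T" "Q s''"
    unfolding runs_def by (auto elim: exec_SeqE)
  moreover from this(1) have "t' = t" "s1 = s'" using exec_deterministic[OF c] by auto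
  ultimately have "t \<le> T" "exec \<omega> d s' u s''" "u \<le> T - t" "Q s''" by auto
  then show "t \<le> T \<and> runs \<omega> d s' (T - t) Q" unfolding runs_def by blast
next
  assume "t \<le> T \<and> runs \<omega> d s' (T - t) Q"
  then obtain u s'' where "exec \<omega> d s' u s''" "t + u \<le> T" "Q s''" unfolding runs_def by auto
  then show "runs \<omega> (Seq c d) s T Q" using exec.Seq[OF c] unfolding runs_def by blast
qed

lemmas runs_atomic =
  runs_iff_exec[OF exec.Skip] runs_iff_exec[OF exec.NAssign] runs_iff_exec[OF exec.RAssign]
  runs_iff_exec[OF exec.RStore] runs_iff_exec[OF exec.Draw]
  runs_Seq_iff_exec[OF exec.NAssign] runs_Seq_iff_exec[OF exec.RAssign]
  runs_Seq_iff_exec[OF exec.RStore] runs_Seq_iff_exec[OF exec.Draw]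

lemma runs_Cond:
  "runs \<omega> (Cond b c d) s T Q \<longleftrightarrow>
    1 + bcost b \<le> T \<and> runs \<omega> (if bval b s then c else d) s (T - (1 + bcost b)) Q"
proof
  assume "runs \<omega> (Cond b c d) s T Q"
  then obtain t s' where "exec \<omega> (Cond b c d) s t s'" "t \<le> T" "Q s'" unfolding runs_def by blast
  then show "1 + bcost b \<le> T \<and> runs \<omega> (if bval b s then c else d) s (T - (1 + bcost b)) Q"
    by (cases rule: exec_CondE) (fastforce simp: runs_def)+
next
  assume "1 + bcost b \<le> T \<and> runs \<omega> (if bval b s then c else d) s (T - (1 + bcost b)) Q"
  then obtain t s' where "exec \<omega> (if bval b s then c else d) s t s'" "1 + bcost b + t \<le> T" "Q s'"
    unfolding runs_def by auto
  then show "runs \<omega> (Cond b c d) s T Q"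
    unfolding runs_def using exec.CondTrue[of b s \<omega> c] exec.CondFalse[of b s \<omega> d]
    by (cases "bval b s") fastforce+
qed

lemma runs_mono:
  "runs \<omega> c s T Q \<Longrightarrow> T \<le> T' \<Longrightarrow> (\<And>s'. Q s' \<Longrightarrow> Q' s') \<Longrightarrow> runs \<omega> c s T' Q'"
  unfolding runs_def using le_trans by blast

lemma runs_While:
  assumes init: "I 0 s"
    and step: "\<And>m s. m < N \<Longrightarrow> I m s \<Longrightarrow> bval b s \<and> runs \<omega> c s T (I (Suc m))"
    and stop: "\<And>s. I N s \<Longrightarrow> \<not> bval b s"
    and time: "N * (1 + bcost b + T) + (1 + bcost b) \<le> U"
  shows "runs \<omega> (While b c) s U (I N)"
proof -
  have "I (N - j) s \<Longrightarrow> runs \<omega> (While b c) s (j * (1 + bcost b + T) + (1 + bcost b)) (I N)"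
    if "j \<le> N" for j s
    using that
  proof (induction j arbitrary: s)
    case 0
    then show ?case using exec.WhileFalse[OF stop, of s] by (auto simp: runs_def)
  next
    case (Suc j)
    then have b: "bval b s" and "runs \<omega> c s T (I (Suc (N - Suc j)))"
      using step[of "N - Suc j" s] by auto
    moreover have "Suc (N - Suc j) = N - j" using Suc.prems(2) by simp
    ultimately obtain t s' where c: "exec \<omega> c s t s'" "t \<le> T" "I (N - j) s'"
      by (auto simp: runs_def)
    from Suc.IH[OF c(3)] Suc.prems(2) obtain u s'' where
      w: "exec \<omega> (While b c) s' u s''" "u \<le> j * (1 + bcost b + T) + (1 + bcost b)" "I N s''"
      by (auto simp: runs_def)
    from exec.WhileTrue[OF b c(1) w(1)] c(2) w(2,3) show ?case
      unfolding runs_def by (intro exI[of _ "1 + bcost b + t + u"] exI[of _ s'']) auto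
  qed
  from this[of N s] init have "runs \<omega> (While b c) s (N * (1 + bcost b + T) + (1 + bcost b)) (I N)"
    by simp
  then show ?thesis using time by (rule runs_mono)
qed

datatype loc = NatVar vname | RealVar vname | NatArr vname | RealArr vname | Tape

primrec writes :: "com \<Rightarrow> loc set" where
  "writes Skip = {}"
| "writes (NAssign x e) = {NatVar x}"
| "writes (RAssign x e) = {RealVar x}"
| "writes (NStore a i e) = {NatArr a}"
| "writes (RStore a i e) = {RealArr a}"
| "writes (Draw x) = {RealVar x, Tape}"
| "writes (Seq c d) = writes c \<union> writes d"
| "writes (Cond b c d) = writes c \<union> writes d"
| "writes (While b c) = writes c"

definition frame :: "loc set \<Rightarrow> state \<Rightarrow> state \<Rightarrow> bool" where
  "frame W s s' \<longleftrightarrow> (\<forall>x. NatVar x \<notin> W \<longrightarrow> nvar s' x = nvar s x) \<and>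
     (\<forall>x. RealVar x \<notin> W \<longrightarrow> rvar s' x = rvar s x) \<and>
     (\<forall>a. NatArr a \<notin> W \<longrightarrow> narr s' a = narr s a) \<and>
     (\<forall>a. RealArr a \<notin> W \<longrightarrow> rarr s' a = rarr s a) \<and> (Tape \<notin> W \<longrightarrow> drawn s' = drawn s)"

lemma frame_trans:
  assumes "frame W s s'" "frame W' s' s''" "W \<subseteq> W''" "W' \<subseteq> W''"
  shows "frame W'' s s''"
proof -
  have "l \<notin> W \<and> l \<notin> W'" if "l \<notin> W''" for l using that assms(3,4) by blast
  then show ?thesis using assms(1,2) by (simp add: frame_def)
qed

lemma frameD:
  assumes "frame W s s'"
  shows "NatVar x \<notin> W \<Longrightarrow> nvar s' x = nvar s x"
    and "RealVar x \<notin> W \<Longrightarrow> rvar s' x = rvar s x"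
    and "NatArr a \<notin> W \<Longrightarrow> narr s' a = narr s a"
    and "RealArr a \<notin> W \<Longrightarrow> rarr s' a = rarr s a"
    and "Tape \<notin> W \<Longrightarrow> drawn s' = drawn s"
  using assms by (simp_all add: frame_def)

lemma exec_frame: "exec \<omega> c s t s' \<Longrightarrow> frame (writes c) s s'"
proof (induction rule: exec.induct)
  case (Seq c s t s' d u s'')
  then show ?case by (simp add: frame_trans)
next
  case (WhileTrue b s c t s' u s'')
  then show ?case by (simp add: frame_trans)
qed (simp_all add: frame_def)

lemma runs_frame: "runs \<omega> c s T Q \<Longrightarrow> runs \<omega> c s T (\<lambda>s'. Q s' \<and> frame (writes c) s s')"
  unfolding runs_def using exec_frame by blast

lemma runs_SeqI:
  assumes c: "runs \<omega> c s T P" and d: "\<And>s'. P s' \<Longrightarrow> frame (writes c) s s' \<Longrightarrow> runs \<omega> d s' U Q"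
    and time: "T + U \<le> V"
  shows "runs \<omega> (Seq c d) s V Q"
proof -
  from c obtain t s' where s': "exec \<omega> c s t s'" "t \<le> T" "P s'" by (auto simp: runs_def)
  from d[OF s'(3) exec_frame[OF s'(1)]] have "runs \<omega> d s' (V - t) Q"
    by (rule runs_mono) (use s'(2) time in auto)
  then show ?thesis using s'(2) time by (simp add: runs_Seq_iff_exec[OF s'(1)])
qed

definition for_loop :: "vname \<Rightarrow> com \<Rightarrow> com" where
  "for_loop bnd body = Seq (NAssign ''i'' (NConst 0))
     (While (NLe (NAdd (NVar ''i'') (NConst 1)) (NVar bnd))
       (Seq body (NAssign ''i'' (NAdd (NVar ''i'') (NConst 1)))))"

lemma writes_for_loop [simp]: "writes (for_loop bnd body) = insert (NatVar ''i'') (writes body)"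
  by (auto simp: for_loop_def)

lemma runs_for_loop:
  assumes counter: "NatVar ''i'' \<notin> writes body" "NatVar bnd \<notin> writes body" "bnd \<noteq> ''i''"
    and I_counter: "\<And>m s' j. I m (s'\<lparr>nvar := (nvar s')(''i'' := j)\<rparr>) \<longleftrightarrow> I m s'"
    and init: "I 0 s"
    and step: "\<And>m s'. m < nvar s bnd \<Longrightarrow> I m s' \<Longrightarrow> nvar s' ''i'' = m \<Longrightarrow>
      frame (insert (NatVar ''i'') (writes body)) s s' \<Longrightarrow> runs \<omega> body s' T (I (Suc m))"
    and time: "(nvar s bnd + 1) * (T + 10) \<le> U"
  shows "runs \<omega> (for_loop bnd body) s U (I (nvar s bnd))"
proof -
  let ?N = "nvar s bnd" and ?W = "insert (NatVar ''i'') (writes body)"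
  let ?b = "NLe (NAdd (NVar ''i'') (NConst 1)) (NVar bnd)"
  let ?incr = "NAssign ''i'' (NAdd (NVar ''i'') (NConst 1))"
  let ?J = "\<lambda>m s'. I m s' \<and> nvar s' ''i'' = m \<and> frame ?W s s'"
  let ?s0 = "s\<lparr>nvar := (nvar s)(''i'' := 0)\<rparr>"
  have bound: "bval ?b s' \<longleftrightarrow> m < ?N" if "?J m s'" for m s'
    using that frameD(1)[of ?W s s' bnd] counter by auto
  have "runs \<omega> (While ?b (Seq body ?incr)) ?s0 (U - 2) (?J ?N)"
  proof (rule runs_While)
    show "?J 0 ?s0" using init I_counter by (simp add: frame_def)
  next
    fix m and s' :: state assume m: "m < ?N" and J: "?J m s'"
    then have "runs \<omega> body s' T (I (Suc m))" using step by blast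
    then have "runs \<omega> (Seq body ?incr) s' (T + 4) (\<lambda>s2. I (Suc m) s2 \<and> nvar s2 ''i'' = Suc m)"
    proof (rule runs_SeqI)
      fix s1 assume "I (Suc m) s1" "frame (writes body) s' s1"
      then show "runs \<omega> ?incr s1 4 (\<lambda>s2. I (Suc m) s2 \<and> nvar s2 ''i'' = Suc m)"
        using frameD(1)[of "writes body" s' s1 "''i''"] counter J
        by (simp add: runs_atomic I_counter)
    qed simp
    then have "runs \<omega> (Seq body ?incr) s' (T + 4) (?J (Suc m))"
    proof (rule runs_mono[OF runs_frame le_refl])
      fix s2
      assume s2: "(I (Suc m) s2 \<and> nvar s2 ''i'' = Suc m) \<and> frame (writes (Seq body ?incr)) s' s2"
      have "frame ?W s s2"
        by (rule frame_trans[OF conjunct2[OF conjunct2[OF J]] conjunct2[OF s2]]) auto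
      with s2 show "?J (Suc m) s2" by blast
    qed
    then show "bval ?b s' \<and> runs \<omega> (Seq body ?incr) s' (T + 4) (?J (Suc m))"
      using bound[OF J] m by blast
  next
    fix s' assume "?J ?N s'"
    then show "\<not> bval ?b s'" using bound by blast
  qed (use time in \<open>simp add: algebra_simps\<close>)
  then have "runs \<omega> (While ?b (Seq body ?incr)) ?s0 (U - 2) (I ?N)"
    by (rule runs_mono) simp_all
  then show ?thesis using time by (simp add: for_loop_def runs_atomic numeral_2_eq_2)
qed

section \<open>Vector operations on the machine\<close>

definition array_vec :: "nat \<Rightarrow> state \<Rightarrow> vname \<Rightarrow> real vec" where
  "array_vec n s a = vec n (rarr s a)"

lemma array_vec_carrier [simp]: "array_vec n s a \<in> carrier_vec n"
  by (simp add: array_vec_def)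

definition zero_u :: com where
  "zero_u = for_loop ''n'' (RStore ''u'' (NVar ''i'') (RConst 0))"

lemma writes_zero_u [simp]: "writes zero_u = {NatVar ''i'', RealArr ''u''}"
  by (simp add: zero_u_def)

lemma runs_zero_u:
  assumes n: "nvar s ''n'' = n"
  shows "runs \<omega> zero_u s (100 * Suc n) (\<lambda>s'. array_vec n s' ''u'' = 0\<^sub>v n)"
proof -
  have "runs \<omega> zero_u s (100 * Suc n) (\<lambda>s'. \<forall>i<nvar s ''n''. rarr s' ''u'' i = 0)"
    unfolding zero_u_def
    by (rule runs_for_loop[where T = 90 and I = "\<lambda>m s'. \<forall>i<m. rarr s' ''u'' i = 0"])
      (simp_all add: runs_atomic less_Suc_eq n)
  then show ?thesis by (rule runs_mono) (auto simp: array_vec_def n)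
qed

datatype mat_regs = MatRegs (nnz_reg: vname) (row_reg: vname) (col_reg: vname) (val_reg: vname)

abbreviation entry_row :: "mat_regs \<Rightarrow> nexp" where "entry_row R \<equiv> NArr (row_reg R) (NVar ''i'')"
abbreviation entry_col :: "mat_regs \<Rightarrow> nexp" where "entry_col R \<equiv> NArr (col_reg R) (NVar ''i'')"
abbreviation entry_val :: "mat_regs \<Rightarrow> rexp" where "entry_val R \<equiv> RArr (val_reg R) (NVar ''i'')"

definition holds_matrix :: "state \<Rightarrow> mat_regs \<Rightarrow> (nat \<times> nat) list \<Rightarrow> real mat \<Rightarrow> bool" where
  "holds_matrix s R xs A \<longleftrightarrow> nvar s (nnz_reg R) = length xs \<and>
     (\<forall>j<length xs. narr s (row_reg R) j = fst (xs ! j) \<and> narr s (col_reg R) j = snd (xs ! j) \<and>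
       rarr s (val_reg R) j = A $$ (xs ! j))"

lemma sum_list_nonzeros:
  assumes xs: "lists_nonzeros xs A" and A: "A \<in> carrier_mat n n"
    and F: "\<And>i j. A $$ (i, j) = 0 \<Longrightarrow> F (i, j) = 0"
  shows "(\<Sum>k<length xs. F (xs ! k)) = (\<Sum>i<n. \<Sum>j<n. F (i, j) :: real)"
proof -
  have "(\<Sum>k<length xs. F (xs ! k)) = sum_list (map F xs)"
    by (simp add: sum_list_sum_nth atLeast0LessThan)
  also have "\<dots> = sum F (nonzeros A)"
    using xs by (simp add: lists_nonzeros_def sum_list_distinct_conv_sum_set)
  also have "\<dots> = sum F ({..<n} \<times> {..<n})"
    using A F by (intro sum.mono_neutral_left) (auto simp: nonzeros_def)
  also have "\<dots> = (\<Sum>i<n. \<Sum>j<n. F (i, j))"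
    by (simp add: sum.cartesian_product)
  finally show ?thesis .
qed

lemma mult_mat_vec_eq_sum_nonzeros:
  assumes xs: "lists_nonzeros xs A" and A: "A \<in> carrier_mat n n" and z: "z \<in> carrier_vec n"
    and i: "i < n"
  shows "(A *\<^sub>v z) $ i
      = (\<Sum>k<length xs. if fst (xs ! k) = i then A $$ (xs ! k) * z $ snd (xs ! k) else 0)"
proof -
  have "(\<Sum>k<length xs. if fst (xs ! k) = i then A $$ (xs ! k) * z $ snd (xs ! k) else 0)
      = (\<Sum>i'<n. \<Sum>j<n. if fst (i', j) = i then A $$ (i', j) * z $ snd (i', j) else 0)"
    by (rule sum_list_nonzeros[OF xs A]) auto
  also have "\<dots> = (\<Sum>i'<n. if i' = i then (\<Sum>j<n. A $$ (i', j) * z $ j) else 0)"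
    by (intro sum.cong) auto
  also have "\<dots> = (A *\<^sub>v z) $ i" using A z i by (simp add: scalar_prod_def atLeast0LessThan)
  finally show ?thesis by (rule sym)
qed

lemma quad_form_eq_sum_nonzeros:
  assumes xs: "lists_nonzeros xs A" and A: "A \<in> carrier_mat n n" and z: "z \<in> carrier_vec n"
  shows "quad_form A z = (\<Sum>k<length xs. A $$ (xs ! k) * (z $ fst (xs ! k) * z $ snd (xs ! k)))"
  unfolding quad_form_eq_sum[OF A z]
  by (subst sum_list_nonzeros[OF xs A, of "\<lambda>ij. A $$ ij * (z $ fst ij * z $ snd ij)"]) auto

lemma lists_nonzeros_nth_less:
  assumes "lists_nonzeros xs A" "A \<in> carrier_mat n n" "k < length xs"
  shows "fst (xs ! k) < n" "snd (xs ! k) < n"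
proof -
  have "xs ! k \<in> nonzeros A" using nth_mem[OF assms(3)] assms(1) by (simp add: lists_nonzeros_def)
  then show "fst (xs ! k) < n" "snd (xs ! k) < n"
    using carrier_matD[OF assms(2)] by (simp_all add: nonzeros_def case_prod_beta)
qed

definition add_entry :: "mat_regs \<Rightarrow> rexp \<Rightarrow> com" where
  "add_entry R c = RStore ''u'' (entry_row R) (RAdd (RArr ''u'' (entry_row R))
     (RMul c (RMul (entry_val R) (RAdd (RArr ''w'' (entry_col R)) (RArr ''v'' (entry_col R))))))"

definition add_product :: "mat_regs \<Rightarrow> rexp \<Rightarrow> com" where
  "add_product R c = for_loop (nnz_reg R) (add_entry R c)"

lemma writes_add_entry [simp]: "writes (add_entry R c) = {RealArr ''u''}"
  by (simp add: add_entry_def)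

lemma writes_add_product [simp]: "writes (add_product R c) = {NatVar ''i'', RealArr ''u''}"
  by (simp add: add_product_def)

lemma runs_add_product:
  assumes regs: "nnz_reg R \<noteq> ''i''" "val_reg R \<noteq> ''u''" and hold: "holds_matrix s R xs A"
    and xs: "lists_nonzeros xs A" and A: "A \<in> carrier_mat n n"
    and c: "\<And>s'. rvar s' = rvar s \<Longrightarrow> rval c s' = a" "rcost c = 1"
  shows "runs \<omega> (add_product R c) s (100 * Suc (length xs)) (\<lambda>s'. array_vec n s' ''u'' =
    array_vec n s ''u'' + a \<cdot>\<^sub>v (A *\<^sub>v (array_vec n s ''w'' + array_vec n s ''v'')))"
proof -
  define z where "z = array_vec n s ''w'' + array_vec n s ''v''"
  define partial where "partial i m
      = (\<Sum>j<m. if fst (xs ! j) = i then A $$ (xs ! j) * z $ snd (xs ! j) else 0)"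
    for i m
  have partial: "partial i (length xs) = (A *\<^sub>v z) $ i" if "i < n" for i
    unfolding partial_def
    by (rule mult_mat_vec_eq_sum_nonzeros[OF xs A _ that, symmetric]) (simp add: z_def)
  let ?I = "\<lambda>m s'. \<forall>i. rarr s' ''u'' i = rarr s ''u'' i + a * partial i m"
  have nnz: "nvar s (nnz_reg R) = length xs" using hold by (simp add: holds_matrix_def)
  have "runs \<omega> (add_product R c) s (100 * Suc (length xs)) (?I (nvar s (nnz_reg R)))"
    unfolding add_product_def
  proof (rule runs_for_loop[where T = 90])
    fix m and s' :: state assume m: "m < nvar s (nnz_reg R)" and I: "?I m s'"
      and i: "nvar s' ''i'' = m"
      and "frame (insert (NatVar ''i'') (writes (add_entry R c))) s s'"
    then have fr: "frame {NatVar ''i'', RealArr ''u''} s s'" by simp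
    have m': "m < length xs" using m nnz by simp
    have "rvar s' = rvar s" using frameD(2)[OF fr] by auto
    then have c': "rval c s' = a" by (rule c(1))
    have entry: "narr s' (row_reg R) m = fst (xs ! m)" "narr s' (col_reg R) m = snd (xs ! m)"
      "rarr s' (val_reg R) m = A $$ (xs ! m)"
      using hold m' regs by (simp_all add: holds_matrix_def frameD[OF fr])
    have "rarr s' ''w'' (snd (xs ! m)) + rarr s' ''v'' (snd (xs ! m)) = z $ snd (xs ! m)"
      using lists_nonzeros_nth_less(2)[OF xs A m'] by (simp add: z_def array_vec_def frameD[OF fr])
    then show "runs \<omega> (add_entry R c) s' 90 (?I (Suc m))"
      using I by (simp add: add_entry_def runs_atomic c' c(2) i entry partial_def algebra_simps)
  qed (simp_all add: nnz partial_def regs)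
  then show ?thesis
    unfolding z_def[symmetric]
  proof (rule runs_mono)
    fix s' :: state assume "?I (nvar s (nnz_reg R)) s'"
    then show "array_vec n s' ''u'' = array_vec n s ''u'' + a \<cdot>\<^sub>v (A *\<^sub>v z)"
      using A by (intro eq_vecI) (simp_all add: array_vec_def nnz partial del: index_mult_mat_vec)
  qed simp
qed

definition form_entry :: "mat_regs \<Rightarrow> vname \<Rightarrow> com" where
  "form_entry R acc = RAssign acc (RAdd (RVar acc)
     (RMul (entry_val R) (RMul (RArr ''w'' (entry_row R)) (RArr ''w'' (entry_col R)))))"

definition eval_form :: "mat_regs \<Rightarrow> vname \<Rightarrow> com" where
  "eval_form R acc = Seq (RAssign acc (RConst 0)) (for_loop (nnz_reg R) (form_entry R acc))"

lemma writes_form_entry [simp]: "writes (form_entry R acc) = {RealVar acc}"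
  by (simp add: form_entry_def)

lemma writes_eval_form [simp]: "writes (eval_form R acc) = {NatVar ''i'', RealVar acc}"
  by (auto simp: eval_form_def)

lemma runs_eval_form:
  assumes regs: "nnz_reg R \<noteq> ''i''" and hold: "holds_matrix s R xs A"
    and xs: "lists_nonzeros xs A" and A: "A \<in> carrier_mat n n"
  shows "runs \<omega> (eval_form R acc) s (2 + 100 * Suc (length xs))
    (\<lambda>s'. rvar s' acc = quad_form A (array_vec n s ''w''))"
proof -
  define z where "z = array_vec n s ''w''"
  let ?body = "form_entry R acc"
  let ?s0 = "s\<lparr>rvar := (rvar s)(acc := 0)\<rparr>"
  let ?I = "\<lambda>m s'. rvar s' acc = (\<Sum>j<m. A $$ (xs ! j) * (z $ fst (xs ! j) * z $ snd (xs ! j)))"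
  have nnz: "nvar s (nnz_reg R) = length xs" using hold by (simp add: holds_matrix_def)
  have "runs \<omega> (for_loop (nnz_reg R) ?body) ?s0 (100 * Suc (length xs)) (?I (nvar ?s0 (nnz_reg R)))"
  proof (rule runs_for_loop[where T = 90])
    fix m and s' :: state assume m: "m < nvar ?s0 (nnz_reg R)" and I: "?I m s'"
      and i: "nvar s' ''i'' = m"
      and "frame (insert (NatVar ''i'') (writes ?body)) ?s0 s'"
    then have fr: "frame {NatVar ''i'', RealVar acc} ?s0 s'" by simp
    have m': "m < length xs" using m nnz by simp
    have "narr s' (row_reg R) m = fst (xs ! m)" "narr s' (col_reg R) m = snd (xs ! m)"
      "rarr s' (val_reg R) m = A $$ (xs ! m)"
      using hold m' by (simp_all add: holds_matrix_def frameD[OF fr])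
    moreover have "rarr s' ''w'' j = z $ j" if "j < n" for j
      using that by (simp add: z_def array_vec_def frameD[OF fr])
    ultimately show "runs \<omega> ?body s' 90 (?I (Suc m))"
      using I lists_nonzeros_nth_less[OF xs A m'] by (simp add: form_entry_def runs_atomic i)
  qed (simp_all add: nnz regs)
  then have "runs \<omega> (for_loop (nnz_reg R) ?body) ?s0 (100 * Suc (length xs))
      (\<lambda>s'. rvar s' acc = quad_form A z)"
    by (simp add: nnz quad_form_eq_sum_nonzeros[OF xs A] z_def)
  then show ?thesis by (simp add: eval_form_def runs_atomic z_def)
qed

definition eval_norm :: com where
  "eval_norm = Seq (RAssign ''nn'' (RConst 0)) (for_loop ''n''
     (RAssign ''nn'' (RAdd (RVar ''nn'')
       (RMul (RArr ''w'' (NVar ''i'')) (RArr ''w'' (NVar ''i''))))))"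

lemma writes_eval_norm [simp]: "writes eval_norm = {NatVar ''i'', RealVar ''nn''}"
  by (auto simp: eval_norm_def)

lemma runs_eval_norm:
  assumes n: "nvar s ''n'' = n"
  shows "runs \<omega> eval_norm s (2 + 100 * Suc n)
      (\<lambda>s'. rvar s' ''nn'' = array_vec n s ''w'' \<bullet> array_vec n s ''w'')"
proof -
  let ?body = "RAssign ''nn''
      (RAdd (RVar ''nn'') (RMul (RArr ''w'' (NVar ''i'')) (RArr ''w'' (NVar ''i''))))"
  let ?s0 = "s\<lparr>rvar := (rvar s)(''nn'' := 0)\<rparr>"
  let ?I = "\<lambda>m s'. rvar s' ''nn'' = (\<Sum>i<m. rarr s ''w'' i * rarr s ''w'' i)"
  have "runs \<omega> (for_loop ''n'' ?body) ?s0 (100 * Suc n) (?I (nvar ?s0 ''n''))"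
  proof (rule runs_for_loop[where T = 90])
    fix m and s' :: state assume I: "?I m s'" "nvar s' ''i'' = m"
      "frame (insert (NatVar ''i'') (writes ?body)) ?s0 s'"
    then have "rarr s' ''w'' = rarr s ''w''" using frameD(4)[OF I(3), of "''w''"] by simp
    then show "runs \<omega> ?body s' 90 (?I (Suc m))" using I(1,2) by (simp add: runs_atomic)
  qed (simp_all add: n)
  then have "runs \<omega> eval_norm s (2 + 100 * Suc n) (?I n)"
    using n by (simp add: eval_norm_def runs_atomic)
  then show ?thesis
    by (rule runs_mono) (simp_all add: array_vec_def scalar_prod_def atLeast0LessThan)
qed

definition draw_block :: com where
  "draw_block = Seq (RAssign ''rn'' (RConst 0)) (for_loop ''n''
     (Seq (Draw ''x'') (Seq (RStore ''w'' (NVar ''i'') (RVar ''x''))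
       (Seq (RStore ''v'' (NVar ''i'') (RVar ''x''))
       (RAssign ''rn'' (RAdd (RVar ''rn'') (RConst 1)))))))"

lemma writes_draw_block [simp]:
  "writes draw_block = {NatVar ''i'', RealVar ''rn'', RealVar ''x'', Tape, RealArr ''w'',
    RealArr ''v''}"
  by (auto simp: draw_block_def)

lemma runs_draw_block:
  assumes n: "nvar s ''n'' = n"
  shows "runs \<omega> draw_block s (2 + 100 * Suc n)
    (\<lambda>s'. drawn s' = drawn s + n \<and> rvar s' ''rn'' = real n \<and>
      array_vec n s' ''w'' = tape_block n (drawn s) \<omega> \<and>
      array_vec n s' ''v'' = tape_block n (drawn s) \<omega>)"
proof -
  let ?body = "Seq (Draw ''x'') (Seq (RStore ''w'' (NVar ''i'') (RVar ''x''))
    (Seq (RStore ''v'' (NVar ''i'') (RVar ''x''))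
      (RAssign ''rn'' (RAdd (RVar ''rn'') (RConst 1)))))"
  let ?s0 = "s\<lparr>rvar := (rvar s)(''rn'' := 0)\<rparr>"
  let ?I = "\<lambda>m s'. drawn s' = drawn s + m \<and> rvar s' ''rn'' = real m \<and>
     (\<forall>i<m. rarr s' ''w'' i = \<omega> (drawn s + i) \<and> rarr s' ''v'' i = \<omega> (drawn s + i))"
  have "runs \<omega> (for_loop ''n'' ?body) ?s0 (100 * Suc n) (?I (nvar ?s0 ''n''))"
  proof (rule runs_for_loop[where T = 90])
    fix m and s' :: state assume "?I m s'" "nvar s' ''i'' = m"
    then show "runs \<omega> ?body s' 90 (?I (Suc m))" by (simp add: runs_atomic less_Suc_eq)
  qed (simp_all add: n)
  then have "runs \<omega> draw_block s (2 + 100 * Suc n) (?I n)"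
    using n by (simp add: draw_block_def runs_atomic)
  then show ?thesis by (rule runs_mono) (auto simp: array_vec_def tape_block_def)
qed

text \<open>With \<open>u = A(\<gamma>) (w + v)\<close>, the value of \<open>t\<close> is the next coordinate of the filter matrix
  times \<open>w + v\<close>.\<close>

definition update_entry :: com where
  "update_entry =
     Seq (RAssign ''t'' (RSub
         (RMul (RAdd (RConst 1)
           (RDiv (RMul (RConst 3) (RVar ''xi'')) (RAdd (RConst 1) (RVar ''gamma''))))
           (RAdd (RArr ''w'' (NVar ''i'')) (RArr ''v'' (NVar ''i''))))
         (RMul (RDiv (RConst 2) (RAdd (RConst 1) (RVar ''gamma''))) (RArr ''u'' (NVar ''i'')))))
     (Seq (RAssign ''x'' (RArr ''w'' (NVar ''i'')))
     (Seq (RStore ''w'' (NVar ''i'') (RAdd (RVar ''t'') (RArr ''v'' (NVar ''i''))))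
          (RStore ''v'' (NVar ''i'') (RSub (RVar ''t'') (RVar ''x'')))))"

definition update_vectors :: com where
  "update_vectors = for_loop ''n'' update_entry"

lemma writes_update_entry [simp]:
  "writes update_entry = {RealVar ''t'', RealVar ''x'', RealArr ''w'', RealArr ''v''}"
  by (auto simp: update_entry_def)

lemma writes_update_vectors [simp]:
  "writes update_vectors
    = {NatVar ''i'', RealVar ''t'', RealVar ''x'', RealArr ''w'', RealArr ''v''}"
  by (auto simp: update_vectors_def)

lemma runs_update_vectors:
  fixes s \<xi> \<gamma>
  assumes n: "nvar s ''n'' = n" and vars: "rvar s ''xi'' = \<xi>" "rvar s ''gamma'' = \<gamma>"
  defines "b \<equiv> (1 + 3 * \<xi> / (1 + \<gamma>)) \<cdot>\<^sub>v (array_vec n s ''w'' + array_vec n s ''v'')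
     + (- 2 / (1 + \<gamma>)) \<cdot>\<^sub>v array_vec n s ''u''"
  shows "runs \<omega> update_vectors s (100 * Suc n)
    (\<lambda>s'. array_vec n s' ''w'' = b + array_vec n s ''v'' \<and>
      array_vec n s' ''v'' = b - array_vec n s ''w'')"
proof -
  let ?b = "\<lambda>i. (1 + 3 * \<xi> / (1 + \<gamma>)) * (rarr s ''w'' i + rarr s ''v'' i) -
      2 / (1 + \<gamma>) * rarr s ''u'' i"
  let ?I = "\<lambda>m s'. (\<forall>i<m. rarr s' ''w'' i = ?b i + rarr s ''v'' i \<and>
      rarr s' ''v'' i = ?b i - rarr s ''w'' i) \<and>
     (\<forall>i\<ge>m. rarr s' ''w'' i = rarr s ''w'' i \<and> rarr s' ''v'' i = rarr s ''v'' i)"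
  have "runs \<omega> update_vectors s (100 * Suc n) (?I (nvar s ''n''))"
    unfolding update_vectors_def
  proof (rule runs_for_loop[where T = 90])
    fix m and s' :: state assume I: "?I m s'" and i: "nvar s' ''i'' = m"
      and fr: "frame (insert (NatVar ''i'') (writes update_entry)) s s'"
    have "rvar s' ''xi'' = \<xi>" "rvar s' ''gamma'' = \<gamma>" "rarr s' ''u'' = rarr s ''u''"
      using frameD[OF fr] vars by simp_all
    then show "runs \<omega> update_entry s' 90 (?I (Suc m))"
      using I i by (auto simp: update_entry_def runs_atomic less_Suc_eq)
  qed (simp_all add: n)
  then show ?thesis
    by (rule runs_mono) (auto simp: n b_def array_vec_def intro!: eq_vecI)
qed

definition update_scalars :: com where
  "update_scalars =
     Seq (RAssign ''t'' (RMul (RAdd (RConst 1) (RVar ''eta'')) (RAdd (RVar ''cw'') (RVar ''cv''))))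
     (Seq (RAssign ''x'' (RVar ''cw''))
     (Seq (RAssign ''cw'' (RAdd (RVar ''t'') (RVar ''cv'')))
          (RAssign ''cv'' (RSub (RVar ''t'') (RVar ''x'')))))"

lemma writes_update_scalars [simp]:
  "writes update_scalars = {RealVar ''t'', RealVar ''x'', RealVar ''cw'', RealVar ''cv''}"
  by (auto simp: update_scalars_def)

lemma runs_update_scalars:
  assumes "rvar s ''eta'' = \<eta>" "rvar s ''cw'' = chebW (1 + \<eta>) m" "rvar s ''cv'' = chebV (1 + \<eta>) m"
  shows "runs \<omega> update_scalars s 100
    (\<lambda>s'. rvar s' ''cw'' = chebW (1 + \<eta>) (Suc m) \<and> rvar s' ''cv'' = chebV (1 + \<eta>) (Suc m))"
  using assms by (simp add: update_scalars_def runs_atomic)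

section \<open>The program\<close>

abbreviation "A0_regs \<equiv> MatRegs ''nnz0'' ''row0'' ''col0'' ''val0''"
abbreviation "A1_regs \<equiv> MatRegs ''nnz1'' ''row1'' ''col1'' ''val1''"

definition pencil_product :: com where
  "pencil_product = Seq zero_u
    (Seq (add_product A0_regs (RConst 1)) (add_product A1_regs (RVar ''gamma'')))"

definition chebyshev_step :: com where
  "chebyshev_step = Seq pencil_product (Seq update_vectors update_scalars)"

definition chebyshev_guard :: bexp where
  "chebyshev_guard = BNot (RLe (RMul (RVar ''th'') (RVar ''th''))
     (RMul (RVar ''eta'') (RMul (RVar ''cw'') (RVar ''cw''))))"

definition prepare_filter :: com where
  "prepare_filter =
     Seq (RAssign ''gamma'' (RDiv (RAdd (RVar ''l'') (RVar ''r'')) (RConst 2)))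
     (Seq (RAssign ''eta'' (RDiv (RVar ''xi'') (RAdd (RConst 1) (RVar ''gamma''))))
     (Seq (RAssign ''th'' (RDiv
         (RMul (RMul (RMul (RConst 3) (RVar ''rn'')) (RAdd (RVar ''cnt'') (RConst 1)))
           (RAdd (RVar ''cnt'') (RConst 2)))
         (RVar ''p'')))
     (Seq (RAssign ''cw'' (RConst 1)) (RAssign ''cv'' (RConst 1)))))"

definition run_filter :: com where
  "run_filter = Seq draw_block (Seq prepare_filter (While chebyshev_guard chebyshev_step))"

definition evaluate_probe :: com where
  "evaluate_probe = Seq (eval_form A0_regs ''a0'') (Seq (eval_form A1_regs ''a1'') eval_norm)"

definition reset_bracket :: com where
  "reset_bracket = Cond (RLe (RVar ''xi'') (RSub (RVar ''r'') (RVar ''l''))) Skip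
     (Seq (RAssign ''xi'' (RDiv (RVar ''xi'') (RConst 2))) (Seq (RAssign ''l'' (RConst 0))
       (RAssign ''r'' (RVar ''zeta''))))"

definition decide :: com where
  "decide = Cond (BNot (RLe (RMul (RMul (RConst 3) (RVar ''xi'')) (RVar ''nn''))
       (RMul (RConst 2) (RAdd (RVar ''a0'') (RMul (RVar ''gamma'') (RVar ''a1''))))))
     (Seq (RAssign ''cnt'' (RAdd (RVar ''cnt'') (RConst 1)))
       (Cond (RLe (RVar ''a1'') (RConst 0)) (RAssign ''r'' (RVar ''gamma''))
         (RAssign ''l'' (RVar ''gamma''))))
     (NAssign ''done'' (NConst 1))"

definition search_step :: com where
  "search_step = Seq reset_bracket (Seq run_filter (Seq evaluate_probe decide))"

definition approx_xi :: com where
  "approx_xi = Seq (RAssign ''xi'' (RConst 1)) (Seq (RAssign ''r'' (RVar ''zeta''))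
     (While (NLe (NVar ''done'') (NConst 0)) search_step))"

lemma writes_pencil_product [simp]: "writes pencil_product = {NatVar ''i'', RealArr ''u''}"
  by (simp add: pencil_product_def)

lemma writes_chebyshev_step [simp]:
  "writes chebyshev_step = {NatVar ''i'', RealVar ''t'', RealVar ''x'', RealVar ''cw'',
    RealVar ''cv'', RealArr ''u'', RealArr ''w'', RealArr ''v''}"
  by (auto simp: chebyshev_step_def)

lemma writes_prepare_filter [simp]:
  "writes prepare_filter
    = {RealVar ''gamma'', RealVar ''eta'', RealVar ''th'', RealVar ''cw'', RealVar ''cv''}"
  by (auto simp: prepare_filter_def)

lemma writes_run_filter [simp]:
  "writes run_filter = {NatVar ''i'', RealVar ''rn'', RealVar ''x'', RealVar ''t'',
    RealVar ''gamma'', RealVar ''eta'', RealVar ''th'', RealVar ''cw'', RealVar ''cv'', Tape,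
    RealArr ''u'', RealArr ''w'', RealArr ''v''}"
  by (auto simp: run_filter_def)

lemma writes_evaluate_probe [simp]:
  "writes evaluate_probe = {NatVar ''i'', RealVar ''a0'', RealVar ''a1'', RealVar ''nn''}"
  by (auto simp: evaluate_probe_def)

locale gtrs_run = multiplier_search +
  fixes xs0 xs1 :: "(nat \<times> nat) list"
  assumes xs0: "lists_nonzeros xs0 A0" and xs1: "lists_nonzeros xs1 A1"
begin

definition nnz :: nat where "nnz = length xs0 + length xs1"

lemma nnz_eq_card: "nnz = card (nonzeros A0) + card (nonzeros A1)"
  unfolding nnz_def using xs0 xs1 by (metis distinct_card lists_nonzeros_def)

lemma nnz_bounds: "n \<le> nnz" "1 \<le> nnz"
  using n_le_card_nonzeros n_pos by (simp_all add: nnz_eq_card)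

definition input_ok :: "state \<Rightarrow> bool" where
  "input_ok s \<longleftrightarrow> nvar s ''n'' = n \<and> rvar s ''zeta'' = \<zeta> \<and> rvar s ''p'' = p \<and>
     holds_matrix s A0_regs xs0 A0 \<and> holds_matrix s A1_regs xs1 A1"

definition input_locs :: "loc set" where
  "input_locs = {NatVar ''n'', NatVar ''nnz0'', NatVar ''nnz1'', RealVar ''zeta'', RealVar ''p'',
     NatArr ''row0'', NatArr ''col0'', RealArr ''val0'',
     NatArr ''row1'', NatArr ''col1'', RealArr ''val1''}"

lemma input_ok_frame: "input_ok s \<Longrightarrow> frame W s s' \<Longrightarrow> W \<inter> input_locs = {} \<Longrightarrow> input_ok s'"
  by (simp add: frameD input_ok_def input_locs_def holds_matrix_def)

lemma runs_pencil_product: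
  assumes ok: "input_ok s" and \<gamma>: "rvar s ''gamma'' = \<gamma>"
  shows "runs \<omega> pencil_product s (500 * nnz)
    (\<lambda>s'. array_vec n s' ''u'' = A \<gamma> *\<^sub>v (array_vec n s ''w'' + array_vec n s ''v''))"
  unfolding pencil_product_def
proof (rule runs_SeqI[OF runs_zero_u])
  show "nvar s ''n'' = n" using ok by (simp add: input_ok_def)
  define z where "z = array_vec n s ''w'' + array_vec n s ''v''"
  fix s1 assume u1: "array_vec n s1 ''u'' = 0\<^sub>v n" and fr1: "frame (writes zero_u) s s1"
  have ok1: "input_ok s1" using input_ok_frame[OF ok fr1] by (simp add: input_locs_def)
  have z1: "array_vec n s1 ''w'' + array_vec n s1 ''v'' = z"
    using frameD[OF fr1] by (simp add: z_def array_vec_def)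
  show "runs \<omega> (Seq (add_product A0_regs (RConst 1)) (add_product A1_regs (RVar ''gamma''))) s1
      (100 * Suc (length xs0) + 100 * Suc (length xs1))
      (\<lambda>s'. array_vec n s' ''u'' = A \<gamma> *\<^sub>v (array_vec n s ''w'' + array_vec n s ''v''))"
  proof (rule runs_SeqI[OF runs_add_product[OF _ _ _ xs0 A0(1), where a = 1]])
    show "holds_matrix s1 A0_regs xs0 A0" using ok1 by (simp add: input_ok_def)
    fix s2 assume u2: "array_vec n s2 ''u'' = array_vec n s1 ''u'' +
        1 \<cdot>\<^sub>v (A0 *\<^sub>v (array_vec n s1 ''w'' + array_vec n s1 ''v''))"
      and fr2: "frame (writes (add_product A0_regs (RConst 1))) s1 s2"
    have ok2: "input_ok s2" using input_ok_frame[OF ok1 fr2] by (simp add: input_locs_def)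
    have z2: "array_vec n s2 ''w'' + array_vec n s2 ''v'' = z"
      unfolding z1[symmetric] using frameD[OF fr2] by (simp add: array_vec_def)
    have \<gamma>2: "rvar s2 ''gamma'' = \<gamma>" using frameD[OF fr1] frameD[OF fr2] \<gamma> by simp
    show "runs \<omega> (add_product A1_regs (RVar ''gamma'')) s2 (100 * Suc (length xs1))
        (\<lambda>s'. array_vec n s' ''u'' = A \<gamma> *\<^sub>v (array_vec n s ''w'' + array_vec n s ''v''))"
    proof (rule runs_mono[OF runs_add_product[OF _ _ _ xs1 A1(1), where a = \<gamma>] le_refl])
      show "holds_matrix s2 A1_regs xs1 A1" using ok2 by (simp add: input_ok_def)
      fix s3 assume "array_vec n s3 ''u'' = array_vec n s2 ''u'' +
        \<gamma> \<cdot>\<^sub>v (A1 *\<^sub>v (array_vec n s2 ''w'' + array_vec n s2 ''v''))"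
      moreover have "z \<in> carrier_vec n" by (simp add: z_def)
      ultimately show "array_vec n s3 ''u'' = A \<gamma> *\<^sub>v (array_vec n s ''w'' + array_vec n s ''v'')"
        using A0(1) by (simp add: u1 u2 z1 z2 pencil_mult_vec flip: z_def)
    qed (use \<gamma>2 in simp_all)
  qed simp_all
qed (use nnz_bounds in \<open>simp add: nnz_def\<close>)

definition bracket_state :: "nat \<Rightarrow> bracket \<Rightarrow> state \<Rightarrow> bool" where
  "bracket_state k b s \<longleftrightarrow> input_ok s \<and> rvar s ''xi'' = guess b \<and> rvar s ''l'' = lower b \<and>
     rvar s ''r'' = upper b \<and> rvar s ''cnt'' = real k \<and> nvar s ''done'' = 0"

definition bracket_locs :: "loc set" where
  "bracket_locs = input_locs
    \<union> {RealVar ''xi'', RealVar ''l'', RealVar ''r'', RealVar ''cnt'', NatVar ''done''}"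

lemma bracket_state_frame:
  assumes st: "bracket_state k b s" and fr: "frame W s s'" and W: "W \<inter> bracket_locs = {}"
  shows "bracket_state k b s'"
proof -
  have "input_ok s'"
    using input_ok_frame[OF _ fr] st W by (auto simp: bracket_state_def bracket_locs_def)
  then show ?thesis using st W by (simp add: bracket_state_def bracket_locs_def frameD[OF fr])
qed

definition filter_params :: "nat \<Rightarrow> bracket \<Rightarrow> state \<Rightarrow> bool" where
  "filter_params k b s \<longleftrightarrow> input_ok s \<and> rvar s ''xi'' = guess b \<and> rvar s ''gamma'' = mid b \<and>
     rvar s ''eta'' = rel_gap b \<and> rvar s ''th'' = threshold k"

definition filter_iterate :: "bracket \<Rightarrow> real vec \<Rightarrow> nat \<Rightarrow> state \<Rightarrow> bool" where
  "filter_iterate b g m s \<longleftrightarrow>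
     rvar s ''cw'' = chebW (1 + rel_gap b) m \<and> rvar s ''cv'' = chebV (1 + rel_gap b) m \<and>
     array_vec n s ''w'' = chebW_vec (bracket_filter b) g m \<and>
     array_vec n s ''v'' = chebV_vec (bracket_filter b) g m"

lemma runs_chebyshev_step:
  assumes params: "filter_params k b s" and iterate: "filter_iterate b g m s"
  shows "runs \<omega> chebyshev_step s (900 * nnz) (filter_iterate b g (Suc m))"
  unfolding chebyshev_step_def
proof (rule runs_SeqI[OF runs_pencil_product[where \<gamma> = "mid b"]])
  show "input_ok s" and "rvar s ''gamma'' = mid b"
    using params by (simp_all add: filter_params_def)
  define z where "z = array_vec n s ''w'' + array_vec n s ''v''"
  fix s1
  assume u1: "array_vec n s1 ''u'' = A (mid b) *\<^sub>v (array_vec n s ''w'' + array_vec n s ''v'')"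
    and fr1: "frame (writes pencil_product) s s1"
  have arrays1: "array_vec n s1 ''w'' = array_vec n s ''w''"
    "array_vec n s1 ''v'' = array_vec n s ''v''"
    using frameD[OF fr1] by (simp_all add: array_vec_def)
  have vars1: "nvar s1 ''n'' = n" "rvar s1 ''xi'' = guess b" "rvar s1 ''gamma'' = mid b"
    using frameD[OF fr1] params by (simp_all add: filter_params_def input_ok_def)
  have filter_z: "(1 + 3 * guess b / (1 + mid b)) \<cdot>\<^sub>v (array_vec n s ''w'' + array_vec n s ''v'')
      + (- 2 / (1 + mid b)) \<cdot>\<^sub>v array_vec n s1 ''u'' = bracket_filter b *\<^sub>v z"
    unfolding bracket_filter_def u1 z_def by (subst filter_mat_mult_vec[of _ n]) simp_all
  show "runs \<omega> (Seq update_vectors update_scalars) s1 (100 * Suc n + 100)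
      (filter_iterate b g (Suc m))"
  proof (rule runs_SeqI[OF runs_update_vectors[OF vars1, unfolded arrays1 filter_z]])
    fix s2 assume arrays2: "array_vec n s2 ''w'' = bracket_filter b *\<^sub>v z + array_vec n s ''v'' \<and>
        array_vec n s2 ''v'' = bracket_filter b *\<^sub>v z - array_vec n s ''w''"
      and fr2: "frame (writes update_vectors) s1 s2"
    have "rvar s2 ''eta'' = rel_gap b" "rvar s2 ''cw'' = chebW (1 + rel_gap b) m"
      "rvar s2 ''cv'' = chebV (1 + rel_gap b) m"
      using frameD[OF fr1] frameD[OF fr2] params iterate
      by (simp_all add: filter_params_def filter_iterate_def)
    from runs_frame[OF runs_update_scalars[OF this]]
    show "runs \<omega> update_scalars s2 100 (filter_iterate b g (Suc m))"
    proof (rule runs_mono[OF _ le_refl])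
      fix s3 assume s3: "(rvar s3 ''cw'' = chebW (1 + rel_gap b) (Suc m) \<and>
        rvar s3 ''cv'' = chebV (1 + rel_gap b) (Suc m)) \<and> frame (writes update_scalars) s2 s3"
      then have "array_vec n s3 ''w'' = array_vec n s2 ''w''"
        "array_vec n s3 ''v'' = array_vec n s2 ''v''"
        using frameD(4)[OF conjunct2[OF s3]] by (simp_all add: array_vec_def)
      then show "filter_iterate b g (Suc m) s3"
        using s3 arrays2 iterate by (simp add: filter_iterate_def z_def)
    qed
  qed simp
qed (use nnz_bounds in simp)

lemma runs_chebyshev_loop:
  assumes params: "filter_params k b s" and iterate: "filter_iterate b g 0 s"
    and inv: "search_inv k b"
  shows "runs \<omega> (While chebyshev_guard chebyshev_step) s (Suc (degree k b) * (1000 * nnz))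
    (filter_iterate b g (degree k b))"
proof -
  let ?I = "\<lambda>m s'. filter_params k b s' \<and> filter_iterate b g m s'"
  have guard: "bval chebyshev_guard s' \<longleftrightarrow> \<not> (threshold k)\<^sup>2 \<le> rel_gap b * (chebW (1 + rel_gap b) m)\<^sup>2"
    if "?I m s'" for m s'
    using that
    by (simp add: chebyshev_guard_def filter_params_def filter_iterate_def power2_eq_square)
  have "runs \<omega> (While chebyshev_guard chebyshev_step) s (Suc (degree k b) * (1000 * nnz))
    (?I (degree k b))"
  proof (rule runs_While)
    show "?I 0 s" using params iterate by simp
  next
    fix m s' assume m: "m < degree k b" and I: "?I m s'"
    have "filter_params k b s''" if "frame (writes chebyshev_step) s' s''" for s''
      using I input_ok_frame[OF _ that]
      by (simp add: filter_params_def input_locs_def frameD[OF that])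
    then have "runs \<omega> chebyshev_step s' (900 * nnz) (?I (Suc m))"
      by (intro runs_mono[OF runs_frame[OF runs_chebyshev_step[OF conjunct1[OF I] conjunct2[OF I]]]
        le_refl]) simp
    then show "bval chebyshev_guard s' \<and> runs \<omega> chebyshev_step s' (900 * nnz) (?I (Suc m))"
      using guard[OF I] less_cheb_degree[OF m[unfolded degree_def]] by simp
  next
    fix s' assume "?I (degree k b) s'"
    from guard[OF this] show "\<not> bval chebyshev_guard s'"
      using cheb_degree_reaches[OF rel_gap_bounds[OF inv] threshold_nonneg]
      by (simp add: degree_def)
  next
    have "1 + bcost chebyshev_guard + 900 * nnz \<le> 1000 * nnz"
      "1 + bcost chebyshev_guard \<le> 1000 * nnz"
      using nnz_bounds by (simp_all add: chebyshev_guard_def)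
    then show "degree k b * (1 + bcost chebyshev_guard + 900 * nnz) + (1 + bcost chebyshev_guard)
        \<le> Suc (degree k b) * (1000 * nnz)"
      by (metis add.commute add_le_mono mult_Suc mult_le_mono2)
  qed
  then show ?thesis by (rule runs_mono) auto
qed

lemma runs_prepare_filter:
  assumes st: "bracket_state k b s" and rn: "rvar s ''rn'' = real n"
    and g: "array_vec n s ''w'' = g" "array_vec n s ''v'' = g"
  shows "runs \<omega> prepare_filter s 50 (\<lambda>s'. filter_params k b s' \<and> filter_iterate b g 0 s')"
proof -
  let ?Q = "\<lambda>s'. rvar s' ''gamma'' = mid b \<and> rvar s' ''eta'' = rel_gap b \<and>
    rvar s' ''th'' = threshold k \<and> rvar s' ''cw'' = 1 \<and> rvar s' ''cv'' = 1"
  have "runs \<omega> prepare_filter s 50 ?Q"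
    using st rn
    by (simp add: prepare_filter_def runs_atomic bracket_state_def input_ok_def mid_def
        rel_gap_def threshold_def)
  from runs_frame[OF this] show ?thesis
  proof (rule runs_mono[OF _ le_refl])
    fix s' assume s': "?Q s' \<and> frame (writes prepare_filter) s s'"
    have "bracket_state k b s'"
      by (rule bracket_state_frame[OF st conjunct2[OF s']])
        (simp add: bracket_locs_def input_locs_def)
    then show "filter_params k b s' \<and> filter_iterate b g 0 s'"
      using s' g frameD(4)[OF conjunct2[OF s']]
      by (simp add: bracket_state_def filter_params_def filter_iterate_def array_vec_def)
  qed
qed

lemma runs_run_filter:
  assumes st: "bracket_state k b s" and tape: "drawn s = k * n" and inv: "search_inv k b"
  shows "runs \<omega> run_filter s (60 + 100 * Suc n + Suc (degree k b) * (1000 * nnz))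
    (\<lambda>s'. array_vec n s' ''w'' = filtered k \<omega> b \<and> rvar s' ''gamma'' = mid b \<and> drawn s' = Suc k * n)"
    (is "runs \<omega> run_filter s _ ?Q")
  unfolding run_filter_def
proof (rule runs_SeqI[OF runs_draw_block])
  let ?g = "tape_block n (k * n) \<omega>" and ?loop = "While chebyshev_guard chebyshev_step"
  show "nvar s ''n'' = n" using st by (simp add: bracket_state_def input_ok_def)
  fix s1 assume s1: "drawn s1 = drawn s + n \<and> rvar s1 ''rn'' = real n \<and>
      array_vec n s1 ''w'' = tape_block n (drawn s) \<omega> \<and>
      array_vec n s1 ''v'' = tape_block n (drawn s) \<omega>"
    and fr1: "frame (writes draw_block) s s1"
  have st1: "bracket_state k b s1"
    by (rule bracket_state_frame[OF st fr1]) (simp add: bracket_locs_def input_locs_def)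
  show "runs \<omega> (Seq prepare_filter ?loop) s1 (50 + Suc (degree k b) * (1000 * nnz)) ?Q"
  proof (rule runs_SeqI[OF runs_prepare_filter[OF st1, where g = ?g]])
    fix s2 assume s2: "filter_params k b s2 \<and> filter_iterate b ?g 0 s2"
      and fr2: "frame (writes prepare_filter) s1 s2"
    from runs_frame[OF runs_chebyshev_loop[OF conjunct1[OF s2] conjunct2[OF s2] inv]]
    show "runs \<omega> ?loop s2 (Suc (degree k b) * (1000 * nnz)) ?Q"
    proof (rule runs_mono[OF _ le_refl])
      fix s3 assume s3: "filter_iterate b ?g (degree k b) s3 \<and> frame (writes ?loop) s2 s3"
      then show "?Q s3"
        using s1 s2 tape frameD[OF fr2] frameD[OF conjunct2[OF s3]]
        by (simp add: filter_params_def filter_iterate_def filtered_def)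
    qed
  qed (use s1 tape in simp_all)
qed simp

lemma runs_reset_bracket:
  assumes st: "bracket_state k b s"
  shows "runs \<omega> reset_bracket s 50 (bracket_state k (reset b))"
proof -
  have "input_ok (s\<lparr>rvar := ((rvar s)(''xi'' := x, ''l'' := y, ''r'' := z))\<rparr>)" for x y z
    using input_ok_frame[of s "{RealVar ''xi'', RealVar ''l'', RealVar ''r''}"] st
    by (simp add: bracket_state_def frame_def input_locs_def)
  then show ?thesis
    using st by (simp add: reset_bracket_def runs_Cond runs_atomic bracket_state_def reset_def
      input_ok_def)
qed

lemma runs_evaluate_probe:
  assumes ok: "input_ok s" and y: "array_vec n s ''w'' = y"
  shows "runs \<omega> evaluate_probe s (6 + 100 * (nnz + n + 3)) (\<lambda>s'. rvar s' ''a0'' = quad_form A0 y \<and>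
    rvar s' ''a1'' = quad_form A1 y \<and> rvar s' ''nn'' = y \<bullet> y)"
  unfolding evaluate_probe_def
proof (rule runs_SeqI[OF runs_eval_form[OF _ _ xs0 A0(1)]])
  show "holds_matrix s A0_regs xs0 A0" using ok by (simp add: input_ok_def)
  fix s1 assume s1: "rvar s1 ''a0'' = quad_form A0 (array_vec n s ''w'')"
    and fr1: "frame (writes (eval_form A0_regs ''a0'')) s s1"
  have ok1: "input_ok s1" using input_ok_frame[OF ok fr1] by (simp add: input_locs_def)
  have y1: "array_vec n s1 ''w'' = y" using frameD(4)[OF fr1] y by (simp add: array_vec_def)
  let ?Q = "\<lambda>s'. rvar s' ''a0'' = quad_form A0 y \<and> rvar s' ''a1'' = quad_form A1 y \<and>
    rvar s' ''nn'' = y \<bullet> y"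
  show "runs \<omega> (Seq (eval_form A1_regs ''a1'') eval_norm) s1
      (2 + 100 * Suc (length xs1) + (2 + 100 * Suc n)) ?Q"
  proof (rule runs_SeqI[OF runs_eval_form[OF _ _ xs1 A1(1)]])
    show "holds_matrix s1 A1_regs xs1 A1" using ok1 by (simp add: input_ok_def)
    fix s2 assume s2: "rvar s2 ''a1'' = quad_form A1 (array_vec n s1 ''w'')"
      and fr2: "frame (writes (eval_form A1_regs ''a1'')) s1 s2"
    have n2: "nvar s2 ''n'' = n" using ok1 frameD(1)[OF fr2] by (simp add: input_ok_def)
    have y2: "array_vec n s2 ''w'' = y" using frameD(4)[OF fr2] y1 by (simp add: array_vec_def)
    show "runs \<omega> eval_norm s2 (2 + 100 * Suc n) ?Q"
    proof (rule runs_mono[OF runs_frame[OF runs_eval_norm[OF n2]] le_refl])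
      fix s3 assume s3: "rvar s3 ''nn'' = array_vec n s2 ''w'' \<bullet> array_vec n s2 ''w'' \<and>
        frame (writes eval_norm) s2 s3"
      then show "?Q s3"
        using s1 s2 y y1 y2 frameD(2)[OF fr2] frameD(2)[OF conjunct2[OF s3]] by simp
    qed
  qed simp_all
qed (simp_all add: nnz_def)

lemma runs_decide:
  assumes st: "bracket_state k b s" and \<gamma>: "rvar s ''gamma'' = mid b" and y: "y \<in> carrier_vec n"
    and vals: "rvar s ''a0'' = quad_form A0 y" "rvar s ''a1'' = quad_form A1 y"
      "rvar s ''nn'' = y \<bullet> y"
  shows "runs \<omega> decide s 100
    (\<lambda>s'. drawn s' = drawn s \<and> (if refutes b y then bracket_state (Suc k) (bisect b y) s'
      else nvar s' ''done'' = 1 \<and> rvar s' ''xi'' = guess b \<and> rvar s' ''gamma'' = mid b))"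
proof -
  have "input_ok (s\<lparr>rvar := (rvar s)(''cnt'' := c, x := d)\<rparr>)" if "x = ''l'' \<or> x = ''r''" for c d x
    using input_ok_frame[of s "{RealVar ''cnt'', RealVar x}"] st that
    by (auto simp: bracket_state_def frame_def input_locs_def)
  then show ?thesis
    using st \<gamma> vals
    by (simp add: decide_def runs_Cond runs_atomic bracket_state_def bisect_defs refutes_def
        quad_form_pencil[OF y] not_le)
qed

definition search_state :: "(nat \<Rightarrow> real) \<Rightarrow> nat \<Rightarrow> state \<Rightarrow> bool" where
  "search_state \<omega> k s \<longleftrightarrow> bracket_state k (search k \<omega>) s \<and> drawn s = k * n"

definition final_state :: "(nat \<Rightarrow> real) \<Rightarrow> nat \<Rightarrow> state \<Rightarrow> bool" where
  "final_state \<omega> k s \<longleftrightarrow> nvar s ''done'' = 1 \<and> rvar s ''xi'' = guess (candidate k \<omega>) \<and>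
     rvar s ''gamma'' = mid (candidate k \<omega>)"

lemma runs_search_step:
  assumes top: "search_state \<omega> k s" and inv: "search_inv k (candidate k \<omega>)"
  shows "runs \<omega> search_step s ((degree k (candidate k \<omega>) + 2) * (1000 * nnz))
    (\<lambda>s'. if rejected k \<omega> then search_state \<omega> (Suc k) s' else final_state \<omega> k s')"
  unfolding search_step_def
proof (rule runs_SeqI)
  let ?b = "candidate k \<omega>" and ?y = "probe k \<omega>"
  let ?Q = "\<lambda>s'. if rejected k \<omega> then search_state \<omega> (Suc k) s' else final_state \<omega> k s'"
  show "runs \<omega> reset_bracket s 50 (bracket_state k ?b)"
    unfolding candidate_def using top by (intro runs_reset_bracket) (simp add: search_state_def)
  fix s1 assume st1: "bracket_state k ?b s1" and fr1: "frame (writes reset_bracket) s s1"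
  have tape1: "drawn s1 = k * n"
    using frameD(5)[OF fr1] top by (simp add: search_state_def reset_bracket_def)
  show "runs \<omega> (Seq run_filter (Seq evaluate_probe decide)) s1
      (60 + 100 * Suc n + Suc (degree k ?b) * (1000 * nnz) + (6 + 100 * (nnz + n + 3) + 100)) ?Q"
  proof (rule runs_SeqI[OF runs_run_filter[OF st1 tape1 inv]])
    fix s2 assume s2: "array_vec n s2 ''w'' = filtered k \<omega> ?b \<and> rvar s2 ''gamma'' = mid ?b \<and>
        drawn s2 = Suc k * n"
      and fr2: "frame (writes run_filter) s1 s2"
    have st2: "bracket_state k ?b s2"
      by (rule bracket_state_frame[OF st1 fr2]) (simp add: bracket_locs_def input_locs_def)
    have y2: "array_vec n s2 ''w'' = ?y" using s2 by (simp add: probe_def)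
    have ok2: "input_ok s2" using st2 by (simp add: bracket_state_def)
    show "runs \<omega> (Seq evaluate_probe decide) s2 (6 + 100 * (nnz + n + 3) + 100) ?Q"
    proof (rule runs_SeqI[OF runs_evaluate_probe[OF ok2 y2]])
      fix s3 assume vals: "rvar s3 ''a0'' = quad_form A0 ?y \<and> rvar s3 ''a1'' = quad_form A1 ?y \<and>
          rvar s3 ''nn'' = ?y \<bullet> ?y"
        and fr3: "frame (writes evaluate_probe) s2 s3"
      have st3: "bracket_state k ?b s3"
        by (rule bracket_state_frame[OF st2 fr3]) (simp add: bracket_locs_def input_locs_def)
      have "rvar s3 ''gamma'' = mid ?b" "drawn s3 = Suc k * n"
        using s2 by (simp_all add: frameD[OF fr3])
      then show "runs \<omega> decide s3 100 ?Q"
        using vals by (intro runs_mono[OF runs_decide[OF st3 _ probe_carrier]])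
          (auto simp: search_state_def final_state_def search_Suc simp del: search.simps)
    qed simp
  qed simp
qed (use nnz_bounds in simp)

lemma search_state_init:
  fixes b0 c0 b1 c1
  defines "s \<equiv> input_state n A0 b0 c0 A1 b1 c1 xs0 xs1 \<zeta> p"
  shows "search_state \<omega> 0 (s\<lparr>rvar := (rvar s)(''xi'' := 1, ''r'' := \<zeta>)\<rparr>)"
  by (simp add: s_def search_state_def bracket_state_def input_ok_def holds_matrix_def
    input_state_def array_of_def)

lemma runs_search_loop:
  assumes top: "search_state \<omega> 0 s" and K: "\<not> rejected K \<omega>" "\<And>k. k < K \<Longrightarrow> rejected k \<omega>"
    and M: "\<And>k. k \<le> K \<Longrightarrow> degree k (candidate k \<omega>) \<le> M"
  shows "runs \<omega> (While (NLe (NVar ''done'') (NConst 0)) search_step) s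
      (Suc K * ((M + 2) * (1100 * nnz)) + 4) (final_state \<omega> K)"
proof -
  let ?b = "NLe (NVar ''done'') (NConst 0)"
  let ?I = "\<lambda>k s. if k \<le> K then search_state \<omega> k s else final_state \<omega> K s"
  have "runs \<omega> (While ?b search_step) s (Suc K * ((M + 2) * (1100 * nnz)) + 4) (?I (Suc K))"
  proof (rule runs_While[where I = ?I and T = "(M + 2) * (1000 * nnz)"])
    show "?I 0 s" using top by simp
  next
    fix k s assume k: "k < Suc K" and "?I k s"
    then have top: "search_state \<omega> k s" by simp
    have "runs \<omega> search_step s ((M + 2) * (1000 * nnz)) (?I (Suc k))"
    proof (rule runs_mono[OF runs_search_step[OF top search_inv_candidate(1)]])
      show "(degree k (candidate k \<omega>) + 2) * (1000 * nnz) \<le> (M + 2) * (1000 * nnz)"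
        using M[of k] k by (intro mult_le_mono1) simp
      fix s' assume "if rejected k \<omega> then search_state \<omega> (Suc k) s' else final_state \<omega> k s'"
      then show "?I (Suc k) s'" using K k by (cases "k = K") auto
    qed (use K(2) k in simp)
    then show "bval ?b s \<and> runs \<omega> search_step s ((M + 2) * (1000 * nnz)) (?I (Suc k))"
      using top by (simp add: search_state_def bracket_state_def)
  next
    show "\<not> bval ?b s" if "?I (Suc K) s" for s using that by (simp add: final_state_def)
  next
    have guard_cost: "1 + bcost ?b = 4" by simp
    have "1 * 1 \<le> (M + 2) * nnz" using nnz_bounds by (intro mult_le_mono) auto
    then have "4 + (M + 2) * (1000 * nnz) \<le> (M + 2) * (1100 * nnz)" by simp
    then have "Suc K * (4 + (M + 2) * (1000 * nnz)) + 4 \<le> Suc K * ((M + 2) * (1100 * nnz)) + 4"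
      by (intro add_right_mono mult_le_mono2)
    then show "Suc K * (1 + bcost ?b + (M + 2) * (1000 * nnz)) + (1 + bcost ?b)
        \<le> Suc K * ((M + 2) * (1100 * nnz)) + 4" by (simp only: guard_cost)
  qed
  then show ?thesis by (rule runs_mono) auto
qed

lemma runs_approx_xi:
  assumes "\<not> rejected K \<omega>" "\<And>k. k < K \<Longrightarrow> rejected k \<omega>"
    and "\<And>k. k \<le> K \<Longrightarrow> degree k (candidate k \<omega>) \<le> M"
  shows "runs \<omega> approx_xi (input_state n A0 b0 c0 A1 b1 c1 xs0 xs1 \<zeta> p)
      (Suc K * ((M + 2) * (1108 * nnz))) (final_state \<omega> K)"
proof -
  define s where "s = input_state n A0 b0 c0 A1 b1 c1 xs0 xs1 \<zeta> p"
  define U where "U = Suc K * ((M + 2) * (1100 * nnz))"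
  have "runs \<omega> (While (NLe (NVar ''done'') (NConst 0)) search_step)
      (s\<lparr>rvar := (rvar s)(''xi'' := 1, ''r'' := \<zeta>)\<rparr>) (U + 4) (final_state \<omega> K)"
    unfolding s_def U_def using assms by (intro runs_search_loop search_state_init)
  moreover have "rvar s ''zeta'' = \<zeta>" by (simp add: s_def input_state_def)
  ultimately have "runs \<omega> approx_xi s (U + 8) (final_state \<omega> K)"
    by (simp add: approx_xi_def runs_atomic add.commute)
  moreover have "U + 8 \<le> Suc K * ((M + 2) * (1108 * nnz))"
  proof -
    have "1 * (1 * 1) \<le> Suc K * ((M + 2) * nnz)" using nnz_bounds by (intro mult_le_mono) auto
    moreover have "Suc K * ((M + 2) * (c * nnz)) = c * (Suc K * ((M + 2) * nnz))" for c
      by (simp only: mult_ac)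
    ultimately show ?thesis unfolding U_def by linarith
  qed
  ultimately show ?thesis unfolding s_def by (rule runs_mono)
qed

lemma total_time_le:
  assumes K: "K < Suc max_halvings * Suc max_bisections"
    and M: "real M + 2 \<le> 141 * (Lnp * LL * sqrt (\<zeta> / \<xi>star))"
  shows "real (Suc K * ((M + 2) * (1108 * nnz))) \<le> 8000000 * time_bound nnz n \<zeta> \<xi>star p * LL"
proof -
  let ?S = "sqrt (\<zeta> / \<xi>star)"
  have "real (Suc K) \<le> 50 * (L\<zeta> * L\<xi>\<^sup>2)"
    using K max_tests_le by (meson Suc_leI of_nat_mono order_trans)
  then have "real (Suc K) * ((real M + 2) * (1108 * real nnz))
      \<le> (50 * (L\<zeta> * L\<xi>\<^sup>2)) * ((141 * (Lnp * LL * ?S)) * (1108 * real nnz))"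
    using M lg_ge_1[of \<zeta>] by (intro mult_mono) auto
  also have "\<dots> = 7811400 * (real nnz * ?S * Lnp * L\<zeta> * L\<xi>\<^sup>2 * LL)" by (simp add: algebra_simps)
  also have "\<dots> \<le> 8000000 * (real nnz * ?S * Lnp * L\<zeta> * L\<xi> ^ 3 * LL)"
  proof -
    have "0 \<le> lg x" for x using lg_ge_1[of x] by linarith
    moreover have "L\<xi>\<^sup>2 \<le> L\<xi> ^ 3" using lg_ge_1 by (intro power_increasing) auto
    ultimately show ?thesis
      using loglog_factor_ge_1[of n \<zeta> \<xi>star p] zeta_ge_1 xi_star_pos
      by (intro mult_mono mult_nonneg_nonneg) auto
  qed
  finally show ?thesis by (simp add: time_bound_def mult.assoc algebra_simps)
qed

lemma approx_xi_correct:
  assumes \<omega>: "\<omega> \<in> lucky"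
  obtains t s where "exec \<omega> approx_xi (input_state n A0 b0 c0 A1 b1 c1 xs0 xs1 \<zeta> p) t s"
    "\<xi>star / 4 \<le> rvar s ''xi''" "rvar s ''xi'' \<le> \<xi>star" "rvar s ''xi'' \<le> lmin (rvar s ''gamma'')"
    "real t \<le> 8000000 * time_bound nnz n \<zeta> \<xi>star p * LL"
proof -
  obtain K where K: "\<not> rejected K \<omega>" "\<And>k. k < K \<Longrightarrow> rejected k \<omega>"
    using ex_first_accepted[of \<omega>] by metis
  have inv: "search_inv k (candidate k \<omega>)"
    "k < Suc max_halvings * Suc max_bisections" if "k \<le> K" for k
    using that K(2) search_inv_candidate[of k \<omega>] by (meson less_le_trans)+
  define M where "M = Max ((\<lambda>k. degree k (candidate k \<omega>)) ` {..K})"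
  have M: "degree k (candidate k \<omega>) \<le> M" if "k \<le> K" for k
    unfolding M_def using that by (intro Max_ge) auto
  have "M \<in> (\<lambda>k. degree k (candidate k \<omega>)) ` {..K}" unfolding M_def by (rule Max_in) auto
  then have degree: "real M + 2 \<le> 141 * (Lnp * LL * sqrt (\<zeta> / \<xi>star))"
    using degree_le[OF inv] by auto
  from runs_approx_xi[OF K M] obtain t s where
    exec: "exec \<omega> approx_xi (input_state n A0 b0 c0 A1 b1 c1 xs0 xs1 \<zeta> p) t s"
    and t: "t \<le> Suc K * ((M + 2) * (1108 * nnz))" and final: "final_state \<omega> K s"
    unfolding runs_def by blast
  note bounds = search_inv_bounds[OF inv(1)[OF le_refl]]
  have registers: "rvar s ''xi'' = guess (candidate K \<omega>)" "rvar s ''gamma'' = mid (candidate K \<omega>)"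
    using final by (simp_all add: final_state_def)
  have certified: "guess (candidate K \<omega>) \<le> lmin (mid (candidate K \<omega>))"
    by (rule accepted_guess_le_lmin[OF \<omega> inv(1)[OF le_refl] K(1)])
  have "real t \<le> real (Suc K * ((M + 2) * (1108 * nnz)))" using t by (rule of_nat_mono)
  also have "\<dots> \<le> 8000000 * time_bound nnz n \<zeta> \<xi>star p * LL"
    by (rule total_time_le[OF inv(2)[OF le_refl] degree])
  finally show thesis
    using that exec bounds(5) certified le_xi_star[OF bounds(3) certified]
    unfolding registers[symmetric] by blast
qed

end

lemma definite_pencil_if_assumption_A:
  "assumption_A n A0 b0 c0 A1 b1 c1 \<Longrightarrow> definite_pencil n A0 A1"
  by unfold_locales (auto simp: assumption_A_def)

lemma approx_xi_guarantee:
  assumes A: "assumption_A n A0 b0 c0 A1 b1 c1"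
    and xs: "lists_nonzeros xs0 A0" "lists_nonzeros xs1 A1"
    and \<zeta>: "zeta_star A0 A1 \<le> \<zeta>" and p: "0 < p"
  shows "\<exists>E\<in>sets random_tape. 1 - p \<le> measure random_tape E \<and> (\<forall>\<omega>\<in>E. \<exists>t s.
    exec \<omega> approx_xi (input_state n A0 b0 c0 A1 b1 c1 xs0 xs1 \<zeta> p) t s \<and>
    xi_star A0 A1 / 4 \<le> rvar s ''xi'' \<and> rvar s ''xi'' \<le> xi_star A0 A1 \<and>
    rvar s ''xi'' \<le> lambda_min (pencil A0 A1 (rvar s ''gamma'')) \<and>
    real t \<le> 8000000 * time_bound (card (nonzeros A0) + card (nonzeros A1)) n \<zeta> (xi_star A0 A1) p
      * loglog_factor n \<zeta> (xi_star A0 A1) p)"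
    (is "\<exists>E\<in>_. _ \<and> (\<forall>\<omega>\<in>E. ?guarantee \<omega>)")
proof (cases "p < 1")
  case True
  interpret definite_pencil n A0 A1 by (rule definite_pencil_if_assumption_A[OF A])
  interpret gtrs_run n A0 A1 \<zeta> p xs0 xs1 using xs \<zeta> p True by unfold_locales
  have "?guarantee \<omega>" if "\<omega> \<in> lucky" for \<omega>
    using approx_xi_correct[OF that] unfolding nnz_eq_card by metis
  then show ?thesis using lucky_sets prob_lucky_ge by blast
next
  case False
  then show ?thesis by (intro bexI[of _ "{}"]) auto
qed

theorem theorem8:
  shows "\<exists>(ApproxXi :: com) (C :: real) (k :: nat).
    \<forall>(n :: nat) (A0 :: real mat) (b0 :: real vec) (c0 :: real)
      (A1 :: real mat) (b1 :: real vec) (c1 :: real)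
      (xs0 :: (nat \<times> nat) list) (xs1 :: (nat \<times> nat) list) (\<zeta> :: real) (p :: real).
      assumption_A n A0 b0 c0 A1 b1 c1 \<and> lists_nonzeros xs0 A0 \<and> lists_nonzeros xs1 A1 \<and>
      zeta_star A0 A1 \<le> \<zeta> \<and> 0 < p \<longrightarrow>
      (\<exists>E \<in> sets random_tape. measure random_tape E \<ge> 1 - p \<and>
        (\<forall>\<omega> \<in> E. \<exists>t s.
          exec \<omega> ApproxXi (input_state n A0 b0 c0 A1 b1 c1 xs0 xs1 \<zeta> p) t s \<and>
          xi_star A0 A1 / 4 \<le> rvar s ''xi'' \<and> rvar s ''xi'' \<le> xi_star A0 A1 \<and>
          lambda_min (pencil A0 A1 (rvar s ''gamma'')) \<ge> rvar s ''xi'' \<and>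
          real t \<le> C * time_bound (card (nonzeros A0) + card (nonzeros A1)) n \<zeta> (xi_star A0 A1) p
                     * loglog_factor n \<zeta> (xi_star A0 A1) p ^ k))"
  using approx_xi_guarantee
  by (intro exI[of _ approx_xi] exI[of _ 8000000] exI[of _ 1]) (unfold power_one_right, blast)

end
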